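(* Let $b\colon\mathbb{T}\to\mathbb{R}$ be smooth with finitely many critical points $\{y_1,\dots,y_M\}$, and suppose there is $N\in\mathbb{N}$ such that for each $1\le i\le M$ one has $b^{(k)}(y_i)\neq0$ for some $1\le k\le N+1$; let $N$ denote the minimal natural number with this property. Then $u(x,y)=(b(y),0)$ is dissipation enhancing with rate function $\lambda(\nu)=\nu^{\frac{N+1}{N+3}}$.
   Context: $\mathbb{T}=\mathbb{R}/\mathbb{Z}$ and $\mathbb{N}=\{1,2,\dots\}$. For $b\colon\mathbb{T}\to\mathbb{R}$, the flow $u(x,y)=(b(y),0)$ on $\mathbb{T}^2$ is dissipation enhancing with rate function $\lambda\colon(0,1)\to(0,\infty)$ if $\lim_{\nu\to0}\nu/\lambda(\nu)=0$ and there exist constants $C,c>0$ (independent of $\nu$) such that for all $\nu\in(0,1)$ and all $f_0\in L^2(\mathbb{T}^2)$ with $\int_{\mathbb{T}}f_0(x,y)\,dx=0$ for all $y\in\mathbb{T}$, the solution of $\partial_tf+b(y)\partial_xf=\nu\Delta f$, $f|_{t=0}=f_0$ on $\mathbb{T}^2$ satisfies $\|f(t)\|_{L^2}\le Ce^{-c\lambda(\nu)t}\|f_0\|_{L^2}$ for all $t\ge0$. *)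

theory Defs
  imports "HOL-Analysis.Analysis" "HOL-Library.Periodic_Fun"
begin

text \<open>
  Continuous or smooth functions on the circle \<open>\<real>/\<int>\<close> are represented by \<open>1\<close>-periodic functions
  on \<open>\<real>\<close> (and similarly on the torus).  For integration and for \<open>L\<^sup>2\<close>, the circle is represented
  by its fundamental domain \<open>[0,1)\<close>, so that the values of an \<open>L\<^sup>2\<close> function outside
  \<open>[0,1) \<times> [0,1)\<close> are irrelevant.  Elements of \<open>L\<^sup>2\<close> are real-valued representatives; all notions
  below only depend on their almost-everywhere classes.
\<close>

definition circle :: "real measure" where
  "circle = restrict_space lborel {0..<1}"

definition torus :: "(real \<times> real) measure" where
  "torus = circle \<Otimes>\<^sub>M circle"

definition in_L2 :: "(real \<times> real \<Rightarrow> real) \<Rightarrow> bool" where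
  "in_L2 f \<longleftrightarrow> f \<in> borel_measurable torus \<and> integrable torus (\<lambda>p. (f p)\<^sup>2)"

definition L2_norm :: "(real \<times> real \<Rightarrow> real) \<Rightarrow> real" where
  "L2_norm f = sqrt (LINT p|torus. (f p)\<^sup>2)"

definition smooth :: "(real \<Rightarrow> real) \<Rightarrow> bool" where
  "smooth b \<longleftrightarrow> (\<forall>k x. (deriv ^^ k) b differentiable at x)"

definition circle_critical_points :: "(real \<Rightarrow> real) \<Rightarrow> real set" where
  "circle_critical_points b = {y \<in> {0..<1}. deriv b y = 0}"

definition partial_x :: "(real \<times> real \<Rightarrow> real) \<Rightarrow> real \<times> real \<Rightarrow> real" where
  "partial_x \<phi> = (\<lambda>(x, y). deriv (\<lambda>s. \<phi> (s, y)) x)"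

definition partial_y :: "(real \<times> real \<Rightarrow> real) \<Rightarrow> real \<times> real \<Rightarrow> real" where
  "partial_y \<phi> = (\<lambda>(x, y). deriv (\<lambda>s. \<phi> (x, s)) y)"

definition laplacian :: "(real \<times> real \<Rightarrow> real) \<Rightarrow> real \<times> real \<Rightarrow> real" where
  "laplacian \<phi> p = partial_x (partial_x \<phi>) p + partial_y (partial_y \<phi>) p"

text \<open>\<open>C_k k \<phi>\<close>: all iterated partial derivatives of \<open>\<phi>\<close> up to order \<open>k\<close> exist and are continuous.\<close>

fun C_k :: "nat \<Rightarrow> (real \<times> real \<Rightarrow> real) \<Rightarrow> bool" where
  "C_k 0 \<phi> \<longleftrightarrow> continuous_on UNIV \<phi>"
| "C_k (Suc k) \<phi> \<longleftrightarrow> continuous_on UNIV \<phi> \<and>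
     (\<forall>x y. (\<lambda>s. \<phi> (s, y)) differentiable at x \<and> (\<lambda>s. \<phi> (x, s)) differentiable at y) \<and>
     C_k k (partial_x \<phi>) \<and> C_k k (partial_y \<phi>)"

definition test_function :: "(real \<times> real \<Rightarrow> real) \<Rightarrow> bool" where
  "test_function \<phi> \<longleftrightarrow> (\<forall>k. C_k k \<phi>) \<and> (\<forall>x y. \<phi> (x + 1, y) = \<phi> (x, y) \<and> \<phi> (x, y + 1) = \<phi> (x, y))"

text \<open>
  Since the initial datum is only in \<open>L\<^sup>2\<close>, the equation \<open>\<partial>\<^sub>t f + b(y) \<partial>\<^sub>x f = \<nu> \<Delta> f\<close> is understood weakly:
  \<open>f\<close> is continuous from \<open>[0,\<infinity>)\<close> to \<open>L\<^sup>2\<close>, and all derivatives are moved onto the test function,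
  where \<open>\<integral> b(y) (\<partial>\<^sub>x f) \<phi> = - \<integral> f b(y) \<partial>\<^sub>x \<phi>\<close> because \<open>b\<close> does not depend on \<open>x\<close>.
\<close>

definition weak_solution ::
    "(real \<Rightarrow> real) \<Rightarrow> real \<Rightarrow> (real \<times> real \<Rightarrow> real) \<Rightarrow> (real \<Rightarrow> real \<times> real \<Rightarrow> real) \<Rightarrow> bool" where
  "weak_solution b \<nu> f0 f \<longleftrightarrow>
     (\<forall>t\<ge>0. in_L2 (f t)) \<and>
     (\<forall>t\<ge>0. ((\<lambda>s. L2_norm (\<lambda>p. f s p - f t p)) \<longlongrightarrow> 0) (at t within {0..})) \<and>
     (AE p in torus. f 0 p = f0 p) \<and>
     (\<forall>\<phi>. test_function \<phi> \<longrightarrow> (\<forall>t>0.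
        ((\<lambda>s. LINT p|torus. f s p * \<phi> p) has_real_derivative
           (LINT p|torus. f t p * (b (snd p) * partial_x \<phi> p + \<nu> * laplacian \<phi> p))) (at t)))"

text \<open>
  Dissipation enhancement of the shear flow \<open>(x, y) \<mapsto> (b y, 0)\<close>.  The rate function is a function
  on \<open>(0,1)\<close>; its values elsewhere are irrelevant.
\<close>

definition shear_dissipation_enhancing :: "(real \<Rightarrow> real) \<Rightarrow> (real \<Rightarrow> real) \<Rightarrow> bool" where
  "shear_dissipation_enhancing b rate \<longleftrightarrow>
     (\<forall>\<nu>\<in>{0<..<1}. rate \<nu> > 0) \<and>
     ((\<lambda>\<nu>. \<nu> / rate \<nu>) \<longlongrightarrow> 0) (at_right 0) \<and>
     (\<exists>C>0. \<exists>c>0. \<forall>\<nu>\<in>{0<..<1}. \<forall>f0 f.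
        in_L2 f0 \<longrightarrow> (AE y in circle. (LINT x|circle. f0 (x, y)) = 0) \<longrightarrow>
        weak_solution b \<nu> f0 f \<longrightarrow>
        (\<forall>t\<ge>0. L2_norm (f t) \<le> C * exp (- c * rate \<nu> * t) * L2_norm f0))"

definition nondegeneracy_bound :: "(real \<Rightarrow> real) \<Rightarrow> nat \<Rightarrow> bool" where
  "nondegeneracy_bound b n \<longleftrightarrow>
     n \<ge> 1 \<and> (\<forall>y\<in>circle_critical_points b. \<exists>k\<in>{1..n + 1}. (deriv ^^ k) b y \<noteq> 0)"

end

theory Submission
  imports Defs
begin

text \<open>
  A mode \<open>e\<^sup>i\<^sup>q\<^sup>x G(t,y)\<close> of the solution satisfies \<open>\<partial>\<^sub>t G = - i q b G + \<nu> (G'' - q\<^sup>2 G)\<close>.  The decay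
  comes from the functional
  \<open>\<Phi> = \<integral> \<bar>G\<bar>\<^sup>2 + \<theta>/q Im \<integral> w(y) G(y+h) cnj (G(y)) dy\<close>, which is comparable to the squared norm because
  \<open>w\<close> is bounded.  Using the finite shift \<open>G(y+h)\<close> instead of the usual \<open>G'(y)\<close> avoids second derivatives,
  and therefore the loss of a logarithm.  The transport term produces
  \<open>- \<theta> \<integral> w(y) (b(y+h) - b(y)) Re (G(y+h) cnj (G(y)))\<close>.  Take \<open>\<delta> ~ \<nu>\<^bsup>1/(N+3)\<^esup>\<close>, \<open>h = \<kappa> \<delta>\<close> and
  \<open>w = \<delta>\<^sup>N b' / (\<Sum>j\<le>N. \<delta>\<^bsup>2j\<^esup> (b\<^bsup>(j+1)\<^esup>)\<^sup>2)\<close>.  Then \<open>w\<close> is bounded, \<open>w'\<close> is of size \<open>1/\<delta>\<close>, and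
  \<open>w (b(y+h) - b(y))\<close> is of size \<open>\<delta>\<^bsup>N+1\<^esup>\<close> away from the \<open>\<delta>\<close>-neighbourhoods of finitely many points.
  These neighbourhoods carry little mass by the one-dimensional Sobolev inequality, all other errors are
  absorbed by the dissipation \<open>\<nu> \<integral> \<bar>G'\<bar>\<^sup>2\<close>, and \<open>\<Phi>\<close> decays at rate \<open>\<delta>\<^bsup>N+1\<^esup> ~ \<nu>\<^bsup>(N+1)/(N+3)\<^esup>\<close>.

  Weak solutions are not differentiable in \<open>y\<close>, so the estimate is applied to their Fejer means, which
  solve the equation up to a commutator that vanishes uniformly.  The modes are summed by Bessel's
  inequality at time \<open>0\<close> and by the density of trigonometric polynomials at time \<open>t\<close>.
\<close>

subsection \<open>Periodic functions and nondegenerate critical points\<close>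

text \<open>The scale \<delta> balances two rates. Next to a critical point of the highest order, b
  varies by about \<delta>^(N+1) over a distance \<delta>, while viscosity acts over that distance
  at rate \<nu>/\<delta>^2. Equating them gives \<delta>^(N+3) = \<nu>, and both rates become
  \<nu>^((N+1)/(N+3)). The denominator of w is the squared size of all derivatives of b up to order
  N+1 as seen at scale \<delta>; it controls each of them, whatever the order of vanishing at the
  point in question. The second concern is uniformity in the frequency q. Dividing the cross term by
  q cancels the q of the transport term, so the gain is the same for every mode, and the only error
  growing with q is \<nu> q^2 times the mass, which the energy dissipates anyway. The commutator
  error is not uniform in the modes, so it is sent to zero for finitely many modes at a fixed time
  before the set of modes grows.\<close>

lemma smooth_has_derivative:
  assumes "smooth b"
  shows "((deriv ^^ k) b has_real_derivative (deriv ^^ Suc k) b x) (at x)"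
  using assms by (auto simp: smooth_def DERIV_deriv_iff_real_differentiable)

lemma periodic_iterated_deriv:
  fixes b :: "real \<Rightarrow> real"
  assumes "\<And>x. b (x + 1) = b x"
  shows "(deriv ^^ k) b (x + 1) = (deriv ^^ k) b x"
proof (induction k arbitrary: x)
  case 0
  then show ?case using assms by simp
next
  case (Suc k)
  let ?f = "(deriv ^^ k) b"
  have "(?f has_real_derivative d) (at (x + 1)) \<longleftrightarrow> (?f has_real_derivative d) (at x)" for d
    using DERIV_shift[of ?f d x 1] Suc by simp
  then have "deriv ?f (x + 1) = deriv ?f x" unfolding deriv_def by simp
  then show ?case by simp
qed

lemma periodic_shift_int:
  fixes f :: "real \<Rightarrow> 'a"
  assumes "\<And>x. f (x + 1) = f x"
  shows "f (x + of_int n) = f x"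
proof -
  interpret periodic_fun_simple' f by unfold_locales (rule assms)
  show ?thesis by (rule plus_of_int)
qed

lemma periodic_frac:
  fixes f :: "real \<Rightarrow> 'a"
  assumes "\<And>x. f (x + 1) = f x"
  shows "f (frac x) = f x"
  using periodic_shift_int[of f "frac x" "\<lfloor>x\<rfloor>"] assms by (simp add: frac_def)

lemma periodic_continuous_bounded:
  fixes f :: "real \<Rightarrow> 'a::real_normed_vector"
  assumes "\<And>x. f (x + 1) = f x" "continuous_on UNIV f"
  obtains B where "\<And>x. norm (f x) \<le> B"
proof -
  have "compact (f ` {0..1})"
    using assms(2) by (intro compact_continuous_image) (auto intro: continuous_on_subset)
  then obtain B where B: "\<And>x. x \<in> {0..1} \<Longrightarrow> norm (f x) \<le> B"
    by (metis (no_types) bounded_iff compact_imp_bounded imageI)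
  have "norm (f x) \<le> B" for x
    using B[of "frac x"] periodic_frac[of f, OF assms(1)]
    by (simp add: frac_lt_1 less_imp_le)
  then show ?thesis using that by blast
qed

lemma iterated_deriv_bounded:
  assumes "smooth b" "\<And>x. b (x + 1) = b x"
  obtains B where "B \<ge> 1" "\<And>k x. k \<le> n \<Longrightarrow> \<bar>(deriv ^^ k) b x\<bar> \<le> B"
proof -
  have "\<exists>B. \<forall>x. norm ((deriv ^^ k) b x) \<le> B" for k
    using periodic_continuous_bounded[of "(deriv ^^ k) b"] periodic_iterated_deriv[of b, OF assms(2)]
      smooth_has_derivative[OF assms(1), of k] DERIV_continuous_on
    by (metis (no_types, lifting) has_field_derivative_at_within)
  then obtain B where B: "\<And>k x. norm ((deriv ^^ k) b x) \<le> B k" by metis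
  have nn: "B k \<ge> 0" for k using B[of k 0] norm_ge_zero order_trans by blast
  have "\<bar>(deriv ^^ k) b x\<bar> \<le> 1 + (\<Sum>i\<le>n. B i)" if "k \<le> n" for k x
    using B[of k x] member_le_sum[of k "{..n}" B] nn that by auto
  then show ?thesis using that[of "1 + (\<Sum>i\<le>n. B i)"] nn by (simp add: sum_nonneg)
qed

text \<open>All Taylor terms below the remainder vanish at y0. The case j = 0 bounds b' from below,
  larger j bound the higher derivatives from above.\<close>

lemma Taylor_vanishing:
  assumes "smooth b" "\<And>i. i < n \<Longrightarrow> (deriv ^^ Suc i) b y0 = 0" "j \<le> n"
  obtains \<xi> where "\<bar>\<xi> - y0\<bar> \<le> \<bar>y - y0\<bar>"
    "(deriv ^^ Suc j) b y = (deriv ^^ Suc n) b \<xi> / fact (n - j) * (y - y0) ^ (n - j)"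
\<comment> \<open>\<open>Taylor\<close> requires a positive order and two distinct points, so these
  cases are settled separately.\<close>
proof (cases "j = n \<or> y = y0")
  case True
  then consider "j = n" | "j < n" "y = y0" using assms(3) by linarith
  then show ?thesis
  proof cases
    case 1
    then show ?thesis using that[of y] by simp
  next
    case 2
    then show ?thesis using that[of y0] assms(2)[of j] by simp
  qed
next
  case False
  then have jn: "n - j > 0" "y \<noteq> y0" using assms(3) by auto
  have "\<exists>t. (if y < y0 then y < t \<and> t < y0 else y0 < t \<and> t < y) \<and>
    (deriv ^^ Suc j) b y = (\<Sum>m<n - j. (deriv ^^ (Suc j + m)) b y0 / fact m * (y - y0) ^ m)
      + (deriv ^^ (Suc j + (n - j))) b t / fact (n - j) * (y - y0) ^ (n - j)"
    by (rule Taylor[where a = "min y y0" and b = "max y y0"])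
       (use jn smooth_has_derivative[OF assms(1), of "Suc j + m" for m] in auto)
  then obtain t where t: "if y < y0 then y < t \<and> t < y0 else y0 < t \<and> t < y"
    and eq: "(deriv ^^ Suc j) b y = (\<Sum>m<n - j. (deriv ^^ (Suc j + m)) b y0 / fact m * (y - y0) ^ m)
      + (deriv ^^ (Suc j + (n - j))) b t / fact (n - j) * (y - y0) ^ (n - j)" by blast
  have "(\<Sum>m<n - j. (deriv ^^ (Suc j + m)) b y0 / fact m * (y - y0) ^ m) = 0"
  proof (intro sum.neutral ballI)
    fix m assume "m \<in> {..<n - j}"
    then have "(deriv ^^ Suc (j + m)) b y0 = 0" by (intro assms(2)) auto
    then show "(deriv ^^ (Suc j + m)) b y0 / fact m * (y - y0) ^ m = 0" by simp
  qed
  with eq have "(deriv ^^ Suc j) b y = (deriv ^^ Suc n) b t / fact (n - j) * (y - y0) ^ (n - j)"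
    using assms(3) by simp
  moreover have "\<bar>t - y0\<bar> \<le> \<bar>y - y0\<bar>" using t by (auto split: if_splits)
  ultimately show ?thesis using that by blast
qed

text \<open>Let n be the order of vanishing of b' at y0 and d the distance to y0. Nearby, b' is of
  size d^n, while b^(j+1) is at most of size d^(n-j) for j up to n, so each further derivative costs
  at most one factor d. A noncritical y0 is the case n = 0.\<close>

lemma derivatives_near_point:
  assumes sm: "smooth b" and bd: "\<And>k x. k \<le> Suc N \<Longrightarrow> \<bar>(deriv ^^ k) b x\<bar> \<le> B"
    and nz: "\<exists>k\<in>{1..N + 1}. (deriv ^^ k) b y0 \<noteq> 0"
  obtains r C where "r > 0" "C \<ge> 0"
    "\<And>y j. \<bar>y - y0\<bar> < r \<Longrightarrow> j \<le> N \<Longrightarrow> \<bar>(deriv ^^ Suc j) b y\<bar> * \<bar>y - y0\<bar> ^ j \<le> C * \<bar>deriv b y\<bar>"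
proof -
  define n where "n = (LEAST n. (deriv ^^ Suc n) b y0 \<noteq> 0)"
  obtain k where k: "k \<in> {1..N + 1}" "(deriv ^^ k) b y0 \<noteq> 0" using nz by blast
  then have k': "(deriv ^^ Suc (k - 1)) b y0 \<noteq> 0" by auto
  have n: "(deriv ^^ Suc n) b y0 \<noteq> 0" unfolding n_def using k' by (rule LeastI)
  have "n \<le> k - 1" unfolding n_def using k' by (rule Least_le)
  then have nN: "n \<le> N" using k by auto
  have van: "(deriv ^^ Suc i) b y0 = 0" if "i < n" for i
    using not_less_Least[of i "\<lambda>n. (deriv ^^ Suc n) b y0 \<noteq> 0"] that unfolding n_def by blast
  define g where "g = (deriv ^^ Suc n) b"
  define \<beta> where "\<beta> = \<bar>g y0\<bar> / 2"
  have \<beta>: "\<beta> > 0" using n by (simp add: \<beta>_def g_def)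
  have B0: "B \<ge> 0" using bd[of 0 0] by linarith
  have "isCont g y0" using smooth_has_derivative[OF sm, of "Suc n"] DERIV_isCont g_def by blast
  then obtain r where r: "r > 0" "\<And>y. \<bar>y - y0\<bar> < r \<Longrightarrow> \<bar>g y - g y0\<bar> < \<beta>"
    using \<beta> unfolding continuous_at_eps_delta dist_real_def by blast
  have gl: "\<bar>g y\<bar> \<ge> \<beta>" if "\<bar>y - y0\<bar> < r" for y
    using r(2)[OF that] unfolding \<beta>_def by linarith
  have main: "\<bar>(deriv ^^ Suc j) b y\<bar> * \<bar>y - y0\<bar> ^ j \<le> (B * fact n / \<beta>) * \<bar>deriv b y\<bar>"
    if y: "\<bar>y - y0\<bar> < min r 1" and j: "j \<le> N" for y j
  proof -
    let ?d = "\<bar>y - y0\<bar>"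
    have d: "0 \<le> ?d" "?d \<le> 1" using y by auto
    have up: "\<bar>(deriv ^^ Suc j) b y\<bar> * ?d ^ j \<le> B * ?d ^ n"
    proof (cases "j \<le> n")
      case True
      obtain \<xi> where \<xi>: "(deriv ^^ Suc j) b y = g \<xi> / fact (n - j) * (y - y0) ^ (n - j)"
        using Taylor_vanishing[OF sm van True, of y] unfolding g_def by metis
      have "\<bar>(deriv ^^ Suc j) b y\<bar> = \<bar>g \<xi>\<bar> / fact (n - j) * ?d ^ (n - j)"
        unfolding \<xi> by (simp add: abs_mult power_abs)
      also have "\<dots> \<le> B * ?d ^ (n - j)"
      proof (intro mult_right_mono)
        have "\<bar>g \<xi>\<bar> \<le> B" unfolding g_def using bd nN by (metis Suc_le_mono)
        moreover have "\<bar>g \<xi>\<bar> / fact (n - j) \<le> \<bar>g \<xi>\<bar> / 1"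
          by (intro divide_left_mono) (auto simp: fact_ge_1)
        ultimately show "\<bar>g \<xi>\<bar> / fact (n - j) \<le> B" by simp
      qed auto
      finally have "\<bar>(deriv ^^ Suc j) b y\<bar> * ?d ^ j \<le> B * ?d ^ (n - j) * ?d ^ j"
        by (intro mult_right_mono) auto
      also have "\<dots> = B * ?d ^ n" using True by (simp add: mult.assoc flip: power_add)
      finally show ?thesis .
    next
      \<comment> \<open>Beyond order n the derivatives are merely bounded; d at most 1 gives d^j at
        most d^n.\<close>
      case False
      then have "?d ^ j \<le> ?d ^ n" using d by (intro power_decreasing) auto
      then show ?thesis using bd[of "Suc j" y] j d B0 by (intro mult_mono) auto
    qed
    obtain \<xi> where \<xi>: "\<bar>\<xi> - y0\<bar> \<le> ?d" "deriv b y = g \<xi> / fact n * (y - y0) ^ n"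
      using Taylor_vanishing[OF sm van, of n 0 y] unfolding g_def by auto
    have "\<bar>deriv b y\<bar> = \<bar>g \<xi>\<bar> / fact n * ?d ^ n"
      unfolding \<xi> by (simp add: abs_mult power_abs)
    moreover have "\<dots> \<ge> \<beta> / fact n * ?d ^ n"
      using gl[of \<xi>] \<xi>(1) y by (intro mult_right_mono divide_right_mono) auto
    ultimately have "(B * fact n / \<beta>) * (\<beta> / fact n * ?d ^ n) \<le> (B * fact n / \<beta>) * \<bar>deriv b y\<bar>"
      using B0 \<beta> by (intro mult_left_mono) auto
    then show ?thesis using up \<beta> by simp
  qed
  show ?thesis
    using that[of "min r 1" "B * fact n / \<beta>"] main r(1) B0 \<beta> by simp
qed

text \<open>Compactness makes nondegeneracy uniform. Scaled by \<open>\<delta> ^ (2 * N)\<close>,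
  the bound keeps the denominator of the weight away from zero, at critical points too.\<close>

lemma periodic_nondegenerate_lower_bound:
  assumes sm: "smooth b" and per: "\<And>x. b (x + 1) = b x"
    and nz: "\<And>y. \<exists>k\<in>{1..N + 1}. (deriv ^^ k) b y \<noteq> 0"
  obtains c where "c > 0" "\<And>y. (\<Sum>j\<le>N. ((deriv ^^ Suc j) b y)\<^sup>2) \<ge> c"
proof -
  let ?f = "\<lambda>y. \<Sum>j\<le>N. ((deriv ^^ Suc j) b y)\<^sup>2"
  have "isCont ((deriv ^^ Suc j) b) y" for j y
    using smooth_has_derivative[OF sm] DERIV_isCont by blast
  then have c: "continuous_on {0..1} ?f"
    by (intro continuous_intros continuous_at_imp_continuous_on ballI) auto
  obtain z where z: "z \<in> {0..1}" "\<And>y. y \<in> {0..1} \<Longrightarrow> ?f z \<le> ?f y"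
    using continuous_attains_inf[OF _ _ c] by auto
  have "?f z > 0"
  proof -
    obtain k where k: "k \<in> {1..N + 1}" "(deriv ^^ k) b z \<noteq> 0" using nz by blast
    then have "((deriv ^^ Suc (k - 1)) b z)\<^sup>2 > 0" by auto
    moreover have "((deriv ^^ Suc (k - 1)) b z)\<^sup>2 \<le> ?f z"
      using k by (intro member_le_sum) auto
    ultimately show ?thesis by linarith
  qed
  moreover have "?f z \<le> ?f y" for y
  proof -
    have "?f (frac y) = ?f y"
      by (simp only: periodic_frac[of "(deriv ^^ Suc j) b" for j, OF periodic_iterated_deriv[of b, OF per]])
    then show ?thesis using z(2)[of "frac y"] by (simp add: frac_lt_1 less_imp_le)
  qed
  ultimately show ?thesis using that by blast
qed

text \<open>At distance at least \<delta> from a centre z, \<delta>^j is at most the j-th power of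
  that distance, and \<open>derivatives_near_point\<close> applies. Z collects the centres of a
  finite subcover of the unit interval, so it may contain noncritical points.\<close>

lemma nondegenerate_cover:
  assumes sm: "smooth b" and per: "\<And>x. b (x + 1) = b x"
    and nz: "\<And>y. \<exists>k\<in>{1..N + 1}. (deriv ^^ k) b y \<noteq> 0"
  obtains Z c where "finite Z" "0 < c" "c \<le> 1"
    "\<And>\<delta> y. 0 < \<delta> \<Longrightarrow> y \<in> {0..1} \<Longrightarrow> (\<And>z. z \<in> Z \<Longrightarrow> \<delta> \<le> \<bar>y - z\<bar>) \<Longrightarrow>
       c * (\<Sum>j\<le>N. \<delta> ^ (2 * j) * ((deriv ^^ Suc j) b y)\<^sup>2) \<le> (deriv b y)\<^sup>2"
proof -
  obtain B where B: "\<And>k x. k \<le> Suc N \<Longrightarrow> \<bar>(deriv ^^ k) b x\<bar> \<le> B"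
    using iterated_deriv_bounded[OF sm per] by metis
  have "\<forall>y0. \<exists>r C. r > 0 \<and> C \<ge> 0 \<and> (\<forall>y j. \<bar>y - y0\<bar> < r \<longrightarrow> j \<le> N \<longrightarrow>
      \<bar>(deriv ^^ Suc j) b y\<bar> * \<bar>y - y0\<bar> ^ j \<le> C * \<bar>deriv b y\<bar>)"
    using derivatives_near_point[OF sm B nz] by metis
  then obtain r C where r: "\<And>y0. r y0 > 0" and C: "\<And>y0. C y0 \<ge> 0"
    and rC: "\<And>y0 y j. \<bar>y - y0\<bar> < r y0 \<Longrightarrow> j \<le> N \<Longrightarrow>
      \<bar>(deriv ^^ Suc j) b y\<bar> * \<bar>y - y0\<bar> ^ j \<le> C y0 * \<bar>deriv b y\<bar>"
    by metis
  have "compact {0..1::real}" by simp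
  then obtain Z where Z: "Z \<subseteq> {0..1}" "finite Z" "{0..1} \<subseteq> (\<Union>z\<in>Z. ball z (r z))"
    by (rule compactE_image[of _ "{0..1}" "\<lambda>z. ball z (r z)"]) (use r in auto)
  define K where "K = 1 + (\<Sum>z\<in>Z. (C z)\<^sup>2)"
  have K: "K \<ge> 1" by (simp add: K_def sum_nonneg)
  have Kz: "(C z)\<^sup>2 \<le> K" if "z \<in> Z" for z
    using member_le_sum[of z Z "\<lambda>z. (C z)\<^sup>2"] that Z(2) by (simp add: K_def)
  have "1 / ((N + 1) * K) * (\<Sum>j\<le>N. \<delta> ^ (2 * j) * ((deriv ^^ Suc j) b y)\<^sup>2) \<le> (deriv b y)\<^sup>2"
    if \<delta>: "0 < \<delta>" and y: "y \<in> {0..1}" and far: "\<And>z. z \<in> Z \<Longrightarrow> \<delta> \<le> \<bar>y - z\<bar>" for \<delta> y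
  proof -
    obtain z where z: "z \<in> Z" "\<bar>y - z\<bar> < r z" using Z(3) y by (auto simp: dist_real_def abs_minus_commute)
    have "\<delta> ^ (2 * j) * ((deriv ^^ Suc j) b y)\<^sup>2 \<le> K * (deriv b y)\<^sup>2" if j: "j \<le> N" for j
    proof -
      have "\<delta> ^ j * \<bar>(deriv ^^ Suc j) b y\<bar> \<le> \<bar>y - z\<bar> ^ j * \<bar>(deriv ^^ Suc j) b y\<bar>"
        using far[OF z(1)] \<delta> by (intro mult_right_mono power_mono) auto
      also have "\<dots> \<le> C z * \<bar>deriv b y\<bar>" using rC[OF z(2) j] by (simp add: mult.commute)
      finally have "(\<delta> ^ j * \<bar>(deriv ^^ Suc j) b y\<bar>)\<^sup>2 \<le> (C z * \<bar>deriv b y\<bar>)\<^sup>2"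
        using \<delta> by (intro power_mono) auto
      also have "\<dots> \<le> K * (deriv b y)\<^sup>2"
        using Kz[OF z(1)] by (simp add: power_mult_distrib mult_right_mono)
      finally show ?thesis by (simp add: power_mult_distrib power_even_eq power2_abs)
    qed
    then have "(\<Sum>j\<le>N. \<delta> ^ (2 * j) * ((deriv ^^ Suc j) b y)\<^sup>2) \<le> (\<Sum>j\<le>N. K * (deriv b y)\<^sup>2)"
      by (intro sum_mono) auto
    then have "(\<Sum>j\<le>N. \<delta> ^ (2 * j) * ((deriv ^^ Suc j) b y)\<^sup>2) \<le> (deriv b y)\<^sup>2 * ((N + 1) * K)"
      by (simp add: algebra_simps)
    moreover have "(N + 1) * K > 0" using K by (intro mult_pos_pos) auto
    ultimately show ?thesis by (simp add: pos_divide_le_eq)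
  qed
  moreover have "(N + 1) * K \<ge> 1 * 1" using K by (intro mult_mono) auto
  ultimately show ?thesis
    using that[of Z "1 / ((N + 1) * K)"] Z(2) K by (auto simp: field_simps)
qed

subsection \<open>The weight function\<close>

text \<open>The interface between the geometry of b and the energy estimates;
  \<open>shear_weight\<close> supplies it with C, c and Z independent of \<delta>. The density p is
  the fraction of the ideal gain \<kappa> \<delta>^(N+1) that transport realises at y.\<close>

definition admissible_weight ::
    "(real \<Rightarrow> real) \<Rightarrow> nat \<Rightarrow> real \<Rightarrow> real \<Rightarrow> real set \<Rightarrow> real \<Rightarrow>
     (real \<Rightarrow> real) \<Rightarrow> (real \<Rightarrow> real) \<Rightarrow> (real \<Rightarrow> real) \<Rightarrow> bool" where
  "admissible_weight b N C c Z \<delta> w w' p \<longleftrightarrow>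
       (\<forall>y. (w has_real_derivative w' y) (at y)) \<and> continuous_on UNIV w' \<and> continuous_on UNIV p \<and>
       (\<forall>y. w (y + 1) = w y) \<and> (\<forall>y. \<bar>w y\<bar> \<le> C) \<and> (\<forall>y. \<bar>w' y\<bar> \<le> C / \<delta>) \<and>
       (\<forall>y. 0 \<le> p y \<and> p y \<le> 1) \<and>
       (\<forall>\<kappa> y. 0 < \<kappa> \<longrightarrow> \<kappa> \<le> 1 \<longrightarrow>
          \<bar>w y * (b (y + \<kappa> * \<delta>) - b y) - \<kappa> * \<delta> ^ (N + 1) * p y\<bar> \<le> C * \<kappa>\<^sup>2 * \<delta> ^ (N + 1)) \<and>
       (\<forall>y\<in>{0..1}. p y < c \<longrightarrow> (\<exists>z\<in>Z. \<bar>y - z\<bar> < \<delta>))"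

text \<open>Everything is compared with e, the square root of the denominator E of w: each
  \<delta>^j b^(j+1) with j at most N is at most e in modulus, and \<delta>^N is at most a constant
  times e. A numerator made of two such factors is therefore absorbed by E. The linear Taylor term
  of b(y+h) - b(y) produces p exactly, and all later terms carry at least \<kappa>^2.\<close>

lemma shear_weight:
  assumes sm: "smooth b" and per: "\<And>x. b (x + 1) = b x"
    and nz: "\<And>y. \<exists>k\<in>{1..N + 1}. (deriv ^^ k) b y \<noteq> 0"
  obtains C c Z where "C \<ge> 1" "0 < c" "c \<le> 1" "finite Z"
    "\<And>\<delta>. 0 < \<delta> \<Longrightarrow> \<delta> \<le> 1 \<Longrightarrow> \<exists>w w' p.
       admissible_weight b N C c Z \<delta> w w' p"
proof -
  let ?D = "\<lambda>k. (deriv ^^ k) b"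
  have der: "(?D k has_real_derivative ?D (Suc k) y) (at y)" for k y
    by (rule smooth_has_derivative[OF sm])
  obtain B where B: "B \<ge> 1" "\<And>k x. k \<le> N + 2 \<Longrightarrow> \<bar>?D k x\<bar> \<le> B"
    using iterated_deriv_bounded[OF sm per] by metis
  obtain c1 where c1: "c1 > 0" "\<And>y. (\<Sum>j\<le>N. (?D (Suc j) y)\<^sup>2) \<ge> c1"
    using periodic_nondegenerate_lower_bound[OF sm per nz] by metis
  obtain Z c where Z: "finite Z" "0 < c" "c \<le> 1"
    "\<And>\<delta> y. 0 < \<delta> \<Longrightarrow> y \<in> {0..1} \<Longrightarrow> (\<And>z. z \<in> Z \<Longrightarrow> \<delta> \<le> \<bar>y - z\<bar>) \<Longrightarrow>
       c * (\<Sum>j\<le>N. \<delta> ^ (2 * j) * (?D (Suc j) y)\<^sup>2) \<le> (deriv b y)\<^sup>2"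
    by (rule nondegenerate_cover[OF sm per nz]) blast
  define K where "K = 1 + B\<^sup>2 / c1"
  have K: "K \<ge> 1" using c1(1) by (simp add: K_def)
  define W where "W = 1 / sqrt c1"
  have W: "W > 0" using c1(1) by (simp add: W_def)
  define C where "C = 1 + W + (1 + 2 * (N + 1)) * K * W + N + W * B"
  have C: "C \<ge> 1" "C \<ge> W" "C \<ge> (1 + 2 * (N + 1)) * K * W" "C \<ge> N + W * B"
    using W K B(1) by (auto simp: C_def)
  show ?thesis
  proof (rule that[OF C(1) Z(2,3,1)])
    fix \<delta> :: real assume \<delta>: "0 < \<delta>" "\<delta> \<le> 1"
    define E where "E = (\<lambda>y. \<Sum>j\<le>N. \<delta> ^ (2 * j) * (?D (Suc j) y)\<^sup>2)"
    define E' where "E' = (\<lambda>y. \<Sum>j\<le>N. \<delta> ^ (2 * j) * (2 * ?D (Suc j) y * ?D (Suc (Suc j)) y))"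
    define w where "w = (\<lambda>y. \<delta> ^ N * deriv b y / E y)"
    define w' where "w' = (\<lambda>y. (\<delta> ^ N * ?D 2 y * E y - \<delta> ^ N * deriv b y * E' y) / (E y * E y))"
    define p where "p = (\<lambda>y. (deriv b y)\<^sup>2 / E y)"
    have Elow: "E y \<ge> c1 * \<delta> ^ (2 * N)" for y
    proof -
      have "\<delta> ^ (2 * N) * (\<Sum>j\<le>N. (?D (Suc j) y)\<^sup>2) \<le> E y"
        unfolding E_def sum_distrib_left using \<delta>
        by (intro sum_mono mult_right_mono power_decreasing) auto
      moreover have "\<delta> ^ (2 * N) * (\<Sum>j\<le>N. (?D (Suc j) y)\<^sup>2) \<ge> \<delta> ^ (2 * N) * c1"
        using \<delta> c1(2) by (intro mult_left_mono) auto
      ultimately show ?thesis by (simp add: mult.commute)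
    qed
    have Epos: "E y > 0" for y
      using Elow[of y] c1(1) \<delta> by (smt (verit) mult_pos_pos zero_less_power)
    define e where "e = (\<lambda>y. sqrt (E y))"
    have e: "e y > 0" "e y * e y = E y" for y using Epos[of y] by (auto simp: e_def)
    have elow: "\<delta> ^ N \<le> W * e y" for y
    proof -
      have "(sqrt c1 * \<delta> ^ N)\<^sup>2 \<le> (e y)\<^sup>2"
        using Elow[of y] c1(1) e(2)[of y] by (simp add: power_mult_distrib power_even_eq power2_eq_square[of "e y"])
      then have "sqrt c1 * \<delta> ^ N \<le> e y" by (rule power2_le_imp_le) (use e(1)[of y] in simp)
      then show ?thesis using c1(1) by (simp add: W_def field_simps)
    qed
    have s1: "\<delta> ^ j * \<bar>?D (Suc j) y\<bar> \<le> e y" if "j \<le> N" for j y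
    proof -
      have "\<delta> ^ (2 * j) * (?D (Suc j) y)\<^sup>2 \<le> E y"
        unfolding E_def using that \<delta>
        by (intro member_le_sum[where f = "\<lambda>j. \<delta> ^ (2 * j) * (?D (Suc j) y)\<^sup>2"]) auto
      then have "(\<delta> ^ j * \<bar>?D (Suc j) y\<bar>)\<^sup>2 \<le> (e y)\<^sup>2"
        using e(2)[of y] by (simp add: power_mult_distrib power_even_eq power2_eq_square[of "e y"])
      then show ?thesis by (rule power2_le_imp_le) (use e(1)[of y] in simp)
    qed
    \<comment> \<open>The derivative of order N+2 does not occur in E; the lower bound on E pays for
      it, which is the origin of K. It enters through the derivative of w.\<close>
    have s2: "\<delta> ^ j * \<bar>?D (Suc j) y\<bar> \<le> K * e y" if "j \<le> Suc N" for j y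
    proof (cases "j \<le> N")
      case True
      then have "\<delta> ^ j * \<bar>?D (Suc j) y\<bar> \<le> 1 * e y" using s1 by simp
      also have "\<dots> \<le> K * e y" using K e[of y] by (intro mult_right_mono) auto
      finally show ?thesis .
    next
      case False
      then have j: "j = Suc N" using that by simp
      have "(\<delta> ^ Suc N * \<bar>?D (Suc (Suc N)) y\<bar>)\<^sup>2 \<le> (\<delta> ^ N * B)\<^sup>2"
      proof (intro power_mono mult_mono)
        show "\<delta> ^ Suc N \<le> \<delta> ^ N" using \<delta> by (intro power_decreasing) auto
      qed (use \<delta> B(2)[of "Suc (Suc N)" y] in auto)
      also have "\<dots> \<le> B\<^sup>2 / c1 * E y"
      proof -
        have "B\<^sup>2 / c1 * (c1 * \<delta> ^ (2 * N)) \<le> B\<^sup>2 / c1 * E y"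
          using Elow c1(1) by (intro mult_left_mono) auto
        then show ?thesis using c1(1) by (simp add: power_mult_distrib power_mult[symmetric] mult_ac)
      qed
      also have "\<dots> \<le> K * E y" using Epos[of y] by (intro mult_right_mono) (auto simp: K_def)
      also have "\<dots> \<le> K * K * E y"
        using K Epos[of y] mult_left_mono[of 1 K K] by (intro mult_right_mono) auto
      also have "\<dots> = (K * e y)\<^sup>2" unfolding e(2)[of y, symmetric] power2_eq_square by (simp only: mult_ac)
      finally have "\<delta> ^ Suc N * \<bar>?D (Suc (Suc N)) y\<bar> \<le> K * e y"
        by (rule power2_le_imp_le) (use K e(1)[of y] in simp)
      then show ?thesis unfolding j .
    qed
    have derE: "(E has_real_derivative E' y) (at y)" for y
      unfolding E_def E'_def
      by (intro DERIV_sum) (auto intro!: derivative_eq_intros der[of "Suc _", simplified] simp: numeral_2_eq_2)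
    have contD: "continuous_on UNIV (?D k)" for k
      using der[of k] DERIV_isCont by (intro continuous_at_imp_continuous_on) blast
    have contE: "continuous_on UNIV E" unfolding E_def by (intro continuous_intros contD)
    have contE': "continuous_on UNIV E'" unfolding E'_def by (intro continuous_intros contD)
    have contd: "continuous_on UNIV (deriv b)" using contD[of 1] by simp
    have Ene: "E y \<noteq> 0" for y using Epos[of y] by simp
    have f1: "(w has_real_derivative w' y) (at y)" for y
      unfolding w_def w'_def
      using Ene derE[of y] der[of 1 y]
      by (auto intro!: derivative_eq_intros simp: numeral_2_eq_2)
    have f2: "continuous_on UNIV w'"
      unfolding w'_def using Ene by (intro continuous_intros contE contE' contD contd) auto
    have f3: "continuous_on UNIV p"
      unfolding p_def using Ene by (intro continuous_intros contE contd) auto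
    have f4: "w (y + 1) = w y" for y
      using periodic_iterated_deriv[of b, OF per, of "Suc j" y for j] periodic_iterated_deriv[of b, OF per, of 1 y]
      by (simp add: w_def E_def)
    have wb: "\<bar>w y\<bar> \<le> W" for y
    proof -
      have "\<delta> ^ N * \<bar>deriv b y\<bar> \<le> (W * e y) * e y"
        using elow[of y] s1[of 0 y] W e[of y] \<delta> by (intro mult_mono) auto
      then have "\<delta> ^ N * \<bar>deriv b y\<bar> \<le> W * E y" using e(2)[of y] by (simp add: mult.assoc)
      then show ?thesis unfolding w_def using Epos[of y] \<delta> by (simp add: abs_mult field_simps)
    qed
    have f5: "\<bar>w y\<bar> \<le> C" for y using wb[of y] C(2) by linarith
    have f6: "\<bar>w' y\<bar> \<le> C / \<delta>" for y
    proof -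
      have e0: "e y > 0" "e y \<ge> 0" using e[of y] by auto
      have a1: "\<delta> * \<bar>?D 2 y\<bar> \<le> K * e y" using s2[of 1 y] by (simp add: numeral_2_eq_2)
      have a2: "\<delta> * \<bar>E' y\<bar> \<le> 2 * (N + 1) * K * E y"
      proof -
        have "\<delta> * \<bar>E' y\<bar> \<le> \<delta> * (\<Sum>j\<le>N. \<bar>\<delta> ^ (2 * j) * (2 * ?D (Suc j) y * ?D (Suc (Suc j)) y)\<bar>)"
          unfolding E'_def using \<delta> by (intro mult_left_mono sum_abs) auto
        also have "\<dots> = (\<Sum>j\<le>N. 2 * ((\<delta> ^ j * \<bar>?D (Suc j) y\<bar>) * (\<delta> ^ Suc j * \<bar>?D (Suc (Suc j)) y\<bar>)))"
          unfolding sum_distrib_left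
        proof (intro sum.cong refl)
          fix j
          have "\<delta> * \<bar>\<delta> ^ (2 * j) * (2 * u * v)\<bar> = 2 * ((\<delta> ^ j * \<bar>u\<bar>) * (\<delta> ^ Suc j * \<bar>v\<bar>))" for u v :: real
            using \<delta> by (simp add: abs_mult power_even_eq power2_eq_square)
          then show "\<delta> * \<bar>\<delta> ^ (2 * j) * (2 * ?D (Suc j) y * ?D (Suc (Suc j)) y)\<bar> =
              2 * ((\<delta> ^ j * \<bar>?D (Suc j) y\<bar>) * (\<delta> ^ Suc j * \<bar>?D (Suc (Suc j)) y\<bar>))" .
        qed
        also have "\<dots> \<le> (\<Sum>j\<le>N. 2 * (e y * (K * e y)))"
        proof (intro sum_mono mult_left_mono)
          fix j assume "j \<in> {..N}"
          then show "\<delta> ^ j * \<bar>?D (Suc j) y\<bar> * (\<delta> ^ Suc j * \<bar>?D (Suc (Suc j)) y\<bar>) \<le> e y * (K * e y)"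
            by (intro mult_mono s1 s2 mult_nonneg_nonneg) (use \<delta> e0 in auto)
        qed simp
        also have "\<dots> = 2 * (N + 1) * K * E y" unfolding e(2)[of y, symmetric] by simp
        finally show ?thesis .
      qed
      have a3: "\<bar>deriv b y\<bar> \<le> e y" using s1[of 0 y] by simp
      have "\<bar>w' y\<bar> * (E y * E y) * \<delta> = \<delta> * \<bar>\<delta> ^ N * ?D 2 y * E y - \<delta> ^ N * deriv b y * E' y\<bar>"
        unfolding w'_def using Ene[of y] by (simp add: abs_divide abs_mult)
      also have "\<dots> \<le> \<delta> * (\<delta> ^ N * \<bar>?D 2 y\<bar> * E y + \<delta> ^ N * \<bar>deriv b y\<bar> * \<bar>E' y\<bar>)"
        using \<delta> Epos[of y]
        by (intro mult_left_mono order_trans[OF abs_triangle_ineq4]) (auto simp: abs_mult)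
      also have "\<dots> = \<delta> ^ N * ((\<delta> * \<bar>?D 2 y\<bar>) * E y + \<bar>deriv b y\<bar> * (\<delta> * \<bar>E' y\<bar>))"
        by (simp add: algebra_simps)
      also have "\<dots> \<le> (W * e y) * ((K * e y) * E y + e y * (2 * (N + 1) * K * E y))"
      proof (rule mult_mono[OF elow])
        have "\<delta> * \<bar>?D 2 y\<bar> * E y \<le> K * e y * E y"
          using a1 Epos[of y] by (intro mult_right_mono) auto
        moreover have "\<bar>deriv b y\<bar> * (\<delta> * \<bar>E' y\<bar>) \<le> e y * (2 * (N + 1) * K * E y)"
          using a2 a3 e0 \<delta> by (intro mult_mono[of "\<bar>deriv b y\<bar>"]) auto
        ultimately show "\<delta> * \<bar>?D 2 y\<bar> * E y + \<bar>deriv b y\<bar> * (\<delta> * \<bar>E' y\<bar>)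
            \<le> K * e y * E y + e y * (2 * (N + 1) * K * E y)" by (rule add_mono)
      qed (use W e0 Epos[of y] \<delta> in auto)
      also have "\<dots> = W * ((1 + 2 * (N + 1)) * K) * ((e y * e y) * E y)" by (simp add: algebra_simps)
      also have "\<dots> = W * ((1 + 2 * (N + 1)) * K) * (E y * E y)" by (simp only: e(2))
      finally have "(\<bar>w' y\<bar> * \<delta>) * (E y * E y) \<le> W * ((1 + 2 * (N + 1)) * K) * (E y * E y)"
        by (simp only: mult_ac)
      then have "\<bar>w' y\<bar> * \<delta> \<le> W * ((1 + 2 * (N + 1)) * K)"
        by (rule mult_right_le_imp_le) (simp add: Epos)
      also have "\<dots> \<le> C" using C(3) by (simp only: mult_ac)
      finally show ?thesis using \<delta> by (simp add: field_simps)
    qed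
    have f7: "0 \<le> p y \<and> p y \<le> 1" for y
      using s1[of 0 y] e[of y] Epos[of y] mult_mono[of "\<bar>deriv b y\<bar>" "e y" "\<bar>deriv b y\<bar>" "e y"]
      by (simp add: p_def power2_eq_square)
    have f8: "\<bar>w y * (b (y + \<kappa> * \<delta>) - b y) - \<kappa> * \<delta> ^ (N + 1) * p y\<bar> \<le> C * \<kappa>\<^sup>2 * \<delta> ^ (N + 1)"
      if \<kappa>: "0 < \<kappa>" "\<kappa> \<le> 1" for \<kappa> y
    proof -
      let ?h = "\<kappa> * \<delta>"
      have h: "0 < ?h" using \<kappa> \<delta> by simp
      \<comment> \<open>Orders 2 to N+1 are controlled by E. The remainder of order N+2 is
        controlled by the uniform bound B, with one power of \<delta> to spare.\<close>
      obtain t where t: "b (y + ?h) = (\<Sum>m<N + 2. ?D m y / fact m * ?h ^ m) + ?D (N + 2) t / fact (N + 2) * ?h ^ (N + 2)"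
        using Taylor_up[of "N + 2" ?D b y "y + ?h" y] der h by auto
      have split: "(\<Sum>m<N + 2. ?D m y / fact m * ?h ^ m) =
          b y + deriv b y * ?h + (\<Sum>j<N. ?D (j + 2) y / fact (j + 2) * ?h ^ (j + 2))"
        by (simp add: sum.lessThan_Suc_shift numeral_2_eq_2 del: sum.lessThan_Suc fact_Suc)
      have main: "w y * (deriv b y * ?h) = \<kappa> * \<delta> ^ (N + 1) * p y"
        by (simp add: w_def p_def power2_eq_square)
      have A: "\<bar>w y * (?D (j + 2) y / fact (j + 2) * ?h ^ (j + 2))\<bar> \<le> \<kappa>\<^sup>2 * \<delta> ^ (N + 1)" if j: "j < N" for j
      proof -
        have f1: "\<bar>?D (j + 2) y / fact (j + 2)\<bar> \<le> \<bar>?D (j + 2) y\<bar>"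
          using divide_left_mono[of 1 "fact (j + 2)" "\<bar>?D (j + 2) y\<bar>"] by (simp add: fact_ge_1 abs_divide del: fact_Suc)
        have "\<kappa> ^ (j + 2) \<le> \<kappa> ^ 2" using \<kappa> by (intro power_decreasing) auto
        then have "\<bar>w y * (?D (j + 2) y / fact (j + 2) * ?h ^ (j + 2))\<bar> \<le>
            \<bar>w y\<bar> * (\<bar>?D (j + 2) y\<bar> * (\<kappa>\<^sup>2 * \<delta> ^ (j + 2)))"
          unfolding abs_mult[of "w y"] abs_mult[of "?D (j + 2) y / fact (j + 2)"]
          using f1 \<kappa> \<delta> by (intro mult_left_mono mult_mono) (auto simp: power_mult_distrib abs_mult)
        also have "\<dots> = \<kappa>\<^sup>2 * \<delta> ^ (N + 1) * (\<bar>deriv b y\<bar> * (\<delta> ^ Suc j * \<bar>?D (Suc (Suc j)) y\<bar>) / E y)"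
          using Epos[of y] \<delta> by (simp add: w_def abs_mult power_add)
        also have "\<dots> \<le> \<kappa>\<^sup>2 * \<delta> ^ (N + 1) * 1"
        proof (intro mult_left_mono)
          have "\<bar>deriv b y\<bar> * (\<delta> ^ Suc j * \<bar>?D (Suc (Suc j)) y\<bar>) \<le> e y * e y"
            using s1[of 0 y] s1[of "Suc j" y] j e[of y] \<delta> by (intro mult_mono) auto
          then show "\<bar>deriv b y\<bar> * (\<delta> ^ Suc j * \<bar>?D (Suc (Suc j)) y\<bar>) / E y \<le> 1"
            using e(2)[of y] Epos[of y] by simp
        qed (use \<kappa> \<delta> in auto)
        finally show ?thesis by simp
      qed
      have R: "\<bar>w y * (?D (N + 2) t / fact (N + 2) * ?h ^ (N + 2))\<bar> \<le> W * B * (\<kappa>\<^sup>2 * \<delta> ^ (N + 1))"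
      proof -
        have f1: "\<bar>?D (N + 2) t / fact (N + 2)\<bar> \<le> B"
          using divide_left_mono[of 1 "fact (N + 2)" "\<bar>?D (N + 2) t\<bar>"] B(2)[of "N + 2" t]
          by (simp add: fact_ge_1 abs_divide del: fact_Suc)
        have "\<kappa> ^ (N + 2) \<le> \<kappa> ^ 2" using \<kappa> by (intro power_decreasing) auto
        moreover have "\<delta> ^ (N + 2) \<le> \<delta> ^ (N + 1)" using \<delta> by (intro power_decreasing) auto
        ultimately have f2: "\<bar>?h ^ (N + 2)\<bar> \<le> \<kappa>\<^sup>2 * \<delta> ^ (N + 1)"
          unfolding power_mult_distrib abs_mult using \<kappa> \<delta> by (intro mult_mono) auto
        have "\<bar>w y\<bar> * (\<bar>?D (N + 2) t / fact (N + 2)\<bar> * \<bar>?h ^ (N + 2)\<bar>) \<le> W * (B * (\<kappa>\<^sup>2 * \<delta> ^ (N + 1)))"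
          using f1 f2 wb[of y] W B(1) by (intro mult_mono) auto
        then show ?thesis by (simp only: abs_mult mult.assoc)
      qed
      have "w y * (b (y + ?h) - b y) - \<kappa> * \<delta> ^ (N + 1) * p y =
          (\<Sum>j<N. w y * (?D (j + 2) y / fact (j + 2) * ?h ^ (j + 2))) + w y * (?D (N + 2) t / fact (N + 2) * ?h ^ (N + 2))"
        unfolding t split main[symmetric] sum_distrib_left[symmetric] by (simp only: algebra_simps)
      also have "\<bar>\<dots>\<bar> \<le> (\<Sum>j<N. \<kappa>\<^sup>2 * \<delta> ^ (N + 1)) + W * B * (\<kappa>\<^sup>2 * \<delta> ^ (N + 1))"
        by (intro order_trans[OF abs_triangle_ineq] add_mono R order_trans[OF sum_abs] sum_mono A) auto
      also have "\<dots> = (N + W * B) * (\<kappa>\<^sup>2 * \<delta> ^ (N + 1))" by (simp add: algebra_simps)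
      also have "\<dots> \<le> C * (\<kappa>\<^sup>2 * \<delta> ^ (N + 1))" using C(4) \<kappa> \<delta> by (intro mult_right_mono) auto
      finally show ?thesis by (simp add: mult.assoc)
    qed
    have f9: "\<exists>z\<in>Z. \<bar>y - z\<bar> < \<delta>" if "y \<in> {0..1}" "p y < c" for y
    proof (rule ccontr)
      assume "\<not> ?thesis"
      then have "c * E y \<le> (deriv b y)\<^sup>2" unfolding E_def using \<delta> that by (intro Z(4)) auto
      then show False using that(2) Epos[of y] by (simp add: p_def field_simps)
    qed
    show "\<exists>w w' p.
       admissible_weight b N C c Z \<delta> w w' p"
      unfolding admissible_weight_def
      by (intro exI[of _ w] exI[of _ w'] exI[of _ p] conjI allI ballI impI)
        (fact f1 f2 f3 f4 f5 f6 f8 f9 f7[THEN conjunct1] f7[THEN conjunct2])+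
  qed
qed

subsection \<open>Periodic complex functions on the unit interval\<close>

lemma integrable_unit_interval:
  fixes f :: "real \<Rightarrow> 'a::banach"
  assumes "continuous_on UNIV f"
  shows "f integrable_on {0..1}"
  using assms by (intro integrable_continuous_real) (auto intro: continuous_on_subset)

lemma continuous_on_shift:
  fixes f :: "real \<Rightarrow> 'a::topological_space"
  assumes "continuous_on UNIV f"
  shows "continuous_on UNIV (\<lambda>y. f (y + h))"
  using assms by (rule continuous_on_compose2) (auto intro: continuous_intros)

lemma integral_periodic_shift:
  fixes u :: "real \<Rightarrow> 'a::euclidean_space"
  assumes per: "\<And>x. u (x + 1) = u x" and cont: "continuous_on UNIV u" and h: "0 \<le> h" "h \<le> 1"
  shows "integral {0..1} (\<lambda>y. u (y + h)) = integral {0..1} u"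
proof -
  have c: "continuous_on A u" for A using cont by (rule continuous_on_subset) auto
  have i: "u integrable_on {a..b}" for a b by (intro integrable_continuous_real c)
  have "integral {0..1} (\<lambda>y. u (y + h)) = integral {h..1 + h} u"
    using integral_shift[of 0 h 1 u] c by (simp add: o_def)
  also have "\<dots> = integral {h..1} u + integral {1..1 + h} u"
    using h by (intro Henstock_Kurzweil_Integration.integral_combine[symmetric] i) auto
  also have "integral {1..1 + h} u = integral {0..h} (\<lambda>y. u (y + 1))"
    using integral_shift[of 0 1 h u] c by (simp add: o_def add.commute)
  also have "\<dots> = integral {0..h} u" using per by simp
  finally show ?thesis
    using Henstock_Kurzweil_Integration.integral_combine[OF h i] by (simp add: add.commute)
qed

lemma integral_periodic_derivative:
  fixes F :: "real \<Rightarrow> 'a::banach"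
  assumes "\<And>x. F (x + 1) = F x" "\<And>x. (F has_vector_derivative f x) (at x)"
  shows "integral {0..1} f = 0"
proof -
  have "(f has_integral (F 1 - F 0)) {0..1}"
    using assms(2) by (intro fundamental_theorem_of_calculus) (auto intro: has_vector_derivative_at_within)
  then show ?thesis using assms(1)[of 0] by (simp add: integral_unique)
qed

text \<open>Jensen's inequality on an interval of length one: the variance of
  \<open>norm (f s)\<close> about its mean m is nonnegative.\<close>

lemma norm_integral_unit_interval_squared:
  fixes f :: "real \<Rightarrow> 'a::banach"
  assumes c: "continuous_on {0..1} f"
  shows "(norm (integral {0..1} f))\<^sup>2 \<le> integral {0..1} (\<lambda>s. (norm (f s))\<^sup>2)"
proof -
  define m where "m = integral {0..1} (\<lambda>s. norm (f s))"
  have i: "(\<lambda>s. norm (f s)) integrable_on {0..1}" "(\<lambda>s. (norm (f s))\<^sup>2) integrable_on {0..1}"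
    by (intro integrable_continuous_real continuous_intros c)+
  have "0 \<le> integral {0..1} (\<lambda>s. (norm (f s) - m)\<^sup>2)" by (intro integral_nonneg integrable_continuous_real continuous_intros c) auto
  also have "(\<lambda>s. (norm (f s) - m)\<^sup>2) = (\<lambda>s. ((norm (f s))\<^sup>2 - 2 * m * norm (f s)) + m\<^sup>2)"
    by (auto simp: power2_diff)
  also have "integral {0..1} \<dots> = integral {0..1} (\<lambda>s. (norm (f s))\<^sup>2) - 2 * m * m + m\<^sup>2"
    using i by (subst integral_add integral_diff integral_mult_right; auto intro!: integrable_diff integrable_on_mult_right)+
      (simp add: m_def)
  finally have "m\<^sup>2 \<le> integral {0..1} (\<lambda>s. (norm (f s))\<^sup>2)" by (simp add: power2_eq_square)
  moreover have "norm (integral {0..1} f) \<le> m"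
    unfolding m_def by (intro integral_norm_bound_integral i integrable_continuous_real c) auto
  ultimately show ?thesis by (meson norm_ge_zero order_trans power_mono)
qed

locale periodic_C1 =
  fixes G G1 :: "real \<Rightarrow> complex"
  assumes per: "\<And>y. G (y + 1) = G y" "\<And>y. G1 (y + 1) = G1 y"
    and der: "\<And>y. (G has_vector_derivative G1 y) (at y)"
    and cont1: "continuous_on UNIV G1"
begin

lemma cont: "continuous_on UNIV G"
  using der has_vector_derivative_continuous by (intro continuous_at_imp_continuous_on) blast

text \<open>The difference is h times the mean of G1 over the segment from y to y + h. Jensen and
  Fubini leave integrals of |G1|^2 over translates, all equal by periodicity.\<close>

lemma shift_difference_bound:
  assumes h: "0 \<le> h" "h \<le> 1"
  shows "integral {0..1} (\<lambda>y. (cmod (G (y + h) - G y))\<^sup>2) \<le> h\<^sup>2 * integral {0..1} (\<lambda>y. (cmod (G1 y))\<^sup>2)"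
proof -
  have c2: "continuous_on A (\<lambda>z. G1 (f z))" if "continuous_on A f" for A and f :: "'b::topological_space \<Rightarrow> real"
    using continuous_on_compose2[OF cont1 that] by auto
  have pt: "(cmod (G (y + h) - G y))\<^sup>2 \<le> h\<^sup>2 * integral {0..1} (\<lambda>s. (cmod (G1 (y + s * h)))\<^sup>2)" for y
  proof -
    have "((\<lambda>s. h *\<^sub>R G1 (y + s * h)) has_integral (G (y + 1 * h) - G (y + 0 * h))) {0..1}"
    proof (rule fundamental_theorem_of_calculus)
      fix s :: real
      have "((\<lambda>s. y + s * h) has_vector_derivative h) (at s within {0..1})"
        by (auto intro!: derivative_eq_intros)
      then have "(G \<circ> (\<lambda>s. y + s * h) has_vector_derivative h *\<^sub>R G1 (y + s * h)) (at s within {0..1})"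
        by (rule vector_diff_chain_within) (auto intro: has_vector_derivative_at_within der)
      then show "((\<lambda>s. G (y + s * h)) has_vector_derivative h *\<^sub>R G1 (y + s * h)) (at s within {0..1})"
        by (simp add: o_def)
    qed simp
    from integral_unique[OF this]
    have "G (y + h) - G y = h *\<^sub>R integral {0..1} (\<lambda>s. G1 (y + s * h))" by simp
    then have "(cmod (G (y + h) - G y))\<^sup>2 = h\<^sup>2 * (cmod (integral {0..1} (\<lambda>s. G1 (y + s * h))))\<^sup>2"
      by (simp add: power_mult_distrib)
    also have "\<dots> \<le> h\<^sup>2 * integral {0..1} (\<lambda>s. (cmod (G1 (y + s * h)))\<^sup>2)"
      by (intro mult_left_mono norm_integral_unit_interval_squared c2 continuous_intros) auto
    finally show ?thesis .
  qed
  have cc: "continuous_on A (\<lambda>(y, s). (cmod (G1 (y + s * h)))\<^sup>2)" for A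
    unfolding split_beta by (intro continuous_intros c2)
  have sw: "integral {0..1} (\<lambda>y. integral {0..1} (\<lambda>s. (cmod (G1 (y + s * h)))\<^sup>2)) =
      integral {0..1} (\<lambda>s. integral {0..1} (\<lambda>y. (cmod (G1 (y + s * h)))\<^sup>2))"
    using integral_swap_continuous[of 0 0 1 1 "\<lambda>y s. (cmod (G1 (y + s * h)))\<^sup>2"] cc by simp
  have "continuous_on {0..1} (\<lambda>y. integral (cbox 0 1) (\<lambda>s. (cmod (G1 (y + s * h)))\<^sup>2))"
    by (rule integral_continuous_on_param) (rule cc)
  then have ii: "(\<lambda>y. integral {0..1} (\<lambda>s. (cmod (G1 (y + s * h)))\<^sup>2)) integrable_on {0..1}"
    by (intro integrable_continuous_real) simp
  have "integral {0..1} (\<lambda>y. (cmod (G (y + h) - G y))\<^sup>2) \<le>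
      integral {0..1} (\<lambda>y. h\<^sup>2 * integral {0..1} (\<lambda>s. (cmod (G1 (y + s * h)))\<^sup>2))"
  proof (rule integral_le[OF _ _ pt])
    show "(\<lambda>y. (cmod (G (y + h) - G y))\<^sup>2) integrable_on {0..1}"
      by (intro integrable_unit_interval continuous_intros continuous_on_shift cont)
    show "(\<lambda>y. h\<^sup>2 * integral {0..1} (\<lambda>s. (cmod (G1 (y + s * h)))\<^sup>2)) integrable_on {0..1}"
      by (rule integrable_on_mult_right[OF ii])
  qed
  also have "\<dots> = h\<^sup>2 * integral {0..1} (\<lambda>s. integral {0..1} (\<lambda>y. (cmod (G1 (y + s * h)))\<^sup>2))"
    using sw by simp
  also have "integral {0..1} (\<lambda>s. integral {0..1} (\<lambda>y. (cmod (G1 (y + s * h)))\<^sup>2)) =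
      integral {0..1} (\<lambda>s::real. integral {0..1} (\<lambda>y. (cmod (G1 y))\<^sup>2))"
  proof (rule integral_cong)
    fix s :: real assume s: "s \<in> {0..1}"
    show "integral {0..1} (\<lambda>y. (cmod (G1 (y + s * h)))\<^sup>2) = integral {0..1} (\<lambda>y. (cmod (G1 y))\<^sup>2)"
      using s h by (intro integral_periodic_shift[of "\<lambda>y. (cmod (G1 y))\<^sup>2"])
        (auto simp: per mult_le_one intro!: continuous_intros cont1)
  qed
  finally show ?thesis by simp
qed

text \<open>A Sobolev inequality with a free length s. The values of |G|^2 at y and z differ by at
  most the integral of 2 |G| |G1|, Young's inequality splits it with weight s, and averaging over z
  removes the second point. Later s is proportional to \<delta>.\<close>

lemma sup_norm_bound:
  assumes s: "s > 0" and y: "y \<in> {0..1}"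
  shows "(cmod (G y))\<^sup>2 \<le> (1 + 1 / s) * integral {0..1} (\<lambda>y. (cmod (G y))\<^sup>2) + s * integral {0..1} (\<lambda>y. (cmod (G1 y))\<^sup>2)"
proof -
  let ?f = "\<lambda>y. (1 / s) * (cmod (G y))\<^sup>2 + s * (cmod (G1 y))\<^sup>2"
  let ?g = "\<lambda>y. 2 * Re (cnj (G y) * G1 y)"
  have cG: "continuous_on A G" "continuous_on A G1" for A
    using cont cont1 by (auto intro: continuous_on_subset)
  have dg: "((\<lambda>y. (cmod (G y))\<^sup>2) has_vector_derivative ?g y) (at y within A)" for y A
  proof -
    have "((\<lambda>y. Re (cnj (G y) * G y)) has_vector_derivative Re (cnj (G y) * G1 y + cnj (G1 y) * G y)) (at y within A)"
      by (intro bounded_linear.has_vector_derivative[OF bounded_linear_Re] has_vector_derivative_mult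
          has_vector_derivative_cnj has_vector_derivative_at_within[OF der])
    moreover have "(\<lambda>y. Re (cnj (G y) * G y)) = (\<lambda>y. (cmod (G y))\<^sup>2)"
      unfolding cmod_power2 by (simp add: power2_eq_square)
    moreover have "Re (cnj (G y) * G1 y + cnj (G1 y) * G y) = ?g y" by (simp add: algebra_simps)
    ultimately show ?thesis by simp
  qed
  have gf: "\<bar>?g y\<bar> \<le> ?f y" for y
  proof -
    have "\<bar>?g y\<bar> \<le> 2 * (cmod (G y) * cmod (G1 y))"
      using abs_Re_le_cmod[of "cnj (G y) * G1 y"] by (simp add: norm_mult)
    also have "\<dots> \<le> ?f y"
      using sum_squares_bound[of "cmod (G y) / sqrt s" "sqrt s * cmod (G1 y)"] s
      by (simp add: power_mult_distrib power_divide)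
    finally show ?thesis .
  qed
  have ig: "?g integrable_on {a..b}" "?f integrable_on {a..b}" for a b
    using s by (intro integrable_continuous_real continuous_intros cG; simp)+
  have mono: "integral {a..b} ?f \<le> integral {0..1} ?f" if "0 \<le> a" "b \<le> 1" for a b
    using that s by (intro integral_subset_le ig) auto
  have cmp: "(cmod (G y))\<^sup>2 \<le> (cmod (G z))\<^sup>2 + integral {0..1} ?f" if z: "z \<in> {0..1}" for z
  proof (cases "z \<le> y")
    case True
    then have "(?g has_integral ((cmod (G y))\<^sup>2 - (cmod (G z))\<^sup>2)) {z..y}"
      by (intro fundamental_theorem_of_calculus dg)
    then have "(cmod (G y))\<^sup>2 - (cmod (G z))\<^sup>2 = integral {z..y} ?g" by (simp add: integral_unique)
    also have "\<dots> \<le> integral {z..y} ?f" using gf by (intro integral_le ig) (simp add: abs_le_iff)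
    finally show ?thesis using mono[of z y] z y by simp
  next
    case False
    then have "(?g has_integral ((cmod (G z))\<^sup>2 - (cmod (G y))\<^sup>2)) {y..z}"
      by (intro fundamental_theorem_of_calculus dg) simp
    then have "(cmod (G z))\<^sup>2 - (cmod (G y))\<^sup>2 = integral {y..z} ?g" by (simp add: integral_unique)
    moreover have "- integral {y..z} ?g \<le> integral {y..z} ?f"
      unfolding integral_neg[symmetric] using gf by (intro integral_le ig integrable_neg) (simp add: abs_le_iff)
    ultimately show ?thesis using mono[of y z] z y by simp
  qed
  have "integral {0..1} (\<lambda>z::real. (cmod (G y))\<^sup>2) \<le> integral {0..1} (\<lambda>z. (cmod (G z))\<^sup>2 + integral {0..1} ?f)"
    by (intro integral_le cmp integrable_continuous_real continuous_intros cG) auto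
  also have "\<dots> = integral {0..1} (\<lambda>z. (cmod (G z))\<^sup>2) + integral {0..1} ?f"
    by (subst integral_add) (auto intro!: integrable_continuous_real continuous_intros cG)
  also have "integral {0..1} ?f = (1 / s) * integral {0..1} (\<lambda>z. (cmod (G z))\<^sup>2) + s * integral {0..1} (\<lambda>z. (cmod (G1 z))\<^sup>2)"
    using s by (subst integral_add) (auto intro!: integrable_continuous_real continuous_intros cG)
  finally show ?thesis by (simp add: algebra_simps)
qed

text \<open>The set where p < c is covered by card Z intervals of length at most 2 \<delta>, and on
  it |G|^2 is at most the bound S from \<open>sup_norm_bound\<close>. Mass can concentrate where
  transport is weak only at the price of dissipation.\<close>

lemma mass_lower_bound:
  fixes s \<delta> c :: real and Z :: "real set" and p :: "real \<Rightarrow> real"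
  assumes s: "s > 0" and \<delta>: "\<delta> > 0" and Z: "finite Z" and c: "0 < c"
    and p: "continuous_on UNIV p" "\<And>y. 0 \<le> p y"
    and far: "\<And>y. y \<in> {0..1} \<Longrightarrow> p y < c \<Longrightarrow> \<exists>z\<in>Z. \<bar>y - z\<bar> < \<delta>"
  defines "N0 \<equiv> integral {0..1} (\<lambda>y. (cmod (G y))\<^sup>2)" and "D \<equiv> integral {0..1} (\<lambda>y. (cmod (G1 y))\<^sup>2)"
  shows "c * (N0 - 2 * card Z * \<delta> * ((1 + 1 / s) * N0 + s * D)) \<le> integral {0..1} (\<lambda>y. p y * (cmod (G y))\<^sup>2)"
proof -
  define S where "S = (1 + 1 / s) * N0 + s * D"
  have S: "(cmod (G y))\<^sup>2 \<le> S" if "y \<in> {0..1}" for y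
    unfolding S_def N0_def D_def by (rule sup_norm_bound[OF s that])
  have S0: "S \<ge> 0" by (rule order_trans[OF zero_le_power2 S[of 0]]) simp
  let ?A = "\<lambda>z. {0..1} \<inter> {z - \<delta>..z + \<delta>}"
  have iA: "((indicator (?A z) :: real \<Rightarrow> real) has_integral (measure lborel (?A z))) {0..1}" for z :: real
  proof -
    have e: "?A z = {max 0 (z - \<delta>)..min 1 (z + \<delta>)}" by auto
    have "((\<lambda>y. 1::real) has_integral (measure lborel (?A z))) (?A z)"
      unfolding e by (intro has_integral_measure_lborel) (auto simp: emeasure_lborel_Icc_eq)
    then have "((\<lambda>y. if y \<in> ?A z then 1 else 0 :: real) has_integral (measure lborel (?A z))) {0..1}"
      by (subst has_integral_restrict) auto
    moreover have "(\<lambda>y. if y \<in> ?A z then 1 else 0 :: real) = indicator (?A z)"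
      by (auto simp: indicator_def)
    ultimately show ?thesis by simp
  qed
  have mA: "measure lborel (?A z) \<le> 2 * \<delta>" for z :: real
  proof -
    have "measure lborel (?A z) \<le> measure lborel {z - \<delta>..z + \<delta>}"
      by (intro measure_mono_fmeasurable) (auto simp: fmeasurable_def emeasure_lborel_Icc_eq)
    then show ?thesis using \<delta> by simp
  qed
  have pt: "c * (cmod (G y))\<^sup>2 \<le> p y * (cmod (G y))\<^sup>2 + c * S * (\<Sum>z\<in>Z. indicator (?A z) y)"
    if y: "y \<in> {0..1}" for y
  proof (cases "p y < c")
    case True
    then obtain z where z: "z \<in> Z" "\<bar>y - z\<bar> < \<delta>" using far y by blast
    then have "(1::real) = indicator (?A z) y" using y by (auto simp: indicator_def)
    also have "\<dots> \<le> (\<Sum>z\<in>Z. indicator (?A z) y)"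
      using z Z by (intro member_le_sum) auto
    finally have "c * S * 1 \<le> c * S * (\<Sum>z\<in>Z. indicator (?A z) y)"
      using c S0 by (intro mult_left_mono) auto
    moreover have "c * (cmod (G y))\<^sup>2 \<le> c * S * 1" using S[OF y] c by simp
    moreover have "0 \<le> p y * (cmod (G y))\<^sup>2" using p(2) by simp
    ultimately show ?thesis by linarith
  next
    case False
    then have "c * (cmod (G y))\<^sup>2 \<le> p y * (cmod (G y))\<^sup>2" by (intro mult_right_mono) auto
    moreover have "0 \<le> c * S * (\<Sum>z\<in>Z. indicator (?A z) y)" using c S0 by (intro mult_nonneg_nonneg sum_nonneg) auto
    ultimately show ?thesis by linarith
  qed
  have hi: "((\<lambda>y. p y * (cmod (G y))\<^sup>2 + c * S * (\<Sum>z\<in>Z. indicator (?A z) y)) has_integral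
      (integral {0..1} (\<lambda>y. p y * (cmod (G y))\<^sup>2) + c * S * (\<Sum>z\<in>Z. measure lborel (?A z)))) {0..1}"
    by (intro has_integral_add has_integral_mult_right has_integral_sum Z iA integrable_integral
        integrable_unit_interval continuous_intros p cont)
  have "((\<lambda>y. c * (cmod (G y))\<^sup>2) has_integral (c * N0)) {0..1}"
    unfolding N0_def by (intro has_integral_mult_right integrable_integral integrable_unit_interval continuous_intros cont)
  then have "c * N0 \<le> integral {0..1} (\<lambda>y. p y * (cmod (G y))\<^sup>2) + c * S * (\<Sum>z\<in>Z. measure lborel (?A z))"
    using hi pt by (rule has_integral_le)
  also have "c * S * (\<Sum>z\<in>Z. measure lborel (?A z)) \<le> c * S * (\<Sum>z\<in>Z. 2 * \<delta>)"
    using c S0 by (intro mult_left_mono sum_mono mA) auto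
  finally show ?thesis unfolding S_def by (simp add: algebra_simps)
qed

end

subsection \<open>Energy and cross-term estimates\<close>

text \<open>A single mode at a fixed time. m is the size of the transport gain and e its error, C
  and C' bound the weight and its derivative, and \<rho> bounds the forcing R that the smoothing in
  y leaves behind. The frequency q may have either sign.\<close>

locale shear_mode = periodic_C1 G G1 for G G1 +
  fixes G2 R :: "real \<Rightarrow> complex" and b w w' p :: "real \<Rightarrow> real" and \<nu> q h C C' m e \<rho> :: real
  assumes der1: "\<And>y. (G1 has_vector_derivative G2 y) (at y)"
    and cont2: "continuous_on UNIV G2"
    and contR: "continuous_on UNIV R" and R: "\<And>y. cmod (R y) \<le> \<rho>"
    and contb: "continuous_on UNIV b"
    and derw: "\<And>y. (w has_real_derivative w' y) (at y)" and contw': "continuous_on UNIV w'"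
    and perw: "\<And>y. w (y + 1) = w y"
    and w: "\<And>y. \<bar>w y\<bar> \<le> C" "\<And>y. \<bar>w' y\<bar> \<le> C'"
    and contp: "continuous_on UNIV p" and p: "\<And>y. 0 \<le> p y" "\<And>y. p y \<le> 1"
    and commutator: "\<And>y. \<bar>w y * (b (y + h) - b y) - m * p y\<bar> \<le> e"
    and h: "0 < h" "h \<le> 1" and q: "1 \<le> \<bar>q\<bar>" and \<nu>: "0 < \<nu>" and m: "0 \<le> m"
begin

definition H :: "real \<Rightarrow> complex" where
  "H y = - \<i> * (q * b y) * G y + \<nu> * (G2 y - q\<^sup>2 * G y) + R y"

definition mass :: real where "mass = integral {0..1} (\<lambda>y. (cmod (G y))\<^sup>2)"
definition dissipation :: real where "dissipation = integral {0..1} (\<lambda>y. (cmod (G1 y))\<^sup>2)"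
definition weighted_mass :: real where "weighted_mass = integral {0..1} (\<lambda>y. p y * (cmod (G y))\<^sup>2)"

lemma contw: "continuous_on UNIV w"
  using derw DERIV_isCont by (intro continuous_at_imp_continuous_on) blast

lemma contH: "continuous_on UNIV H"
  unfolding H_def[abs_def] by (intro continuous_intros contb cont cont2 contR)

lemma has_integral_mass: "((\<lambda>y. (cmod (G y))\<^sup>2) has_integral mass) {0..1}"
  unfolding mass_def by (intro integrable_integral integrable_unit_interval continuous_intros cont)

lemma has_integral_dissipation: "((\<lambda>y. (cmod (G1 y))\<^sup>2) has_integral dissipation) {0..1}"
  unfolding dissipation_def by (intro integrable_integral integrable_unit_interval continuous_intros cont1)

lemma has_integral_weighted_mass: "((\<lambda>y. p y * (cmod (G y))\<^sup>2) has_integral weighted_mass) {0..1}"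
  unfolding weighted_mass_def by (intro integrable_integral integrable_unit_interval continuous_intros cont contp)

lemma has_integral_mass_shift: "((\<lambda>y. (cmod (G (y + h)))\<^sup>2) has_integral mass) {0..1}"
proof -
  have "mass = integral {0..1} (\<lambda>y. (cmod (G (y + h)))\<^sup>2)"
    unfolding mass_def using h
    by (intro integral_periodic_shift[of "\<lambda>y. (cmod (G y))\<^sup>2", symmetric] continuous_intros cont) (auto simp: per)
  then show ?thesis
    by (auto intro!: integrable_integral integrable_unit_interval continuous_intros continuous_on_shift cont)
qed

lemma has_integral_dissipation_shift: "((\<lambda>y. (cmod (G1 (y + h)))\<^sup>2) has_integral dissipation) {0..1}"
proof -
  have "dissipation = integral {0..1} (\<lambda>y. (cmod (G1 (y + h)))\<^sup>2)"
    unfolding dissipation_def using h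
    by (intro integral_periodic_shift[of "\<lambda>y. (cmod (G1 y))\<^sup>2", symmetric] continuous_intros cont1) (auto simp: per)
  then show ?thesis
    by (auto intro!: integrable_integral integrable_unit_interval continuous_intros continuous_on_shift cont1)
qed

lemma mass_nonneg: "0 \<le> mass" and dissipation_nonneg: "0 \<le> dissipation"
  by (rule has_integral_nonneg[OF has_integral_mass] has_integral_nonneg[OF has_integral_dissipation], simp)+

lemma rho_nonneg: "0 \<le> \<rho>"
  using R[of 0] norm_ge_zero order_trans by blast

lemma C_nonneg: "0 \<le> C" "0 \<le> C'"
  using w[of 0] abs_ge_zero order_trans by blast+

text \<open>Transport multiplies G by an imaginary factor and drops out of the real part. Instead of
  integrating by parts, the derivative of \<open>Re (cnj (G y) * G1 y)\<close>, which has integral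
  zero over a period, is split off pointwise; it trades the G2 term for -|G1|^2.\<close>

lemma energy_estimate:
  "integral {0..1} (\<lambda>y. 2 * Re (cnj (G y) * H y)) \<le> - 2 * \<nu> * dissipation - 2 * \<nu> * q\<^sup>2 * mass + \<rho> * (1 + mass)"
proof -
  have "integral {0..1} (\<lambda>y. Re (cnj (G y) * G2 y + cnj (G1 y) * G1 y)) = 0"
  proof (rule integral_periodic_derivative)
    show "((\<lambda>y. Re (cnj (G y) * G1 y)) has_vector_derivative Re (cnj (G y) * G2 y + cnj (G1 y) * G1 y)) (at y)" for y
      by (intro bounded_linear.has_vector_derivative[OF bounded_linear_Re] has_vector_derivative_mult
          has_vector_derivative_cnj der der1)
  qed (simp add: per)
  moreover have "(\<lambda>y. Re (cnj (G y) * G2 y + cnj (G1 y) * G1 y)) integrable_on {0..1}"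
    by (intro integrable_unit_interval continuous_intros cont cont1 cont2)
  ultimately have X: "((\<lambda>y. Re (cnj (G y) * G2 y + cnj (G1 y) * G1 y)) has_integral 0) {0..1}"
    unfolding has_integral_integrable_integral by blast
  have one: "((\<lambda>y::real. 1::real) has_integral 1) {0..1}"
    using has_integral_const_real[of "1::real" 0 1] by simp
  have pt: "2 * Re (cnj (G y) * H y) \<le> 2 * \<nu> * Re (cnj (G y) * G2 y + cnj (G1 y) * G1 y)
      - 2 * \<nu> * (cmod (G1 y))\<^sup>2 - 2 * \<nu> * q\<^sup>2 * (cmod (G y))\<^sup>2 + \<rho> * (1 + (cmod (G y))\<^sup>2)" for y
  proof -
    have "2 * Re (cnj (G y) * R y) \<le> 2 * (cmod (G y) * cmod (R y))"
      using complex_Re_le_cmod[of "cnj (G y) * R y"] by (simp add: norm_mult)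
    also have "\<dots> \<le> 2 * (cmod (G y) * \<rho>)" using R by (intro mult_left_mono) auto
    also have "\<dots> = \<rho> * (2 * 1 * cmod (G y))" by simp
    also have "\<dots> \<le> \<rho> * (1\<^sup>2 + (cmod (G y))\<^sup>2)" by (intro mult_left_mono sum_squares_bound rho_nonneg)
    finally have r: "2 * Re (cnj (G y) * R y) \<le> \<rho> * (1 + (cmod (G y))\<^sup>2)" by simp
    have "2 * Re (cnj (G y) * H y) = 2 * \<nu> * Re (cnj (G y) * G2 y + cnj (G1 y) * G1 y)
      - 2 * \<nu> * (cmod (G1 y))\<^sup>2 - 2 * \<nu> * q\<^sup>2 * (cmod (G y))\<^sup>2 + 2 * Re (cnj (G y) * R y)"
      unfolding cmod_power2 H_def by (simp add: power2_eq_square algebra_simps)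
    then show ?thesis using r by linarith
  qed
  have "integral {0..1} (\<lambda>y. 2 * Re (cnj (G y) * H y)) \<le>
      2 * \<nu> * 0 - 2 * \<nu> * dissipation - 2 * \<nu> * q\<^sup>2 * mass + \<rho> * (1 + mass)"
  proof (rule has_integral_le[OF integrable_integral _ pt])
    show "(\<lambda>y. 2 * Re (cnj (G y) * H y)) integrable_on {0..1}"
      by (intro integrable_unit_interval continuous_intros cont contH)
    show "((\<lambda>y. 2 * \<nu> * Re (cnj (G y) * G2 y + cnj (G1 y) * G1 y)
      - 2 * \<nu> * (cmod (G1 y))\<^sup>2 - 2 * \<nu> * q\<^sup>2 * (cmod (G y))\<^sup>2 + \<rho> * (1 + (cmod (G y))\<^sup>2)) has_integral
        2 * \<nu> * 0 - 2 * \<nu> * dissipation - 2 * \<nu> * q\<^sup>2 * mass + \<rho> * (1 + mass)) {0..1}"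
      by (intro has_integral_add has_integral_diff has_integral_mult_right X has_integral_mass
          has_integral_dissipation one)
  qed
  then show ?thesis by simp
qed

text \<open>Transport rotates the values at the two points at different speeds. Only the difference
  \<open>\<beta>h - \<beta>\<close> survives, and the factor i turns the imaginary part into a real
  part; dividing by q makes this gain independent of the frequency.\<close>

lemma cross_term_identity:
  fixes gh g g2h g2 rh r :: complex
  shows "Im ((- \<i> * (q * \<beta>h) * gh + \<nu> * (g2h - q\<^sup>2 * gh) + rh) * cnj g
      + gh * cnj (- \<i> * (q * \<beta>) * g + \<nu> * (g2 - q\<^sup>2 * g) + r)) / q
    = - (\<beta>h - \<beta>) * Re (gh * cnj g) + \<nu> / q * Im (g2h * cnj g + gh * cnj g2)
      - 2 * \<nu> * q * Im (gh * cnj g) + Im (rh * cnj g + gh * cnj r) / q"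
  using q by (auto simp: field_simps power2_eq_square)

text \<open>Transport yields m times the weighted mass, up to the squared shift difference, which
  \<open>shift_difference_bound\<close> converts into dissipation. An exact derivative removes G2,
  and \<Lambda> is the Young weight that splits the resulting w' term between dissipation and
  mass.\<close>

lemma cross_estimate:
  assumes \<Lambda>: "0 < \<Lambda>"
  shows "integral {0..1} (\<lambda>y. w y * Im (H (y + h) * cnj (G y) + G (y + h) * cnj (H y))) / q
    \<le> - m * (weighted_mass - h\<^sup>2 * dissipation) / 2 + e * mass
      + \<nu> * (C' * (\<Lambda> * dissipation + mass / \<Lambda>) + 2 * C * dissipation)
      + 2 * \<nu> * q\<^sup>2 * C * mass + C * \<rho> * (1 + mass)"
proof -
  \<comment> \<open>The y-derivative of
    \<open>w y * Im (G1 (y + h) * cnj (G y) + G (y + h) * cnj (G1 y))\<close>. Its integral over a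
    period is zero, so a multiple of it exchanges G2 for first derivatives and w'.\<close>
  let ?X = "\<lambda>y. w y * Im (G2 (y + h) * cnj (G y) + G (y + h) * cnj (G2 y))
      + (2 * w y * Im (G1 (y + h) * cnj (G1 y)) + w' y * Im (G1 (y + h) * cnj (G y) + G (y + h) * cnj (G1 y)))"
  note shifts = continuous_on_shift[OF cont, of h] continuous_on_shift[OF cont1, of h]
    continuous_on_shift[OF cont2, of h] continuous_on_shift[OF contH, of h]
  have dsh: "((\<lambda>y. f (y + h)) has_vector_derivative f' (y + h)) (at y)"
    if "\<And>y. (f has_vector_derivative f' y) (at y)" for f f' :: "real \<Rightarrow> complex" and y
  proof -
    have "(f \<circ> (\<lambda>y. y + h) has_vector_derivative 1 *\<^sub>R f' (y + h)) (at y)"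
      by (intro vector_diff_chain_at that) (auto intro!: derivative_eq_intros)
    then show ?thesis by (simp add: o_def)
  qed
  have "integral {0..1} ?X = 0"
  proof (rule integral_periodic_derivative)
    show "w (y + 1) * Im (G1 (y + 1 + h) * cnj (G (y + 1)) + G (y + 1 + h) * cnj (G1 (y + 1))) =
      w y * Im (G1 (y + h) * cnj (G y) + G (y + h) * cnj (G1 y))" for y
    proof -
      have "y + 1 + h = (y + h) + 1" by simp
      then show ?thesis by (simp only: per perw)
    qed
    show "((\<lambda>y. w y * Im (G1 (y + h) * cnj (G y) + G (y + h) * cnj (G1 y))) has_vector_derivative ?X y) (at y)" for y
    proof -
      have "((\<lambda>y. Im (G1 (y + h) * cnj (G y) + G (y + h) * cnj (G1 y))) has_vector_derivative
          Im ((G1 (y + h) * cnj (G1 y) + G2 (y + h) * cnj (G y)) + (G (y + h) * cnj (G2 y) + G1 (y + h) * cnj (G1 y)))) (at y)"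
        by (intro bounded_linear.has_vector_derivative[OF bounded_linear_Im] has_vector_derivative_mult
            has_vector_derivative_add has_vector_derivative_cnj der der1 dsh)
      from has_vector_derivative_mult[OF derw[of y, unfolded has_real_derivative_iff_has_vector_derivative] this]
      show ?thesis by (rule back_subst[of "\<lambda>d. (_ has_vector_derivative d) (at y)"]) (simp add: algebra_simps)
    qed
  qed
  moreover have "?X integrable_on {0..1}"
    by (intro integrable_unit_interval continuous_intros cont cont1 cont2 contw contw' shifts)
  ultimately have X: "(?X has_integral 0) {0..1}" unfolding has_integral_integrable_integral by blast
  have one: "((\<lambda>y::real. 1::real) has_integral 1) {0..1}"
    using has_integral_const_real[of "1::real" 0 1] by simp
  define S where "S = integral {0..1} (\<lambda>y. (cmod (G (y + h) - G y))\<^sup>2)"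
  have S: "((\<lambda>y. (cmod (G (y + h) - G y))\<^sup>2) has_integral S) {0..1}"
    unfolding S_def by (intro integrable_integral integrable_unit_interval continuous_intros cont shifts)
  have Sle: "S \<le> h\<^sup>2 * dissipation"
    unfolding S_def dissipation_def using h by (intro shift_difference_bound) auto
  have q0: "q \<noteq> 0" "\<bar>q\<bar> > 0" using q by auto
  have q1: "1 / \<bar>q\<bar> \<le> 1" using q by (simp add: divide_le_eq_1)
  \<comment> \<open>The viscous cross term carries \<nu> |q|; raised to \<nu> q^2, it can be paid by
    the damping \<nu> q^2 in the energy estimate.\<close>
  have absq: "\<bar>q\<bar> \<le> q\<^sup>2" using mult_left_mono[OF q, of "\<bar>q\<bar>"] by (simp add: power2_eq_square abs_mult_self_eq)
  have pt: "w y * Im (H (y + h) * cnj (G y) + G (y + h) * cnj (H y)) / q \<le>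
      \<nu> / q * ?X y - m / 2 * (p y * (cmod (G y))\<^sup>2) + m / 2 * (cmod (G (y + h) - G y))\<^sup>2
      + e / 2 * ((cmod (G (y + h)))\<^sup>2 + (cmod (G y))\<^sup>2)
      + \<nu> * (C' / 2 * (\<Lambda> * ((cmod (G1 (y + h)))\<^sup>2 + (cmod (G1 y))\<^sup>2) + 1 / \<Lambda> * ((cmod (G (y + h)))\<^sup>2 + (cmod (G y))\<^sup>2))
            + C * ((cmod (G1 (y + h)))\<^sup>2 + (cmod (G1 y))\<^sup>2))
      + \<nu> * q\<^sup>2 * C * ((cmod (G (y + h)))\<^sup>2 + (cmod (G y))\<^sup>2)
      + C * \<rho> * (1 + 1 / 2 * ((cmod (G (y + h)))\<^sup>2 + (cmod (G y))\<^sup>2))" for y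
  proof -
    define a where "a = cmod (G y)"
    define ah where "ah = cmod (G (y + h))"
    define d where "d = cmod (G1 y)"
    define dh where "dh = cmod (G1 (y + h))"
    define re where "re = Re (G (y + h) * cnj (G y))"
    have pos: "0 \<le> a" "0 \<le> ah" "0 \<le> d" "0 \<le> dh" by (auto simp: a_def ah_def d_def dh_def)
    have eq: "w y * Im (H (y + h) * cnj (G y) + G (y + h) * cnj (H y)) / q =
        - (w y * (b (y + h) - b y)) * re + \<nu> / q * ?X y
        - \<nu> / q * (2 * w y * Im (G1 (y + h) * cnj (G1 y)) + w' y * Im (G1 (y + h) * cnj (G y) + G (y + h) * cnj (G1 y)))
        - 2 * \<nu> * q * (w y * Im (G (y + h) * cnj (G y))) + w y * Im (R (y + h) * cnj (G y) + G (y + h) * cnj (R y)) / q"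
    proof -
      have "w y * Im (H (y + h) * cnj (G y) + G (y + h) * cnj (H y)) / q =
        w y * (Im (H (y + h) * cnj (G y) + G (y + h) * cnj (H y)) / q)" by simp
      also have "\<dots> = w y * (- (b (y + h) - b y) * re + \<nu> / q * Im (G2 (y + h) * cnj (G y) + G (y + h) * cnj (G2 y))
        - 2 * \<nu> * q * Im (G (y + h) * cnj (G y)) + Im (R (y + h) * cnj (G y) + G (y + h) * cnj (R y)) / q)"
        unfolding H_def re_def cross_term_identity ..
      finally show ?thesis by (simp only: ring_distribs times_divide_eq_right mult_ac) (simp add: algebra_simps)
    qed
    \<comment> \<open>Polarisation: twice the real part \<open>re\<close> is the sum of the squared
      moduli at y + h and y minus the squared difference. The modulus at y + h is dropped, and p at
      most 1 removes p from the difference.\<close>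
    have t1: "- (w y * (b (y + h) - b y)) * re \<le> - m / 2 * (p y * a\<^sup>2) + m / 2 * (cmod (G (y + h) - G y))\<^sup>2 + e / 2 * (ah\<^sup>2 + a\<^sup>2)"
    proof -
      have re2: "2 * re = ah\<^sup>2 + a\<^sup>2 - (cmod (G (y + h) - G y))\<^sup>2"
        unfolding re_def ah_def a_def cmod_power2 by (simp add: power2_eq_square algebra_simps)
      have reb: "2 * \<bar>re\<bar> \<le> ah\<^sup>2 + a\<^sup>2"
      proof -
        have "\<bar>re\<bar> \<le> ah * a" unfolding re_def ah_def a_def
          using abs_Re_le_cmod[of "G (y + h) * cnj (G y)"] by (simp add: norm_mult)
        then show ?thesis using sum_squares_bound[of ah a] by simp
      qed
      have "- (w y * (b (y + h) - b y) - m * p y) * re \<le> \<bar>w y * (b (y + h) - b y) - m * p y\<bar> * \<bar>re\<bar>"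
        by (metis abs_ge_self abs_minus_cancel abs_mult)
      also have "\<dots> \<le> e * ((ah\<^sup>2 + a\<^sup>2) / 2)"
        using commutator[of y] reb abs_ge_zero order_trans[OF abs_ge_zero commutator[of y]] by (intro mult_mono) auto
      finally have A: "- (w y * (b (y + h) - b y) - m * p y) * re \<le> e / 2 * (ah\<^sup>2 + a\<^sup>2)" by simp
      have "p y * (a\<^sup>2 - (cmod (G (y + h) - G y))\<^sup>2) \<le> p y * (2 * re)"
        using p(1)[of y] by (intro mult_left_mono) (auto simp: re2)
      moreover have "p y * (cmod (G (y + h) - G y))\<^sup>2 \<le> (cmod (G (y + h) - G y))\<^sup>2"
        using p[of y] by (intro mult_left_le_one_le) auto
      ultimately have "p y * a\<^sup>2 - (cmod (G (y + h) - G y))\<^sup>2 \<le> p y * (2 * re)"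
        by (simp add: right_diff_distrib)
      then have "m / 2 * (p y * a\<^sup>2 - (cmod (G (y + h) - G y))\<^sup>2) \<le> m / 2 * (p y * (2 * re))"
        using m by (intro mult_left_mono) auto
      then show ?thesis using A by (simp add: algebra_simps)
    qed
    have im: "\<bar>Im (u * cnj v)\<bar> \<le> cmod u * cmod v" for u v
      using abs_Im_le_cmod[of "u * cnj v"] by (simp add: norm_mult)
    have t2: "\<bar>2 * w y * Im (G1 (y + h) * cnj (G1 y)) + w' y * Im (G1 (y + h) * cnj (G y) + G (y + h) * cnj (G1 y))\<bar>
        \<le> C' / 2 * (\<Lambda> * (dh\<^sup>2 + d\<^sup>2) + 1 / \<Lambda> * (ah\<^sup>2 + a\<^sup>2)) + C * (dh\<^sup>2 + d\<^sup>2)"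
    proof -
      have young: "u * v \<le> (\<Lambda> * u\<^sup>2 + 1 / \<Lambda> * v\<^sup>2) / 2" for u v
        using sum_squares_bound[of "sqrt \<Lambda> * u" "v / sqrt \<Lambda>"] \<Lambda>
        by (simp add: power_mult_distrib power_divide)
      have "\<bar>2 * w y * Im (G1 (y + h) * cnj (G1 y))\<bar> \<le> 2 * (C * (dh * d))"
        unfolding abs_mult using w(1)[of y] im[of "G1 (y + h)" "G1 y"] C_nonneg
        by (simp add: mult.assoc dh_def d_def mult_mono)
      also have "\<dots> \<le> C * (dh\<^sup>2 + d\<^sup>2)"
        using mult_left_mono[OF sum_squares_bound[of dh d] C_nonneg(1)] by simp
      finally have A: "\<bar>2 * w y * Im (G1 (y + h) * cnj (G1 y))\<bar> \<le> C * (dh\<^sup>2 + d\<^sup>2)" .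
      have "\<bar>Im (G1 (y + h) * cnj (G y) + G (y + h) * cnj (G1 y))\<bar> \<le> dh * a + ah * d"
        using im[of "G1 (y + h)" "G y"] im[of "G (y + h)" "G1 y"]
        by (simp add: dh_def a_def ah_def d_def)
      also have "\<dots> \<le> (\<Lambda> * dh\<^sup>2 + 1 / \<Lambda> * a\<^sup>2) / 2 + (\<Lambda> * d\<^sup>2 + 1 / \<Lambda> * ah\<^sup>2) / 2"
        using young[of dh a] young[of d ah] unfolding mult.commute[of ah d] by (rule add_mono)
      also have "\<dots> = 1 / 2 * (\<Lambda> * (dh\<^sup>2 + d\<^sup>2) + 1 / \<Lambda> * (ah\<^sup>2 + a\<^sup>2))" using \<Lambda> by (simp add: field_simps)
      finally have "\<bar>w' y * Im (G1 (y + h) * cnj (G y) + G (y + h) * cnj (G1 y))\<bar>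
          \<le> C' * (1 / 2 * (\<Lambda> * (dh\<^sup>2 + d\<^sup>2) + 1 / \<Lambda> * (ah\<^sup>2 + a\<^sup>2)))"
        unfolding abs_mult[of "w' y"] using w(2)[of y] C_nonneg by (intro mult_mono) auto
      then have "\<bar>2 * w y * Im (G1 (y + h) * cnj (G1 y))\<bar> + \<bar>w' y * Im (G1 (y + h) * cnj (G y) + G (y + h) * cnj (G1 y))\<bar>
          \<le> C * (dh\<^sup>2 + d\<^sup>2) + C' / 2 * (\<Lambda> * (dh\<^sup>2 + d\<^sup>2) + 1 / \<Lambda> * (ah\<^sup>2 + a\<^sup>2))"
        using A by (intro add_mono) simp_all
      then show ?thesis by (intro order_trans[OF abs_triangle_ineq]) (simp only: add.commute)
    qed
    have t2': "- \<nu> / q * u \<le> \<nu> * K" if "\<bar>u\<bar> \<le> K" for u K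
    proof -
      have "- \<nu> / q * u \<le> \<bar>\<nu> / q * u\<bar>" using abs_ge_minus_self[of "\<nu> / q * u"] by simp
      also have "\<dots> = \<nu> * (1 / \<bar>q\<bar> * \<bar>u\<bar>)" using \<nu> by (simp add: abs_mult abs_divide)
      also have "\<dots> \<le> \<nu> * (1 * K)" using \<nu> that q1 by (intro mult_left_mono mult_mono) auto
      finally show ?thesis by simp
    qed
    have imN: "2 * \<bar>w y * Im (G (y + h) * cnj (G y))\<bar> \<le> C * (ah\<^sup>2 + a\<^sup>2)"
    proof -
      have "\<bar>w y * Im (G (y + h) * cnj (G y))\<bar> \<le> C * (ah * a)"
        unfolding abs_mult using w(1)[of y] im[of "G (y + h)" "G y"] C_nonneg
        by (intro mult_mono) (auto simp: ah_def a_def)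
      then show ?thesis using mult_left_mono[OF sum_squares_bound[of ah a] C_nonneg(1)] by simp
    qed
    have t3: "- 2 * \<nu> * q * (w y * Im (G (y + h) * cnj (G y))) \<le> \<nu> * q\<^sup>2 * C * (ah\<^sup>2 + a\<^sup>2)"
    proof -
      have "- 2 * \<nu> * q * (w y * Im (G (y + h) * cnj (G y))) \<le> \<bar>- 2 * \<nu> * q * (w y * Im (G (y + h) * cnj (G y)))\<bar>"
        by (rule abs_ge_self)
      also have "\<dots> = \<nu> * (\<bar>q\<bar> * (2 * \<bar>w y * Im (G (y + h) * cnj (G y))\<bar>))" using \<nu> by (simp add: abs_mult)
      also have "\<dots> \<le> \<nu> * (q\<^sup>2 * (C * (ah\<^sup>2 + a\<^sup>2)))"
        using \<nu> by (intro mult_left_mono mult_mono[OF absq imN]) auto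
      finally show ?thesis by (simp only: mult.assoc)
    qed
    have t4: "w y * Im (R (y + h) * cnj (G y) + G (y + h) * cnj (R y)) / q \<le> C * \<rho> * (1 + 1 / 2 * (ah\<^sup>2 + a\<^sup>2))"
    proof -
      have "\<bar>Im (R (y + h) * cnj (G y) + G (y + h) * cnj (R y))\<bar> \<le> cmod (R (y + h)) * a + ah * cmod (R y)"
        using im[of "R (y + h)" "G y"] im[of "G (y + h)" "R y"] by (simp add: a_def ah_def)
      also have "\<dots> \<le> \<rho> * a + ah * \<rho>"
        using R pos by (intro add_mono mult_right_mono mult_left_mono) auto
      also have "\<dots> = \<rho> * (ah + a)" by (simp add: algebra_simps)
      also have "\<dots> \<le> \<rho> * (1 + 1 / 2 * (ah\<^sup>2 + a\<^sup>2))"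
        using sum_squares_bound[of 1 ah] sum_squares_bound[of 1 a] by (intro mult_left_mono rho_nonneg) (simp add: field_simps)
      finally have A: "\<bar>Im (R (y + h) * cnj (G y) + G (y + h) * cnj (R y))\<bar> \<le> \<rho> * (1 + 1 / 2 * (ah\<^sup>2 + a\<^sup>2))" .
      have "w y * Im (R (y + h) * cnj (G y) + G (y + h) * cnj (R y)) / q \<le>
          \<bar>w y * Im (R (y + h) * cnj (G y) + G (y + h) * cnj (R y)) / q\<bar>" by (rule abs_ge_self)
      also have "\<dots> = 1 / \<bar>q\<bar> * (\<bar>w y\<bar> * \<bar>Im (R (y + h) * cnj (G y) + G (y + h) * cnj (R y))\<bar>)"
        by (simp only: abs_mult abs_divide times_divide_eq_left mult_1)
      also have "\<dots> \<le> 1 * (C * (\<rho> * (1 + 1 / 2 * (ah\<^sup>2 + a\<^sup>2))))"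
        using C_nonneg rho_nonneg by (intro mult_mono[OF q1] mult_mono[OF w(1) A]) auto
      finally show ?thesis by (simp add: mult.assoc)
    qed
    show ?thesis
      using t1 t2'[OF t2] t3 t4 eq unfolding a_def[symmetric] ah_def[symmetric] d_def[symmetric] dh_def[symmetric]
      by linarith
  qed
  have "integral {0..1} (\<lambda>y. w y * Im (H (y + h) * cnj (G y) + G (y + h) * cnj (H y)) / q) \<le>
      \<nu> / q * 0 - m / 2 * weighted_mass + m / 2 * S + e / 2 * (mass + mass)
      + \<nu> * (C' / 2 * (\<Lambda> * (dissipation + dissipation) + 1 / \<Lambda> * (mass + mass)) + C * (dissipation + dissipation))
      + \<nu> * q\<^sup>2 * C * (mass + mass) + C * \<rho> * (1 + 1 / 2 * (mass + mass))"
  proof (rule has_integral_le[OF integrable_integral _ pt])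
    show "(\<lambda>y. w y * Im (H (y + h) * cnj (G y) + G (y + h) * cnj (H y)) / q) integrable_on {0..1}"
      using q0 by (intro integrable_unit_interval continuous_intros cont contH contw shifts) auto
  qed (intro has_integral_add has_integral_diff has_integral_mult_right X has_integral_mass S
          has_integral_dissipation one has_integral_weighted_mass has_integral_mass_shift has_integral_dissipation_shift)
  also have "\<dots> \<le> - m * (weighted_mass - h\<^sup>2 * dissipation) / 2 + e * mass
      + \<nu> * (C' * (\<Lambda> * dissipation + mass / \<Lambda>) + 2 * C * dissipation)
      + 2 * \<nu> * q\<^sup>2 * C * mass + C * \<rho> * (1 + mass)"
    using mult_left_mono[OF Sle m] by (simp add: field_simps)
  finally show ?thesis by simp
qed

text \<open>Once \<theta> C is at most 1/2, this makes the corrected functional comparable to the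
  mass.\<close>

lemma cross_bound:
  "\<bar>integral {0..1} (\<lambda>y. w y * Im (G (y + h) * cnj (G y))) / q\<bar> \<le> C * mass"
proof -
  have "norm (integral {0..1} (\<lambda>y. w y * Im (G (y + h) * cnj (G y)))) \<le>
      integral {0..1} (\<lambda>y. C / 2 * ((cmod (G (y + h)))\<^sup>2 + (cmod (G y))\<^sup>2))"
  proof (rule integral_norm_bound_integral)
    show "(\<lambda>y. w y * Im (G (y + h) * cnj (G y))) integrable_on {0..1}"
      by (intro integrable_unit_interval continuous_intros cont contw continuous_on_shift)
    show "(\<lambda>y. C / 2 * ((cmod (G (y + h)))\<^sup>2 + (cmod (G y))\<^sup>2)) integrable_on {0..1}"
      by (intro integrable_unit_interval continuous_intros cont continuous_on_shift)
    fix y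
    have "\<bar>Im (G (y + h) * cnj (G y))\<bar> \<le> cmod (G (y + h)) * cmod (G y)"
      using abs_Im_le_cmod[of "G (y + h) * cnj (G y)"] by (simp add: norm_mult)
    also have "\<dots> \<le> 1 / 2 * ((cmod (G (y + h)))\<^sup>2 + (cmod (G y))\<^sup>2)"
      using sum_squares_bound[of "cmod (G (y + h))" "cmod (G y)"] by simp
    finally have "\<bar>w y\<bar> * \<bar>Im (G (y + h) * cnj (G y))\<bar> \<le> C * (1 / 2 * ((cmod (G (y + h)))\<^sup>2 + (cmod (G y))\<^sup>2))"
      using w(1)[of y] C_nonneg by (intro mult_mono) auto
    then show "norm (w y * Im (G (y + h) * cnj (G y))) \<le> C / 2 * ((cmod (G (y + h)))\<^sup>2 + (cmod (G y))\<^sup>2)"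
      by (simp add: abs_mult)
  qed
  also have "\<dots> = C / 2 * (mass + mass)"
    by (intro integral_unique has_integral_mult_right has_integral_add has_integral_mass has_integral_mass_shift)
  finally have A: "\<bar>integral {0..1} (\<lambda>y. w y * Im (G (y + h) * cnj (G y)))\<bar> \<le> C * mass" by simp
  have "\<bar>integral {0..1} (\<lambda>y. w y * Im (G (y + h) * cnj (G y))) / q\<bar> \<le>
      \<bar>integral {0..1} (\<lambda>y. w y * Im (G (y + h) * cnj (G y)))\<bar> / 1"
    unfolding abs_divide using q by (intro divide_left_mono) auto
  with A show ?thesis by simp
qed

end

subsection \<open>The hypocoercive inequality\<close>

text \<open>
  Here \<open>H\<close> plays the role of \<open>\<partial>\<^sub>t G\<close> for a mode \<open>G\<close> with \<open>x\<close>-frequency \<open>q\<close> and forcing \<open>R\<close>, so the last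
  inequality bounds the time derivative of the functional.
\<close>

definition hypocoercive ::
    "(real \<Rightarrow> real) \<Rightarrow> real \<Rightarrow> real \<Rightarrow> real \<Rightarrow> real \<Rightarrow> (real \<Rightarrow> real) \<Rightarrow> bool" where
  "hypocoercive b \<nu> \<theta> r h w \<longleftrightarrow> continuous_on UNIV w \<and>
      (\<forall>(q::real) (G::real \<Rightarrow> complex) G1 (G2::real \<Rightarrow> complex) (R::real \<Rightarrow> complex) H \<rho>. 1 \<le> \<bar>q\<bar> \<longrightarrow> periodic_C1 G G1 \<longrightarrow>
        (\<forall>y. (G1 has_vector_derivative G2 y) (at y)) \<longrightarrow> continuous_on UNIV G2 \<longrightarrow>
        continuous_on UNIV R \<longrightarrow> (\<forall>y. cmod (R y) \<le> \<rho>) \<longrightarrow>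
        (\<forall>y. H y = - \<i> * (q * b y) * G y + \<nu> * (G2 y - q\<^sup>2 * G y) + R y) \<longrightarrow>
        \<bar>\<theta> * (integral {0..1} (\<lambda>y. w y * Im (G (y + h) * cnj (G y))) / q)\<bar>
          \<le> integral {0..1} (\<lambda>y. (cmod (G y))\<^sup>2) / 2 \<and>
        integral {0..1} (\<lambda>y. 2 * Re (cnj (G y) * H y))
          + \<theta> * (integral {0..1} (\<lambda>y. w y * Im (H (y + h) * cnj (G y) + G (y + h) * cnj (H y))) / q)
          \<le> - r * integral {0..1} (\<lambda>y. (cmod (G y))\<^sup>2)
            + 2 * \<rho> * (1 + integral {0..1} (\<lambda>y. (cmod (G y))\<^sup>2)))"

text \<open>\<theta> is so small that the cross term spends at most half of each of the two
  dissipative terms of the energy estimate. What it adds is decay of the mass at the rate m, which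
  is a constant times \<nu>^((N+1)/(N+3)).\<close>

lemma shear_hypocoercivity:
  assumes sm: "smooth b" and per: "\<And>x. b (x + 1) = b x"
    and nz: "\<And>y. \<exists>k\<in>{1..N + 1}. (deriv ^^ k) b y \<noteq> 0"
  obtains \<theta> \<gamma> where "\<theta> > 0" "\<gamma> > 0"
    "\<And>\<nu>. 0 < \<nu> \<Longrightarrow> \<nu> < 1 \<Longrightarrow> \<exists>h w. hypocoercive b \<nu> \<theta> (\<gamma> * \<nu> powr (real (N + 1) / real (N + 3))) h w"
proof -
  obtain C c Z where C: "C \<ge> 1" and c: "0 < c" "c \<le> 1" and Z: "finite Z"
    and weight: "\<And>\<delta>. 0 < \<delta> \<Longrightarrow> \<delta> \<le> 1 \<Longrightarrow> \<exists>w w' p.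
       admissible_weight b N C c Z \<delta> w w' p"
    by (rule shear_weight[OF sm per nz]) blast
  \<comment> \<open>M is at least 2 card Z and positive even for empty Z. The choice of \<kappa>
    makes the commutator error C \<kappa> m equal to c m / 16, a keeps M \<delta> at most 1/8, and
    \<Lambda> makes the mass part of the w' term c m / 16 as well. Against the gain 3 c m / 8 this
    leaves c m / 4. K adds up the coefficients of \<nu> times the dissipation, and \<theta> K =
    1.\<close>
  define M where "M = 2 * real (card Z) + 1"
  define \<kappa> where "\<kappa> = c / (16 * C)"
  define a where "a = 1 / (8 * M)"
  define \<Lambda> where "\<Lambda> = 16 * C / (\<kappa> * c * a ^ (N + 3))"
  define K where "K = 4 * M\<^sup>2 + 1 + C * \<Lambda> + 2 * C"
  define \<theta> where "\<theta> = 1 / K"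
  define \<gamma> where "\<gamma> = \<theta> * (c / 4) * \<kappa> * a ^ (N + 1)"
  have M: "M \<ge> 1" by (simp add: M_def)
  have \<kappa>: "0 < \<kappa>" "\<kappa> \<le> 1" using C c by (auto simp: \<kappa>_def field_simps)
  have a: "0 < a" "a \<le> 1" "M * a = 1 / 8" using M by (auto simp: a_def field_simps)
  have \<Lambda>: "0 < \<Lambda>" using C \<kappa> c a by (simp add: \<Lambda>_def)
  have K: "K \<ge> 2 * C" "K > 0" using C \<Lambda> by (auto simp: K_def intro!: add_nonneg_pos)
  have \<theta>: "\<theta> > 0" "\<theta> * K = 1" "\<theta> * C \<le> 1 / 2" using K by (auto simp: \<theta>_def field_simps)
  have \<gamma>: "\<gamma> > 0" using \<theta> c \<kappa> a by (simp add: \<gamma>_def)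
  have contb: "continuous_on UNIV b"
    using smooth_has_derivative[OF sm, of 0] DERIV_isCont
    by (intro continuous_at_imp_continuous_on) fastforce
  show ?thesis
  proof (rule that[OF \<theta>(1) \<gamma>])
    fix \<nu> :: real assume \<nu>: "0 < \<nu>" "\<nu> < 1"
    \<comment> \<open>With this exponent m \<delta>^2 is a fixed multiple of \<nu>, so errors of the
      form m \<delta>^2 times the dissipation are of viscous size.\<close>
    define \<delta> where "\<delta> = a * \<nu> powr (1 / real (N + 3))"
    define m where "m = \<kappa> * \<delta> ^ (N + 1)"
    have pw: "(\<nu> powr (1 / real (N + 3))) ^ k = \<nu> powr (real k / real (N + 3))" for k
      using powr_realpow[of "\<nu> powr (1 / real (N + 3))" k] \<nu> powr_powr[of \<nu> "1 / real (N + 3)" "real k"] by simp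
    have \<delta>3: "\<delta> ^ (N + 3) = a ^ (N + 3) * \<nu>"
      unfolding \<delta>_def power_mult_distrib pw using \<nu> by simp
    have \<delta>1: "\<delta> ^ (N + 1) = a ^ (N + 1) * \<nu> powr (real (N + 1) / real (N + 3))"
      unfolding \<delta>_def power_mult_distrib pw ..
    have \<delta>: "0 < \<delta>" "\<delta> \<le> a"
    proof -
      show "0 < \<delta>" using a \<nu> by (simp add: \<delta>_def)
      have "\<nu> powr (1 / real (N + 3)) \<le> 1 powr (1 / real (N + 3))"
        using \<nu> by (intro powr_mono2) auto
      then show "\<delta> \<le> a" using a mult_left_mono[of "\<nu> powr (1 / real (N + 3))" 1 a] by (simp add: \<delta>_def)
    qed
    have m: "0 < m" using \<kappa> \<delta> by (simp add: m_def)
    have m\<delta>: "m * \<delta>\<^sup>2 \<le> \<nu>" "m * \<delta>\<^sup>2 = \<kappa> * a ^ (N + 3) * \<nu>"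
    proof -
      show "m * \<delta>\<^sup>2 = \<kappa> * a ^ (N + 3) * \<nu>"
      proof -
        have "m * \<delta>\<^sup>2 = \<kappa> * \<delta> ^ (N + 3)" by (simp add: m_def power_add power2_eq_square power3_eq_cube)
        then show ?thesis by (simp only: \<delta>3 mult.assoc)
      qed
      moreover have "\<kappa> * a ^ (N + 3) \<le> 1 * 1" using \<kappa> a by (intro mult_mono power_le_one) auto
      ultimately show "m * \<delta>\<^sup>2 \<le> \<nu>" using mult_right_mono[of "\<kappa> * a ^ (N + 3)" 1 \<nu>] \<nu> by simp
    qed
    have "\<delta> \<le> 1" using \<delta> a by linarith
    from weight[OF \<delta>(1) this] obtain w w' p where W0: "admissible_weight b N C c Z \<delta> w w' p" by (elim exE)
    then have W: "\<And>y. (w has_real_derivative w' y) (at y)" "continuous_on UNIV w'" "continuous_on UNIV p"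
      "\<And>y. w (y + 1) = w y" "\<And>y. \<bar>w y\<bar> \<le> C" "\<And>y. \<bar>w' y\<bar> \<le> C / \<delta>" "\<And>y. 0 \<le> p y" "\<And>y. p y \<le> 1"
      "\<And>\<kappa> y. 0 < \<kappa> \<Longrightarrow> \<kappa> \<le> 1 \<Longrightarrow>
          \<bar>w y * (b (y + \<kappa> * \<delta>) - b y) - \<kappa> * \<delta> ^ (N + 1) * p y\<bar> \<le> C * \<kappa>\<^sup>2 * \<delta> ^ (N + 1)"
      "\<And>y. y\<in>{0..1} \<Longrightarrow> p y < c \<Longrightarrow> \<exists>z\<in>Z. \<bar>y - z\<bar> < \<delta>"
      unfolding admissible_weight_def by blast+
    have cw: "continuous_on UNIV w"
      using W(1) DERIV_isCont by (intro continuous_at_imp_continuous_on) blast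
    show "\<exists>h w. hypocoercive b \<nu> \<theta> (\<gamma> * \<nu> powr (real (N + 1) / real (N + 3))) h w"
      unfolding hypocoercive_def
    proof (rule exI[of _ "\<kappa> * \<delta>"], rule exI[of _ w], rule conjI[OF cw], intro allI impI conjI)
      fix q \<rho> :: real and G G1 G2 R H :: "real \<Rightarrow> complex"
      assume q: "1 \<le> \<bar>q\<bar>" and G: "periodic_C1 G G1"
        and G1: "\<forall>y. (G1 has_vector_derivative G2 y) (at y)" and G2: "continuous_on UNIV G2"
        and R: "continuous_on UNIV R" "\<forall>y. cmod (R y) \<le> \<rho>"
        and H: "\<forall>y. H y = - \<i> * (q * b y) * G y + \<nu> * (G2 y - q\<^sup>2 * G y) + R y"
      interpret periodic_C1 G G1 by (rule G)
      have h: "0 < \<kappa> * \<delta>" "\<kappa> * \<delta> \<le> 1" using \<kappa> \<delta> a mult_mono[of \<kappa> 1 \<delta> 1] by auto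
      interpret sm: shear_mode G G1 G2 R b w w' p \<nu> q "\<kappa> * \<delta>" C "C / \<delta>" m "C * \<kappa> * m" \<rho>
      proof unfold_locales
        show "\<bar>w y * (b (y + \<kappa> * \<delta>) - b y) - m * p y\<bar> \<le> C * \<kappa> * m" for y
          using W(9)[OF \<kappa>, of y] by (simp add: m_def power2_eq_square mult_ac)
      qed (use G1 G2 R q W contb h \<nu> m in auto)
      have Heq: "H = sm.H" using H by (auto simp: sm.H_def)
      define N0 where "N0 = sm.mass"
      define D where "D = sm.dissipation"
      define P where "P = sm.weighted_mass"
      have N0: "0 \<le> N0" and D: "0 \<le> D" by (auto simp: N0_def D_def sm.mass_nonneg sm.dissipation_nonneg)
      have P: "P \<ge> 3 * c / 4 * N0 - 8 * M\<^sup>2 * \<delta>\<^sup>2 * D"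
      proof -
        \<comment> \<open>This length turns M \<delta> / s into 1/8. Together with M \<delta> at
          most 1/8, the exceptional intervals take at most a quarter of the mass.\<close>
        let ?s = "8 * M * \<delta>"
        have s: "?s > 0" using M \<delta> by simp
        have M\<delta>: "M * \<delta> \<le> 1 / 8" using mult_left_mono[OF \<delta>(2), of M] M a(3) by simp
        have "c * (N0 - 2 * card Z * \<delta> * ((1 + 1 / ?s) * N0 + ?s * D)) \<le> P"
          unfolding N0_def D_def P_def sm.mass_def sm.dissipation_def sm.weighted_mass_def
          by (rule mass_lower_bound[OF s \<delta>(1) Z c(1) W(3,7,10)])
        moreover have "2 * card Z * \<delta> * ((1 + 1 / ?s) * N0 + ?s * D) \<le> M * \<delta> * ((1 + 1 / ?s) * N0 + ?s * D)"
          using \<delta> s N0 D by (intro mult_right_mono add_nonneg_nonneg mult_nonneg_nonneg) (auto simp: M_def)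
        moreover have "M * \<delta> * ((1 + 1 / ?s) * N0 + ?s * D) = (M * \<delta> + 1 / 8) * N0 + 8 * M\<^sup>2 * \<delta>\<^sup>2 * D"
          using M \<delta> by (simp add: field_simps power2_eq_square)
        moreover have "(M * \<delta> + 1 / 8) * N0 \<le> 1 / 4 * N0" using M\<delta> N0 by (intro mult_right_mono) auto
        ultimately have "c * (3 / 4 * N0 - 8 * M\<^sup>2 * \<delta>\<^sup>2 * D) \<le> P"
          using c mult_left_mono[of "3 / 4 * N0 - 8 * M\<^sup>2 * \<delta>\<^sup>2 * D" "N0 - 2 * card Z * \<delta> * ((1 + 1 / ?s) * N0 + ?s * D)" c]
          by linarith
        moreover have "c * (8 * M\<^sup>2 * \<delta>\<^sup>2 * D) \<le> 1 * (8 * M\<^sup>2 * \<delta>\<^sup>2 * D)"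
          using c D by (intro mult_right_mono) auto
        ultimately show ?thesis by (simp add: algebra_simps)
      qed
      have dJ: "integral {0..1} (\<lambda>y. w y * Im (H (y + \<kappa> * \<delta>) * cnj (G y) + G (y + \<kappa> * \<delta>) * cnj (H y))) / q
          \<le> - (c / 4) * m * N0 + \<nu> * K * D + 2 * \<nu> * q\<^sup>2 * C * N0 + C * \<rho> * (1 + N0)"
      proof -
        have "m * (3 * c / 4 * N0 - 8 * M\<^sup>2 * \<delta>\<^sup>2 * D) \<le> m * P" using P m by (intro mult_left_mono) auto
        moreover have "8 * M\<^sup>2 * (m * \<delta>\<^sup>2) * D \<le> 8 * M\<^sup>2 * \<nu> * D"
          using m\<delta> D by (intro mult_right_mono mult_left_mono) auto
        ultimately have e1: "- m * P / 2 \<le> - (3 * c / 8) * m * N0 + 4 * M\<^sup>2 * \<nu> * D"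
          by (simp add: algebra_simps)
        have "m * (\<kappa> * \<delta>)\<^sup>2 = \<kappa>\<^sup>2 * (m * \<delta>\<^sup>2)" by (simp add: power_mult_distrib)
        also have "\<dots> \<le> 1 * \<nu>" using \<kappa> m by (intro mult_mono m\<delta>(1)) (auto simp: power_le_one)
        finally have e2: "m * (\<kappa> * \<delta>)\<^sup>2 * D \<le> \<nu> * D" using D by (intro mult_right_mono) auto
        have e3: "C * \<kappa> * m = c / 16 * m" using C by (simp add: \<kappa>_def)
        \<comment> \<open>The Young weight is \<Lambda> \<delta>: it cancels the 1/\<delta> in the
          bound on w' in front of the dissipation, and leaves 1/\<delta>^2 in front of the mass,
          where \<nu>/\<delta>^2 is of size m.\<close>
        have e4: "\<nu> * (C / \<delta>) * (N0 / (\<Lambda> * \<delta>)) = c / 16 * m * N0"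
        proof -
          have "C / \<Lambda> = \<kappa> * c * a ^ (N + 3) / 16" using C by (simp add: \<Lambda>_def)
          then have "\<nu> * (C / \<Lambda>) = c / 16 * (m * \<delta>\<^sup>2)" unfolding m\<delta>(2) by (simp only:) simp
          moreover have "\<nu> * (C / \<delta>) * (N0 / (\<Lambda> * \<delta>)) = \<nu> * (C / \<Lambda>) * N0 / \<delta>\<^sup>2"
            by (simp add: power2_eq_square)
          moreover have "c / 16 * (m * \<delta>\<^sup>2) * N0 / \<delta>\<^sup>2 = c / 16 * m * N0" using \<delta> by simp
          ultimately show ?thesis by (simp only:)
        qed
        have e5: "\<nu> * ((C / \<delta>) * (\<Lambda> * \<delta> * D)) = \<nu> * C * \<Lambda> * D" using \<delta> by simp
        have "integral {0..1} (\<lambda>y. w y * Im (H (y + \<kappa> * \<delta>) * cnj (G y) + G (y + \<kappa> * \<delta>) * cnj (H y))) / q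
          \<le> - m * (P - (\<kappa> * \<delta>)\<^sup>2 * D) / 2 + C * \<kappa> * m * N0
      + \<nu> * ((C / \<delta>) * (\<Lambda> * \<delta> * D + N0 / (\<Lambda> * \<delta>)) + 2 * C * D)
      + 2 * \<nu> * q\<^sup>2 * C * N0 + C * \<rho> * (1 + N0)"
          unfolding Heq N0_def D_def P_def using \<Lambda> \<delta> by (intro sm.cross_estimate) auto
        also have "\<dots> = - m * P / 2 + m * (\<kappa> * \<delta>)\<^sup>2 * D / 2 + C * \<kappa> * m * N0
          + \<nu> * ((C / \<delta>) * (\<Lambda> * \<delta> * D)) + \<nu> * (C / \<delta>) * (N0 / (\<Lambda> * \<delta>)) + \<nu> * (2 * C * D)
          + 2 * \<nu> * q\<^sup>2 * C * N0 + C * \<rho> * (1 + N0)"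
        proof -
          have "- m * (P - X) / 2 = - m * P / 2 + m * X / 2" for X by (simp add: field_simps)
          then show ?thesis by (simp only: distrib_left mult.assoc add.assoc)
        qed
        also have "\<dots> \<le> - (c / 4) * m * N0 + \<nu> * K * D + 2 * \<nu> * q\<^sup>2 * C * N0 + C * \<rho> * (1 + N0)"
        proof -
          have "0 \<le> \<nu> * D" using \<nu> D by simp
          then have "m * (\<kappa> * \<delta>)\<^sup>2 * D / 2 \<le> \<nu> * D" using e2 by linarith
          moreover have "\<nu> * K * D = 4 * M\<^sup>2 * \<nu> * D + \<nu> * D + \<nu> * C * \<Lambda> * D + \<nu> * (2 * C * D)"
            by (simp add: K_def algebra_simps)
          ultimately show ?thesis unfolding e3 e4 e5 using e1 by (simp add: algebra_simps)
        qed
        finally show ?thesis .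
      qed
      have dN: "integral {0..1} (\<lambda>y. 2 * Re (cnj (G y) * H y)) \<le> - 2 * \<nu> * D - 2 * \<nu> * q\<^sup>2 * N0 + \<rho> * (1 + N0)"
        unfolding Heq N0_def D_def by (rule sm.energy_estimate)
      have J: "\<bar>\<theta> * (integral {0..1} (\<lambda>y. w y * Im (G (y + \<kappa> * \<delta>) * cnj (G y))) / q)\<bar> \<le> N0 / 2"
      proof -
        have "\<bar>\<theta> * (integral {0..1} (\<lambda>y. w y * Im (G (y + \<kappa> * \<delta>) * cnj (G y))) / q)\<bar> \<le> \<theta> * (C * N0)"
          unfolding abs_mult[of \<theta>] N0_def using \<theta> sm.cross_bound by (intro mult_mono) auto
        also have "\<dots> \<le> 1 / 2 * N0" using mult_right_mono[OF \<theta>(3) N0] by (simp add: mult.assoc)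
        finally show ?thesis by simp
      qed
      have "\<theta> * (integral {0..1} (\<lambda>y. w y * Im (H (y + \<kappa> * \<delta>) * cnj (G y) + G (y + \<kappa> * \<delta>) * cnj (H y))) / q)
          \<le> \<theta> * (- (c / 4) * m * N0 + \<nu> * K * D + 2 * \<nu> * q\<^sup>2 * C * N0 + C * \<rho> * (1 + N0))"
        using \<theta> dJ by (intro mult_left_mono) auto
      also have "\<dots> = - (\<theta> * (c / 4) * m) * N0 + (\<theta> * K) * (\<nu> * D) + (\<theta> * C) * (2 * \<nu> * q\<^sup>2 * N0) + (\<theta> * C) * (\<rho> * (1 + N0))"
        by (simp add: algebra_simps)
      also have "\<dots> \<le> - (\<theta> * (c / 4) * m) * N0 + 1 * (\<nu> * D) + (1 / 2) * (2 * \<nu> * q\<^sup>2 * N0) + (1 / 2) * (\<rho> * (1 + N0))"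
        using \<theta> N0 D \<nu> sm.rho_nonneg by (intro add_mono mult_right_mono) auto
      finally have "integral {0..1} (\<lambda>y. 2 * Re (cnj (G y) * H y)) + \<theta> * (integral {0..1} (\<lambda>y. w y * Im (H (y + \<kappa> * \<delta>) * cnj (G y) + G (y + \<kappa> * \<delta>) * cnj (H y))) / q)
          \<le> - (\<theta> * (c / 4) * m) * N0 - \<nu> * D - \<nu> * q\<^sup>2 * N0 + (3 / 2) * (\<rho> * (1 + N0))"
        using dN by linarith
      also have "\<dots> \<le> - (\<theta> * (c / 4) * m) * N0 + 2 * (\<rho> * (1 + N0))"
      proof -
        have "0 \<le> \<nu> * D" "0 \<le> \<nu> * q\<^sup>2 * N0" "0 \<le> \<rho> * (1 + N0)" using \<nu> D N0 sm.rho_nonneg by auto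
        then show ?thesis by linarith
      qed
      also have "\<theta> * (c / 4) * m = \<gamma> * \<nu> powr (real (N + 1) / real (N + 3))"
        unfolding \<gamma>_def m_def \<delta>1 by (simp add: mult_ac)
      finally have fin: "integral {0..1} (\<lambda>y. 2 * Re (cnj (G y) * H y))
          + \<theta> * (integral {0..1} (\<lambda>y. w y * Im (H (y + \<kappa> * \<delta>) * cnj (G y) + G (y + \<kappa> * \<delta>) * cnj (H y))) / q)
          \<le> - (\<gamma> * \<nu> powr (real (N + 1) / real (N + 3))) * N0 + 2 * \<rho> * (1 + N0)" by (simp add: mult.assoc)
      show "\<bar>\<theta> * (integral {0..1} (\<lambda>y. w y * Im (G (y + \<kappa> * \<delta>) * cnj (G y))) / q)\<bar>
          \<le> integral {0..1} (\<lambda>y. (cmod (G y))\<^sup>2) / 2"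
        using J unfolding N0_def sm.mass_def .
      show "integral {0..1} (\<lambda>y. 2 * Re (cnj (G y) * H y))
          + \<theta> * (integral {0..1} (\<lambda>y. w y * Im (H (y + \<kappa> * \<delta>) * cnj (G y) + G (y + \<kappa> * \<delta>) * cnj (H y))) / q)
          \<le> - (\<gamma> * \<nu> powr (real (N + 1) / real (N + 3))) * integral {0..1} (\<lambda>y. (cmod (G y))\<^sup>2)
            + 2 * \<rho> * (1 + integral {0..1} (\<lambda>y. (cmod (G y))\<^sup>2))"
        using fin unfolding N0_def sm.mass_def .
    qed
  qed
qed

subsection \<open>Square-integrable functions on the torus\<close>

lemma sets_circle[simp, measurable_cong]: "sets circle = sets (restrict_space borel {0..<1::real})"
  by (simp add: circle_def sets_restrict_space)

lemma space_circle[simp]: "space circle = {0..<1}"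
  by (simp add: circle_def space_restrict_space)

interpretation circle: finite_measure circle
  by (rule finite_measureI) (simp add: circle_def emeasure_restrict_space space_restrict_space)

interpretation torus: pair_sigma_finite circle circle ..

interpretation torus: finite_measure torus
  unfolding torus_def by (rule finite_measure_pair_measure; unfold_locales)

lemma measurable_torus_borel:
  fixes f :: "real \<times> real \<Rightarrow> 'a::topological_space"
  assumes "f \<in> borel_measurable borel"
  shows "f \<in> borel_measurable torus"
proof -
  have "id \<in> circle \<rightarrow>\<^sub>M borel"
    unfolding circle_def by (auto intro!: measurable_restrict_space1)
  then have [measurable]: "(\<lambda>x. x) \<in> circle \<rightarrow>\<^sub>M borel" by (simp add: id_def)
  have "(\<lambda>p. (fst p, snd p)) \<in> torus \<rightarrow>\<^sub>M borel \<Otimes>\<^sub>M borel"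
    unfolding torus_def by measurable
  then have i: "(\<lambda>p. p) \<in> torus \<rightarrow>\<^sub>M borel" by (simp add: borel_prod)
  show ?thesis using measurable_compose[OF i assms] by simp
qed

lemma continuous_measurable_torus:
  fixes f :: "real \<times> real \<Rightarrow> 'a::topological_space"
  shows "continuous_on UNIV f \<Longrightarrow> f \<in> borel_measurable torus"
  by (intro measurable_torus_borel borel_measurable_continuous_onI)

text \<open>Fourier analysis is complex-valued, so \<open>in_L2\<close> is extended to general
  measures and normed codomains.\<close>

definition square_integrable :: "'a measure \<Rightarrow> ('a \<Rightarrow> 'b::{real_normed_vector, second_countable_topology}) \<Rightarrow> bool" where
  "square_integrable M f \<longleftrightarrow> f \<in> borel_measurable M \<and> integrable M (\<lambda>x. (norm (f x))\<^sup>2)"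

lemma square_integrable_measurable[measurable_dest]: "square_integrable M f \<Longrightarrow> f \<in> borel_measurable M"
  by (simp add: square_integrable_def)

lemma in_L2_iff: "in_L2 f \<longleftrightarrow> square_integrable torus f"
  by (simp add: in_L2_def square_integrable_def)

lemma square_integrable_add:
  assumes "square_integrable M f" "square_integrable M g"
  shows "square_integrable M (\<lambda>x. f x + g x)"
  unfolding square_integrable_def
proof
  show [measurable]: "(\<lambda>x. f x + g x) \<in> borel_measurable M" using assms by measurable
  have "integrable M (\<lambda>x. 2 * (norm (f x))\<^sup>2 + 2 * (norm (g x))\<^sup>2)"
    using assms by (auto simp: square_integrable_def)
  then show "integrable M (\<lambda>x. (norm (f x + g x))\<^sup>2)"
  proof (rule Bochner_Integration.integrable_bound)
    have "(norm (f x + g x))\<^sup>2 \<le> 2 * (norm (f x))\<^sup>2 + 2 * (norm (g x))\<^sup>2" for x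
    proof -
      have "(norm (f x + g x))\<^sup>2 \<le> (norm (f x) + norm (g x))\<^sup>2"
        by (intro power_mono norm_triangle_ineq) auto
      then show ?thesis using sum_squares_bound[of "norm (f x)" "norm (g x)"] by (simp add: power2_sum)
    qed
    then show "AE x in M. norm ((norm (f x + g x))\<^sup>2) \<le> norm (2 * (norm (f x))\<^sup>2 + 2 * (norm (g x))\<^sup>2)"
      by (auto simp: abs_of_nonneg)
  qed simp
qed

lemma square_integrable_uminus:
  "square_integrable M f \<Longrightarrow> square_integrable M (\<lambda>x. - f x)"
  by (auto simp: square_integrable_def)

lemma square_integrable_diff:
  assumes "square_integrable M f" "square_integrable M g"
  shows "square_integrable M (\<lambda>x. f x - g x)"
  using square_integrable_add[OF assms(1) square_integrable_uminus[OF assms(2)]] by simp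

lemma (in finite_measure) bounded_square_integrable:
  assumes "f \<in> borel_measurable M" "\<And>x. x \<in> space M \<Longrightarrow> norm (f x) \<le> B"
  shows "square_integrable M f"
  unfolding square_integrable_def
  using assms by (auto intro!: integrable_const_bound[of _ "B\<^sup>2"] AE_I2 power_mono)

lemma integrable_mult_L2:
  fixes f g :: "'a \<Rightarrow> 'b::{real_normed_div_algebra, second_countable_topology, banach}"
  assumes "square_integrable M f" "square_integrable M g"
  shows "integrable M (\<lambda>x. f x * g x)"
proof -
  have [measurable]: "f \<in> borel_measurable M" "g \<in> borel_measurable M" using assms by measurable
  have "integrable M (\<lambda>x. (norm (f x))\<^sup>2 + (norm (g x))\<^sup>2)"
    using assms by (auto simp: square_integrable_def)
  then show ?thesis
  proof (rule Bochner_Integration.integrable_bound)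
    have "norm (f x * g x) \<le> (norm (f x))\<^sup>2 + (norm (g x))\<^sup>2" for x
    proof -
      have "2 * (norm (f x) * norm (g x)) \<le> (norm (f x))\<^sup>2 + (norm (g x))\<^sup>2"
        using sum_squares_bound[of "norm (f x)" "norm (g x)"] by simp
      moreover have "0 \<le> norm (f x) * norm (g x)" by simp
      ultimately show ?thesis unfolding norm_mult by linarith
    qed
    then show "AE x in M. norm (f x * g x) \<le> norm ((norm (f x))\<^sup>2 + (norm (g x))\<^sup>2)"
      by (auto simp: abs_of_nonneg)
  qed measurable
qed

text \<open>The squared norm of |f| - s |g| is a nonnegative quadratic in s. Its minimum at I / B,
  where B is the integral of |g|^2, gives the bound; if B is zero the quadratic is affine and hence
  constant.\<close>

lemma Cauchy_Schwarz_L2: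
  fixes f g :: "'a \<Rightarrow> 'b::{real_normed_div_algebra, second_countable_topology, banach}"
  assumes f: "square_integrable M f" and g: "square_integrable M g"
  shows "(norm (LINT x|M. f x * g x))\<^sup>2 \<le> (LINT x|M. (norm (f x))\<^sup>2) * (LINT x|M. (norm (g x))\<^sup>2)"
proof -
  let ?A = "LINT x|M. (norm (f x))\<^sup>2" and ?B = "LINT x|M. (norm (g x))\<^sup>2"
  define I where "I = (LINT x|M. norm (f x) * norm (g x))"
  have int: "integrable M (\<lambda>x. (norm (f x))\<^sup>2)" "integrable M (\<lambda>x. (norm (g x))\<^sup>2)"
    "integrable M (\<lambda>x. norm (f x) * norm (g x))"
    using f g integrable_norm[OF integrable_mult_L2[OF f g]] by (auto simp: square_integrable_def norm_mult)
  have A0: "0 \<le> ?A" "0 \<le> ?B" "0 \<le> I" by (auto simp: I_def)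
  have quad: "0 \<le> ?A - 2 * s * I + s\<^sup>2 * ?B" for s
  proof -
    have "0 \<le> (LINT x|M. (norm (f x) - s * norm (g x))\<^sup>2)" by simp
    also have "\<dots> = (LINT x|M. ((norm (f x))\<^sup>2 - 2 * s * (norm (f x) * norm (g x))) + s\<^sup>2 * (norm (g x))\<^sup>2)"
      by (simp add: power2_diff power_mult_distrib algebra_simps)
    also have "\<dots> = ?A - 2 * s * I + s\<^sup>2 * ?B" using int by (simp add: I_def)
    finally show ?thesis .
  qed
  have "I\<^sup>2 \<le> ?A * ?B"
  proof (cases "?B = 0")
    case True
    have "I = 0"
    proof (rule ccontr)
      assume "I \<noteq> 0"
      \<comment> \<open>At this s the quadratic, affine here, equals -1.\<close>
      then show False using quad[of "(?A + 1) / (2 * I)"] True A0 by (simp add: field_simps)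
    qed
    then show ?thesis using True by simp
  next
    case False
    then have "?B > 0" using A0 by linarith
    moreover have "?A - 2 * (I / ?B) * I + (I / ?B)\<^sup>2 * ?B = ?A - I\<^sup>2 / ?B"
      using False by (simp add: power2_eq_square)
    ultimately have "I\<^sup>2 / ?B \<le> ?A" "?B > 0" using quad[of "I / ?B"] by simp_all
    then show ?thesis by (simp only: pos_divide_le_eq)
  qed
  moreover have "norm (LINT x|M. f x * g x) \<le> I"
    unfolding I_def using integral_norm_bound[of M "\<lambda>x. f x * g x"] by (simp add: norm_mult)
  ultimately show ?thesis by (meson norm_ge_zero order_trans power_mono)
qed

subsection \<open>Fourier characters\<close>

definition fourier_char :: "int \<times> int \<Rightarrow> real \<times> real \<Rightarrow> complex" where
  "fourier_char kl p = cis (2 * pi * (of_int (fst kl) * fst p + of_int (snd kl) * snd p))"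

lemma continuous_fourier_char: "continuous_on UNIV (fourier_char kl)"
  unfolding fourier_char_def[abs_def] by (intro continuous_intros)

lemma measurable_fourier_char[measurable]: "fourier_char kl \<in> borel_measurable torus"
  by (rule continuous_measurable_torus[OF continuous_fourier_char])

lemma norm_fourier_char[simp]: "norm (fourier_char kl p) = 1"
  by (simp add: fourier_char_def)

lemma fourier_char_mult_cnj:
  "fourier_char kl p * cnj (fourier_char kl' p) = fourier_char (fst kl - fst kl', snd kl - snd kl') p"
  by (simp add: fourier_char_def cis_cnj cis_mult algebra_simps)

lemma fourier_char_mult:
  "fourier_char kl p * fourier_char kl' p = fourier_char (fst kl + fst kl', snd kl + snd kl') p"
  by (simp add: fourier_char_def cis_mult algebra_simps)

lemma integral_cis_circle:
  "(LINT x|circle. cis (2 * pi * of_int k * x)) = (if k = 0 then 1 else 0)"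
proof -
  let ?f = "\<lambda>x. cis (2 * pi * of_int k * x)"
  have m: "?f \<in> borel_measurable borel"
    by (intro borel_measurable_continuous_onI continuous_intros)
  have "(LINT x|circle. ?f x) = (LINT x|lborel. indicator {0..<1} x *\<^sub>R ?f x)"
    unfolding circle_def by (rule integral_restrict_space) simp
  \<comment> \<open>The fundamental domain lacks the null set {1}; the fundamental theorem of
    calculus needs the closed interval.\<close>
  also have "\<dots> = (LINT x|lborel. indicator {0..1} x *\<^sub>R ?f x)"
  proof (rule integral_cong_AE)
    have "AE x in lborel. x \<noteq> (1::real)" by (rule AE_lborel_singleton)
    then show "AE x in lborel. indicator {0..<1} x *\<^sub>R ?f x = indicator {0..1} x *\<^sub>R ?f x"
      by eventually_elim (auto simp: indicator_def)
  qed (use m in measurable)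
  also have "\<dots> = (if k = 0 then 1 else 0)"
  proof (cases "k = 0")
    case False
    define z where "z = 2 * pi * of_int k * \<i>"
    have z: "z \<noteq> 0" using False by (simp add: z_def)
    let ?F = "\<lambda>x. ?f x / z"
    have "(LINT x|lborel. indicator {0..1} x *\<^sub>R ?f x) = ?F 1 - ?F 0"
    proof (rule integral_FTC_Icc)
      show "(?F has_vector_derivative ?f x) (at x within {0..1})" for x
      proof -
        have "(?f has_vector_derivative (z * ?f x)) (at x within {0..1})"
          unfolding has_vector_derivative_def z_def
          by (auto intro!: derivative_eq_intros simp: scaleR_conv_of_real)
        from has_vector_derivative_divide[OF this, of z] show ?thesis using z by simp
      qed
    qed (auto intro!: continuous_intros)
    also have "?f 1 = 1" by simp
    then have "?F 1 - ?F 0 = 0" by simp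
    finally show ?thesis using False by simp
  qed simp
  finally show ?thesis .
qed

lemma square_integrable_torus_continuous:
  fixes f :: "real \<times> real \<Rightarrow> 'a::{real_normed_vector, second_countable_topology}"
  assumes "continuous_on UNIV f"
  shows "square_integrable torus f"
proof -
  have "compact (f ` ({0..1} \<times> {0..1}))"
    using assms by (intro compact_continuous_image compact_Times) (auto intro: continuous_on_subset)
  then obtain B where B: "\<And>p. p \<in> {0..1} \<times> {0..1} \<Longrightarrow> norm (f p) \<le> B"
    by (meson bounded_iff compact_imp_bounded imageI)
  show ?thesis
    by (rule torus.bounded_square_integrable[where B = B])
       (use assms B in \<open>auto simp: torus_def space_pair_measure intro: continuous_measurable_torus[unfolded torus_def]\<close>)
qed

lemma integrable_torus_continuous:
  fixes f :: "real \<times> real \<Rightarrow> 'a::{real_normed_div_algebra, second_countable_topology, banach}"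
  assumes "continuous_on UNIV f"
  shows "integrable torus f"
  using integrable_mult_L2[OF square_integrable_torus_continuous[OF assms]
      square_integrable_torus_continuous[OF continuous_on_const[of _ 1]]] by simp

lemma integral_fourier_char: "(LINT p|torus. fourier_char kl p) = (if kl = (0, 0) then 1 else 0)"
proof -
  obtain k l where kl: "kl = (k, l)" by (cases kl)
  have "integrable torus (fourier_char kl)"
    by (rule integrable_torus_continuous[OF continuous_fourier_char])
  then have "(LINT p|torus. fourier_char kl p) = (LINT x|circle. LINT y|circle. fourier_char kl (x, y))"
    unfolding torus_def by (rule torus.integral_fst'[symmetric])
  also have "\<dots> = (LINT x|circle. LINT y|circle. cis (2 * pi * of_int k * x) * cis (2 * pi * of_int l * y))"
    by (simp add: fourier_char_def kl cis_mult algebra_simps)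
  also have "\<dots> = (LINT x|circle. cis (2 * pi * of_int k * x)) * (LINT y|circle. cis (2 * pi * of_int l * y))"
    by simp
  finally show ?thesis unfolding integral_cis_circle kl by simp
qed

lemma norm_trig_poly:
  assumes "finite S"
  shows "(LINT p|torus. (cmod (\<Sum>kl\<in>S. a kl * fourier_char kl p))\<^sup>2) = (\<Sum>kl\<in>S. (cmod (a kl))\<^sup>2)"
proof -
  have i: "integrable torus (fourier_char kl)" for kl
    by (rule integrable_torus_continuous[OF continuous_fourier_char])
  have "complex_of_real (LINT p|torus. (cmod (\<Sum>kl\<in>S. a kl * fourier_char kl p))\<^sup>2) =
      (LINT p|torus. (\<Sum>kl\<in>S. a kl * fourier_char kl p) * cnj (\<Sum>kl\<in>S. a kl * fourier_char kl p))"
    by (simp only: complex_norm_square[symmetric] integral_complex_of_real)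
  also have "\<dots> = (LINT p|torus. (\<Sum>kl\<in>S. \<Sum>kl'\<in>S. (a kl * cnj (a kl')) * fourier_char (fst kl - fst kl', snd kl - snd kl') p))"
  proof (intro Bochner_Integration.integral_cong refl)
    fix p
    have "(\<Sum>kl\<in>S. a kl * fourier_char kl p) * cnj (\<Sum>kl\<in>S. a kl * fourier_char kl p) =
        (\<Sum>kl\<in>S. \<Sum>kl'\<in>S. (a kl * fourier_char kl p) * (cnj (a kl') * cnj (fourier_char kl' p)))"
      by (simp only: cnj_sum complex_cnj_mult sum_product)
    also have "\<dots> = (\<Sum>kl\<in>S. \<Sum>kl'\<in>S. (a kl * cnj (a kl')) * (fourier_char kl p * cnj (fourier_char kl' p)))"
      by (simp only: mult_ac)
    finally show "(\<Sum>kl\<in>S. a kl * fourier_char kl p) * cnj (\<Sum>kl\<in>S. a kl * fourier_char kl p) =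
        (\<Sum>kl\<in>S. \<Sum>kl'\<in>S. (a kl * cnj (a kl')) * fourier_char (fst kl - fst kl', snd kl - snd kl') p)"
      by (simp only: fourier_char_mult_cnj)
  qed
  also have "\<dots> = (\<Sum>kl\<in>S. \<Sum>kl'\<in>S. (a kl * cnj (a kl')) * (if kl' = kl then 1 else 0))"
  proof -
    have "(LINT p|torus. fourier_char (fst kl - fst kl', snd kl - snd kl') p) = (if kl' = kl then 1 else 0)" for kl kl'
      by (auto simp: integral_fourier_char prod_eq_iff)
    then show ?thesis by (simp add: i)
  qed
  also have "\<dots> = (\<Sum>kl\<in>S. a kl * cnj (a kl))"
    using assms by (intro sum.cong refl) (simp add: if_distrib[of "(*) _"] cong: if_cong)
  also have "\<dots> = complex_of_real (\<Sum>kl\<in>S. (cmod (a kl))\<^sup>2)"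
    by (simp add: complex_norm_square[symmetric] del: of_real_power)
  finally show ?thesis by (simp only: of_real_eq_iff)
qed

definition fcoeff :: "(real \<times> real \<Rightarrow> real) \<Rightarrow> int \<times> int \<Rightarrow> complex" where
  "fcoeff f kl = (LINT p|torus. of_real (f p) * cnj (fourier_char kl p))"

lemma square_integrable_of_real:
  "in_L2 f \<Longrightarrow> square_integrable torus (\<lambda>p. complex_of_real (f p))"
  by (auto simp: in_L2_def square_integrable_def)

lemma integrable_L2_continuous:
  fixes g :: "real \<times> real \<Rightarrow> complex"
  assumes "in_L2 f" "continuous_on UNIV g"
  shows "integrable torus (\<lambda>p. of_real (f p) * g p)"
  by (rule integrable_mult_L2[OF square_integrable_of_real[OF assms(1)] square_integrable_torus_continuous[OF assms(2)]])

text \<open>One identity gives both halves of Parseval. With a equal to the Fourier coefficients,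
  nonnegativity of the left side is Bessel's inequality. For any other a the last sum is
  nonnegative, so a good approximation forces the coefficients over S to carry almost the whole
  norm.\<close>

lemma trig_poly_approximation_error:
  assumes f: "in_L2 f" and S: "finite S"
  shows "(LINT p|torus. (cmod (of_real (f p) - (\<Sum>kl\<in>S. a kl * fourier_char kl p)))\<^sup>2) =
    (LINT p|torus. (f p)\<^sup>2) - (\<Sum>kl\<in>S. (cmod (fcoeff f kl))\<^sup>2) + (\<Sum>kl\<in>S. (cmod (a kl - fcoeff f kl))\<^sup>2)"
proof -
  let ?P = "\<lambda>p. \<Sum>kl\<in>S. a kl * fourier_char kl p"
  have cP: "continuous_on UNIV ?P" by (intro continuous_intros continuous_fourier_char)
  have i1: "integrable torus (\<lambda>p. (f p)\<^sup>2)" using f by (simp add: in_L2_def)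
  have i2: "integrable torus (\<lambda>p. of_real (f p) * cnj (?P p))"
    by (intro integrable_L2_continuous f continuous_intros cP)
  have i3: "integrable torus (\<lambda>p. (cmod (?P p))\<^sup>2)"
    using square_integrable_torus_continuous[OF cP] by (simp add: square_integrable_def)
  have fe: "integrable torus (\<lambda>p. of_real (f p) * cnj (fourier_char kl p))" for kl
    by (intro integrable_L2_continuous f continuous_intros continuous_fourier_char)
  have "(LINT p|torus. (cmod (of_real (f p) - ?P p))\<^sup>2) =
      (LINT p|torus. (f p)\<^sup>2 - 2 * Re (of_real (f p) * cnj (?P p)) + (cmod (?P p))\<^sup>2)"
    by (intro Bochner_Integration.integral_cong refl) (simp only: cmod_power2, simp add: power2_eq_square algebra_simps)
  also have "\<dots> = (LINT p|torus. (f p)\<^sup>2) - 2 * Re (LINT p|torus. of_real (f p) * cnj (?P p)) + (\<Sum>kl\<in>S. (cmod (a kl))\<^sup>2)"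
    unfolding norm_trig_poly[OF S, symmetric] using i1 i3 integrable_Re[OF i2]
    by (simp only: Bochner_Integration.integral_add Bochner_Integration.integral_diff Bochner_Integration.integrable_diff
        integrable_mult_right integral_mult_right_zero integral_Re[OF i2])
  also have "(LINT p|torus. of_real (f p) * cnj (?P p)) = (\<Sum>kl\<in>S. cnj (a kl) * fcoeff f kl)"
  proof -
    have "(\<lambda>p. of_real (f p) * cnj (?P p)) = (\<lambda>p. \<Sum>kl\<in>S. cnj (a kl) * (of_real (f p) * cnj (fourier_char kl p)))"
      by (simp add: sum_distrib_left mult_ac)
    then show ?thesis using fe by (simp add: fcoeff_def)
  qed
  finally have E: "(LINT p|torus. (cmod (of_real (f p) - ?P p))\<^sup>2) =
      (LINT p|torus. (f p)\<^sup>2) - 2 * Re (\<Sum>kl\<in>S. cnj (a kl) * fcoeff f kl) + (\<Sum>kl\<in>S. (cmod (a kl))\<^sup>2)" .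
  have "- 2 * Re (\<Sum>kl\<in>S. cnj (a kl) * fcoeff f kl) + (\<Sum>kl\<in>S. (cmod (a kl))\<^sup>2)
      = - (\<Sum>kl\<in>S. (cmod (fcoeff f kl))\<^sup>2) + (\<Sum>kl\<in>S. (cmod (a kl - fcoeff f kl))\<^sup>2)"
    unfolding Re_sum sum_distrib_left sum_negf[symmetric] sum.distrib[symmetric]
    by (intro sum.cong refl) (simp only: cmod_power2, simp add: power2_eq_square algebra_simps)
  then show ?thesis using E by linarith
qed

lemma Bessel:
  assumes "in_L2 f" "finite S"
  shows "(\<Sum>kl\<in>S. (cmod (fcoeff f kl))\<^sup>2) \<le> (LINT p|torus. (f p)\<^sup>2)"
proof -
  have "0 \<le> (LINT p|torus. (cmod (of_real (f p) - (\<Sum>kl\<in>S. fcoeff f kl * fourier_char kl p)))\<^sup>2)" by simp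
  then show ?thesis using trig_poly_approximation_error[OF assms, of "fcoeff f"] by simp
qed

lemma L2_norm_nonneg: "0 \<le> L2_norm f" by (simp add: L2_norm_def)

lemma L2_norm_power2: "(L2_norm f)\<^sup>2 = (LINT p|torus. (f p)\<^sup>2)"
  by (simp add: L2_norm_def)

lemma norm_fcoeff_le: "in_L2 f \<Longrightarrow> cmod (fcoeff f kl) \<le> L2_norm f"
  using Bessel[of f "{kl}"] power2_le_imp_le[OF _ L2_norm_nonneg, of "cmod (fcoeff f kl)" f]
  by (simp add: L2_norm_power2)

lemma in_L2_diff: "in_L2 f \<Longrightarrow> in_L2 g \<Longrightarrow> in_L2 (\<lambda>p. f p - g p)"
  unfolding in_L2_iff by (rule square_integrable_diff)

lemma fcoeff_diff:
  assumes "in_L2 f" "in_L2 g"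
  shows "fcoeff (\<lambda>p. f p - g p) kl = fcoeff f kl - fcoeff g kl"
  unfolding fcoeff_def
  using integrable_L2_continuous[OF assms(1) continuous_on_cnj[OF continuous_fourier_char]]
    integrable_L2_continuous[OF assms(2) continuous_on_cnj[OF continuous_fourier_char]]
  by (simp add: left_diff_distrib)

section \<open>Chords of the circle and the commutator with a Fourier multiplier\<close>

lemma arc_le_chord:
  assumes "\<bar>\<theta>\<bar> \<le> pi"
  shows "\<bar>\<theta>\<bar> \<le> 4 * cmod (cis \<theta> - 1)"
proof (cases "\<bar>\<theta>\<bar> \<le> pi / 2")
  case True
  have "pi / 2 < 2" using pi_less_4 by simp
  then have t: "\<theta>\<^sup>2 \<le> 2\<^sup>2" using True by (subst abs_le_square_iff[symmetric]) auto
  \<comment> \<open>The fourth-order expansion, with \<theta>^4 at most 4 \<theta>^2, bounds the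
    squared chord 2 - 2 cos \<theta> below by \<theta>^2 / 4. For larger angles the cosine is at
    most 0 and the chord is at least 1.\<close>
  obtain t where "cos \<theta> = (\<Sum>m<4. cos_coeff m * \<theta> ^ m) + cos (t + 1/2 * real 4 * pi) / fact 4 * \<theta> ^ 4"
    using Maclaurin_cos_expansion[of \<theta> 4] by blast
  then have "cos \<theta> = 1 - \<theta>\<^sup>2 / 2 + cos (t + 2 * pi) / 24 * \<theta> ^ 4"
    by (simp add: cos_coeff_Suc sin_coeff_Suc numeral_eq_Suc fact_numeral)
  moreover have "cos (t + 2 * pi) / 24 * \<theta> ^ 4 \<le> 1 / 24 * \<theta> ^ 4"
    by (intro mult_right_mono divide_right_mono) auto
  moreover have "\<theta> ^ 4 \<le> 4 * \<theta>\<^sup>2"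
    using mult_right_mono[OF t, of "\<theta>\<^sup>2"] by (simp add: power4_eq_xxxx power2_eq_square mult.assoc)
  ultimately have "2 - 2 * cos \<theta> \<ge> \<theta>\<^sup>2 / 4" using zero_le_power2[of \<theta>] by linarith
  moreover have "(cmod (cis \<theta> - 1))\<^sup>2 = 2 - 2 * cos \<theta>"
    using sin_cos_squared_add[of \<theta>] unfolding cmod_power2 by (simp add: power2_diff power2_eq_square algebra_simps)
  ultimately have "\<bar>\<theta>\<bar>\<^sup>2 \<le> (4 * cmod (cis \<theta> - 1))\<^sup>2"
  proof -
    assume c: "\<theta>\<^sup>2 / 4 \<le> 2 - 2 * cos \<theta>" "(cmod (cis \<theta> - 1))\<^sup>2 = 2 - 2 * cos \<theta>"
    have "(4 * cmod (cis \<theta> - 1))\<^sup>2 = 16 * (cmod (cis \<theta> - 1))\<^sup>2" by (simp add: power_mult_distrib)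
    then show ?thesis using c zero_le_power2[of \<theta>] unfolding power2_abs by linarith
  qed
  then show ?thesis by (rule power2_le_imp_le) simp
next
  case False
  then have "cos \<theta> \<le> 0"
    using assms cos_monotone_0_pi_le[of "pi / 2" "\<bar>\<theta>\<bar>"] by simp
  then have "1 \<le> \<bar>Re (cis \<theta> - 1)\<bar>" by simp
  then have "1 \<le> cmod (cis \<theta> - 1)" using abs_Re_le_cmod order_trans by blast
  then show ?thesis using assms pi_less_4 by simp
qed

text \<open>The chord replaces the periodic distance because multiplication by
  \<open>cis z - 1\<close> acts on Fourier coefficients as a finite difference. Reducing y - y'
  modulo 1 to at most 1/2 in modulus brings the angle into the range of
  \<open>arc_le_chord\<close>.\<close>

lemma periodic_Lipschitz_chord:
  assumes sm: "smooth b" and per: "\<And>x. b (x + 1) = b x"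
  obtains B where "B > 0" "\<And>y y'. \<bar>b y - b y'\<bar> \<le> B * cmod (cis (2 * pi * (y - y')) - 1)"
proof -
  obtain B where B: "B \<ge> 1" "\<And>k x. k \<le> 1 \<Longrightarrow> \<bar>(deriv ^^ k) b x\<bar> \<le> B"
    using iterated_deriv_bounded[OF sm per] by metis
  have lip: "\<bar>b u - b v\<bar> \<le> B * \<bar>u - v\<bar>" for u v
    using field_differentiable_bound[of UNIV b "deriv b" B u v] B(2)[of 1]
      smooth_has_derivative[OF sm, of 0] by (simp add: has_field_derivative_at_within)
  have "\<bar>b y - b y'\<bar> \<le> 4 * B * cmod (cis (2 * pi * (y - y')) - 1)" for y y'
  proof -
    define n where "n = round (y - y')"
    define z where "z = y - y' - of_int n"
    have z: "\<bar>z\<bar> \<le> 1 / 2" using of_int_round_abs_le[of "y - y'"] by (simp add: z_def n_def abs_minus_commute)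
    have "b (y' + z) = b y"
      using periodic_shift_int[of b "y' + z" n] per by (simp add: z_def)
    then have "\<bar>b y - b y'\<bar> \<le> B * \<bar>z\<bar>" using lip[of "y' + z" y'] by simp
    also have "\<dots> \<le> B * (4 * cmod (cis (2 * pi * z) - 1))"
    proof (intro mult_left_mono)
      have "\<bar>2 * pi * z\<bar> \<le> 4 * cmod (cis (2 * pi * z) - 1)"
        using z by (intro arc_le_chord) (simp add: abs_mult)
      moreover have "1 * \<bar>z\<bar> \<le> (2 * pi) * \<bar>z\<bar>"
        using pi_gt3 by (intro mult_right_mono) auto
      ultimately show "\<bar>z\<bar> \<le> 4 * cmod (cis (2 * pi * z) - 1)" by (simp add: abs_mult)
    qed (use B in simp)
    also have "cis (2 * pi * z) = cis (2 * pi * (y - y'))"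
    proof -
      have "2 * pi * (y - y') = 2 * pi * z + 2 * pi * of_int n" by (simp add: z_def algebra_simps)
      then show ?thesis by (simp add: cis_mult[symmetric])
    qed
    finally show ?thesis by simp
  qed
  then show ?thesis using that[of "4 * B"] B(1) by auto
qed


lemma in_L2_mult_continuous:
  fixes g :: "real \<times> real \<Rightarrow> real"
  assumes f: "in_L2 f" and g: "continuous_on UNIV g"
  shows "in_L2 (\<lambda>p. f p * g p)"
proof -
  have "compact (g ` ({0..1} \<times> {0..1}))"
    using g by (intro compact_continuous_image compact_Times) (auto intro: continuous_on_subset)
  then obtain B where B: "\<And>p. p \<in> {0..1} \<times> {0..1} \<Longrightarrow> norm (g p) \<le> B"
    by (meson bounded_iff compact_imp_bounded imageI)
  have [measurable]: "f \<in> borel_measurable torus" "g \<in> borel_measurable torus"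
    using f continuous_measurable_torus[OF g] by (auto simp: in_L2_def)
  have "integrable torus (\<lambda>p. B\<^sup>2 * (f p)\<^sup>2)" using f by (simp add: in_L2_def)
  then have "integrable torus (\<lambda>p. (f p * g p)\<^sup>2)"
  proof (rule Bochner_Integration.integrable_bound)
    show "AE p in torus. norm ((f p * g p)\<^sup>2) \<le> norm (B\<^sup>2 * (f p)\<^sup>2)"
    proof (rule AE_I2)
      fix p assume "p \<in> space torus"
      then have "p \<in> {0..1} \<times> {0..1}" by (auto simp: torus_def space_pair_measure)
      then have "\<bar>g p\<bar>\<^sup>2 \<le> B\<^sup>2" using B by (intro power_mono) auto
      then show "norm ((f p * g p)\<^sup>2) \<le> norm (B\<^sup>2 * (f p)\<^sup>2)"
        using mult_left_mono[of "(g p)\<^sup>2" "B\<^sup>2" "(f p)\<^sup>2"] by (simp add: power_mult_distrib mult.commute)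
    qed
  qed measurable
  then show ?thesis by (simp add: in_L2_def)
qed

text \<open>Multiplication by \<open>cis z\<close> raises every index by one, which is why the
  right-hand sum reaches L + 1; the zero values just outside the range remove the boundary
  terms.\<close>

lemma summation_by_parts_cis:
  fixes \<sigma> :: "int \<Rightarrow> real"
  assumes "\<sigma> (- L - 1) = 0" "\<sigma> (L + 1) = 0" "0 \<le> L"
  shows "(cis z - 1) * (\<Sum>l\<in>{-L..L}. \<sigma> l * cis (l * z)) = (\<Sum>l\<in>{-L..L + 1}. (\<sigma> (l - 1) - \<sigma> l) * cis (l * z))"
proof -
  have "cis z * (\<Sum>l\<in>{-L..L}. \<sigma> l * cis (l * z)) = (\<Sum>l\<in>{-L..L}. \<sigma> l * cis ((l + 1) * z))"
    by (simp add: sum_distrib_left algebra_simps cis_mult[symmetric])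
  also have "\<dots> = (\<Sum>l\<in>{-L + 1..L + 1}. \<sigma> (l - 1) * cis (l * z))"
    by (rule sum.reindex_bij_witness[of _ "\<lambda>l. l - 1" "\<lambda>l. l + 1"]) auto
  also have "\<dots> = (\<Sum>l\<in>{-L..L + 1}. \<sigma> (l - 1) * cis (l * z))"
  proof (intro sum.mono_neutral_left ballI)
    fix l assume "l \<in> {- L..L + 1} - {- L + 1..L + 1}"
    then have "l = - L" by auto
    then show "\<sigma> (l - 1) * cis (l * z) = 0" using assms(1) by simp
  qed auto
  finally have 1: "cis z * (\<Sum>l\<in>{-L..L}. \<sigma> l * cis (l * z)) = (\<Sum>l\<in>{-L..L + 1}. \<sigma> (l - 1) * cis (l * z))" .
  have 2: "(\<Sum>l\<in>{-L..L}. \<sigma> l * cis (l * z)) = (\<Sum>l\<in>{-L..L + 1}. \<sigma> l * cis (l * z))"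
  proof (intro sum.mono_neutral_left ballI)
    fix l assume "l \<in> {- L..L + 1} - {- L..L}"
    then have "l = L + 1" by auto
    then show "\<sigma> l * cis (l * z) = 0" using assms(2) by simp
  qed auto
  have "(cis z - 1) * (\<Sum>l\<in>{-L..L}. \<sigma> l * cis (l * z)) =
      cis z * (\<Sum>l\<in>{-L..L}. \<sigma> l * cis (l * z)) - (\<Sum>l\<in>{-L..L}. \<sigma> l * cis (l * z))"
    by (simp only: left_diff_distrib mult_1)
  also have "\<dots> = (\<Sum>l\<in>{-L..L + 1}. (\<sigma> (l - 1) - \<sigma> l) * cis (l * z))"
    by (simp only: 1, simp only: 2) (simp add: sum_subtractf[symmetric] left_diff_distrib)
  finally show ?thesis .
qed

text \<open>The commutator of multiplication by \<open>b\<close> and convolution with a kernel with Fourier coefficients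
  \<open>\<sigma>\<close> is controlled by the kernel times the chord \<open>\<bar>e\<^sup>i\<^sup>z - 1\<bar>\<close>, whose coefficients are the differences
  of \<open>\<sigma>\<close>.\<close>
lemma multiplier_commutator_bound:
  fixes \<sigma> :: "int \<Rightarrow> real"
  assumes f: "in_L2 f" and contb: "continuous_on UNIV b" and B: "0 \<le> B"
    "\<And>y y'. \<bar>b y - b y'\<bar> \<le> B * cmod (cis (2 * pi * (y - y')) - 1)"
    and \<sigma>: "\<sigma> (- L - 1) = 0" "\<sigma> (L + 1) = 0" "0 \<le> L"
  shows "(cmod (\<Sum>l\<in>{-L..L}. \<sigma> l * (b y * fcoeff f (k, l) - fcoeff (\<lambda>p. f p * b (snd p)) (k, l)) * cis (2 * pi * l * y)))\<^sup>2
    \<le> (LINT p|torus. (f p)\<^sup>2) * (B\<^sup>2 * (\<Sum>l\<in>{-L..L + 1}. (\<sigma> (l - 1) - \<sigma> l)\<^sup>2))"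
proof -
  \<comment> \<open>Q is the smoothing kernel centred at y, carrying the conjugate x-character of
    frequency k. With g, the kernel times the difference of b, the integral of f g is the commutator
    at y.\<close>
  define Q where "Q = (\<lambda>p. (\<Sum>l\<in>{-L..L}. \<sigma> l * cis (2 * pi * l * y) * cnj (fourier_char (k, l) p)))"
  define g where "g = (\<lambda>p. complex_of_real (b y - b (snd p)) * Q p)"
  have cb: "continuous_on UNIV (\<lambda>p::real \<times> real. b (snd p))"
    using continuous_on_compose2[OF contb continuous_on_snd[OF continuous_on_id]] by simp
  have cQ: "continuous_on UNIV Q"
    unfolding Q_def by (intro continuous_intros continuous_fourier_char)
  have cg: "continuous_on UNIV g" unfolding g_def by (intro continuous_intros cb cQ)
  have fb: "in_L2 (\<lambda>p. f p * b (snd p))" by (rule in_L2_mult_continuous[OF f cb])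
  have i: "integrable torus (\<lambda>p. of_real (f p) * cnj (fourier_char kl p))"
    "integrable torus (\<lambda>p. of_real (f p * b (snd p)) * cnj (fourier_char kl p))" for kl
    by (intro integrable_L2_continuous[OF f] integrable_L2_continuous[OF fb] continuous_intros continuous_fourier_char)+
  have "(LINT p|torus. of_real (f p) * g p) = (LINT p|torus. (\<Sum>l\<in>{-L..L}.
      (\<sigma> l * cis (2 * pi * l * y)) * (b y * (of_real (f p) * cnj (fourier_char (k, l) p)) -
        of_real (f p * b (snd p)) * cnj (fourier_char (k, l) p))))"
    by (simp add: g_def Q_def sum_distrib_left algebra_simps)
  also have "\<dots> = (\<Sum>l\<in>{-L..L}. (\<sigma> l * cis (2 * pi * l * y)) * (b y * fcoeff f (k, l) - fcoeff (\<lambda>p. f p * b (snd p)) (k, l)))"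
    unfolding fcoeff_def using i
    by (simp only: Bochner_Integration.integral_sum Bochner_Integration.integral_diff Bochner_Integration.integrable_diff
        integrable_mult_right integral_mult_right_zero)
  finally have eq: "(\<Sum>l\<in>{-L..L}. \<sigma> l * (b y * fcoeff f (k, l) - fcoeff (\<lambda>p. f p * b (snd p)) (k, l)) * cis (2 * pi * l * y))
      = (LINT p|torus. of_real (f p) * g p)" by (simp only: mult_ac)
  have "(cmod (LINT p|torus. of_real (f p) * g p))\<^sup>2 \<le>
      (LINT p|torus. (cmod (of_real (f p)))\<^sup>2) * (LINT p|torus. (cmod (g p))\<^sup>2)"
    by (rule Cauchy_Schwarz_L2[OF square_integrable_of_real[OF f] square_integrable_torus_continuous[OF cg]])
  also have "(LINT p|torus. (cmod (g p))\<^sup>2) \<le> B\<^sup>2 * (\<Sum>l\<in>{-L..L + 1}. (\<sigma> (l - 1) - \<sigma> l)\<^sup>2)"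
  proof -
    \<comment> \<open>As functions of the second variable of p, the waves are characters of
      frequency -l. The x-dependence of g is a factor of modulus one, so the first frequency is 0
      and \<open>norm_trig_poly\<close> evaluates the norm.\<close>
    let ?a = "\<lambda>kl::int \<times> int. complex_of_real (\<sigma> (- snd kl - 1) - \<sigma> (- snd kl)) * cis (- (2 * pi * snd kl * y))"
    let ?S = "(\<lambda>l. (0::int, - l)) ` {-L..L + 1}"
    let ?T = "\<lambda>p. \<Sum>kl\<in>?S. ?a kl * fourier_char kl p"
    have inj: "inj_on (\<lambda>l. (0::int, - l)) {-L..L + 1}" by (auto simp: inj_on_def)
    have T: "?T p = (\<Sum>l\<in>{-L..L + 1}. (\<sigma> (l - 1) - \<sigma> l) * cis (l * (2 * pi * (y - snd p))))" for p
      unfolding sum.reindex[OF inj]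
      by (intro sum.cong refl) (simp add: fourier_char_def cis_mult algebra_simps)
    have Q: "Q p = cis (- (2 * pi * k * fst p)) * (\<Sum>l\<in>{-L..L}. \<sigma> l * cis (l * (2 * pi * (y - snd p))))" for p
      unfolding Q_def sum_distrib_left
      by (intro sum.cong refl) (simp add: fourier_char_def cis_cnj cis_mult algebra_simps)
    have pt: "(cmod (g p))\<^sup>2 \<le> B\<^sup>2 * (cmod (?T p))\<^sup>2" for p
    proof -
      have "cmod (g p) = \<bar>b y - b (snd p)\<bar> * cmod (\<Sum>l\<in>{-L..L}. \<sigma> l * cis (l * (2 * pi * (y - snd p))))"
        unfolding g_def Q by (simp add: norm_mult flip: of_real_diff)
      also have "\<dots> \<le> B * cmod (cis (2 * pi * (y - snd p)) - 1) * cmod (\<Sum>l\<in>{-L..L}. \<sigma> l * cis (l * (2 * pi * (y - snd p))))"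
        by (intro mult_right_mono B) auto
      also have "\<dots> = B * cmod (?T p)"
        unfolding T summation_by_parts_cis[OF \<sigma>, symmetric] by (simp add: norm_mult)
      finally have "(cmod (g p))\<^sup>2 \<le> (B * cmod (?T p))\<^sup>2" by (intro power_mono) auto
      then show ?thesis by (simp add: power_mult_distrib)
    qed
    have cT: "continuous_on UNIV ?T" by (intro continuous_intros continuous_fourier_char)
    have "(LINT p|torus. (cmod (g p))\<^sup>2) \<le> (LINT p|torus. B\<^sup>2 * (cmod (?T p))\<^sup>2)"
      using square_integrable_torus_continuous[OF cg] square_integrable_torus_continuous[OF cT]
      by (intro integral_mono pt) (auto simp: square_integrable_def)
    also have "\<dots> = B\<^sup>2 * (\<Sum>kl\<in>?S. (cmod (?a kl))\<^sup>2)"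
      by (simp add: norm_trig_poly)
    also have "(\<Sum>kl\<in>?S. (cmod (?a kl))\<^sup>2) = (\<Sum>l\<in>{-L..L + 1}. (\<sigma> (l - 1) - \<sigma> l)\<^sup>2)"
      unfolding sum.reindex[OF inj] by (intro sum.cong refl) (simp add: norm_mult flip: of_real_diff)
    finally show ?thesis .
  qed
  finally show ?thesis unfolding eq by (simp add: mult_left_mono)
qed

subsection \<open>Density of trigonometric polynomials\<close>

definition trig_poly :: "(real \<times> real \<Rightarrow> complex) \<Rightarrow> bool" where
  "trig_poly P \<longleftrightarrow> (\<exists>S a. finite S \<and> P = (\<lambda>p. \<Sum>kl\<in>S. a kl * fourier_char kl p))"

lemma trig_poly_char: "trig_poly (\<lambda>p. c * fourier_char kl p)"
  unfolding trig_poly_def by (intro exI[of _ "{kl}"] exI[of _ "\<lambda>_. c"]) auto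

lemma trig_poly_const: "trig_poly (\<lambda>p. c)"
  using trig_poly_char[of c "(0, 0)"] by (simp add: fourier_char_def)

lemma trig_poly_add:
  assumes "trig_poly P" "trig_poly Q"
  shows "trig_poly (\<lambda>p. P p + Q p)"
proof -
  obtain S a T b where S: "finite S" "P = (\<lambda>p. \<Sum>kl\<in>S. a kl * fourier_char kl p)"
    and T: "finite T" "Q = (\<lambda>p. \<Sum>kl\<in>T. b kl * fourier_char kl p)"
    using assms unfolding trig_poly_def by blast
  define a' where "a' = (\<lambda>kl. if kl \<in> S then a kl else 0)"
  define b' where "b' = (\<lambda>kl. if kl \<in> T then b kl else 0)"
  have "P = (\<lambda>p. \<Sum>kl\<in>S \<union> T. a' kl * fourier_char kl p)"
    unfolding S(2) a'_def using S(1) T(1) by (intro ext sum.mono_neutral_cong_left) auto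
  moreover have "Q = (\<lambda>p. \<Sum>kl\<in>S \<union> T. b' kl * fourier_char kl p)"
    unfolding T(2) b'_def using S(1) T(1) by (intro ext sum.mono_neutral_cong_left) auto
  ultimately show ?thesis unfolding trig_poly_def
    using S(1) T(1) by (intro exI[of _ "S \<union> T"] exI[of _ "\<lambda>kl. a' kl + b' kl"]) (simp add: sum.distrib distrib_right)
qed

lemma trig_poly_sum:
  assumes "finite I" "\<And>i. i \<in> I \<Longrightarrow> trig_poly (P i)"
  shows "trig_poly (\<lambda>p. \<Sum>i\<in>I. P i p)"
  using assms by (induction I rule: finite_induct) (auto intro: trig_poly_const trig_poly_add)

lemma trig_poly_mult:
  assumes "trig_poly P" "trig_poly Q"
  shows "trig_poly (\<lambda>p. P p * Q p)"
proof -
  obtain S a T b where S: "finite S" "P = (\<lambda>p. \<Sum>kl\<in>S. a kl * fourier_char kl p)"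
    and T: "finite T" "Q = (\<lambda>p. \<Sum>kl\<in>T. b kl * fourier_char kl p)"
    using assms unfolding trig_poly_def by blast
  have "(\<lambda>p. P p * Q p) = (\<lambda>p. \<Sum>kl\<in>S. \<Sum>kl'\<in>T. (a kl * b kl') * fourier_char (fst kl + fst kl', snd kl + snd kl') p)"
    by (simp add: S(2) T(2) sum_product fourier_char_mult[symmetric] mult_ac)
  then show ?thesis using S(1) T(1) by (simp add: trig_poly_sum trig_poly_char)
qed

lemma continuous_trig_poly: "trig_poly P \<Longrightarrow> continuous_on UNIV P"
  unfolding trig_poly_def by (auto intro!: continuous_intros continuous_fourier_char)

text \<open>Maps the torus onto a compact subset of C^2, where real polynomials in the coordinates
  become trigonometric polynomials and the Stone-Weierstrass theorem applies.\<close>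

definition torus_embedding :: "real \<times> real \<Rightarrow> complex \<times> complex" where
  "torus_embedding p = (cis (2 * pi * fst p), cis (2 * pi * snd p))"

lemma trig_poly_real_polynomial:
  assumes "real_polynomial_function g"
  shows "trig_poly (\<lambda>p. complex_of_real (g (torus_embedding p)))"
  using assms
proof induction
  case (linear f)
  have R: "complex_of_real (Re z) = 1 / 2 * z + 1 / 2 * cnj z" "complex_of_real (Im z) = - (\<i> / 2) * z + \<i> / 2 * cnj z" for z
    by (simp_all add: complex_eq_iff)
  have lin: "f z = Re (fst z) * f (1, 0) + Im (fst z) * f (\<i>, 0) + Re (snd z) * f (0, 1) + Im (snd z) * f (0, \<i>)" for z
  proof -
    interpret bounded_linear f by (rule linear)
    have "z = Re (fst z) *\<^sub>R (1, 0) + Im (fst z) *\<^sub>R (\<i>, 0) + Re (snd z) *\<^sub>R (0, 1) + Im (snd z) *\<^sub>R (0, \<i>)"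
      by (simp add: prod_eq_iff complex_eq_iff)
    then have "f z = f (Re (fst z) *\<^sub>R (1, 0) + Im (fst z) *\<^sub>R (\<i>, 0) + Re (snd z) *\<^sub>R (0, 1) + Im (snd z) *\<^sub>R (0, \<i>))" by simp
    then show ?thesis by (simp only: add scaleR real_scaleR_def)
  qed
  have c: "cis (2 * pi * fst p) = fourier_char (1, 0) p" "cnj (fourier_char (1, 0) p) = fourier_char (- 1, 0) p"
    "cis (2 * pi * snd p) = fourier_char (0, 1) p" "cnj (fourier_char (0, 1) p) = fourier_char (0, - 1) p" for p
    by (simp_all add: fourier_char_def cis_cnj)
  have mult: "trig_poly (\<lambda>p. P p * c)" if "trig_poly P" for P c
    by (intro trig_poly_mult trig_poly_const that)
  have "trig_poly (\<lambda>p. of_real (Re (fst (torus_embedding p))) * of_real (f (1, 0)) + of_real (Im (fst (torus_embedding p))) * of_real (f (\<i>, 0))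
      + of_real (Re (snd (torus_embedding p))) * of_real (f (0, 1)) + of_real (Im (snd (torus_embedding p))) * of_real (f (0, \<i>)))"
    unfolding R torus_embedding_def fst_conv snd_conv c
    by (intro trig_poly_add mult trig_poly_char)
  then show ?case unfolding lin[of "torus_embedding _"] of_real_add of_real_mult .
qed (auto intro: trig_poly_const trig_poly_add trig_poly_mult)

text \<open>The L2 closure of the trigonometric polynomials. It is enlarged from continuous periodic
  functions to boxes, measurable sets and finally all of L2.\<close>

definition trig_approximable :: "(real \<times> real \<Rightarrow> complex) \<Rightarrow> bool" where
  "trig_approximable f \<longleftrightarrow> square_integrable torus f \<and>
    (\<forall>e>0. \<exists>P. trig_poly P \<and> (LINT p|torus. (cmod (f p - P p))\<^sup>2) < e)"

text \<open>From (u + v)^2 at most 2 u^2 + 2 v^2; the factor 2 accounts for the e / 4 in the density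
  arguments.\<close>

lemma L2_dist_triangle:
  fixes f g h :: "real \<times> real \<Rightarrow> complex"
  assumes "square_integrable torus f" "square_integrable torus g" "square_integrable torus h"
  shows "(LINT p|torus. (cmod (f p - h p))\<^sup>2) \<le> 2 * (LINT p|torus. (cmod (f p - g p))\<^sup>2) + 2 * (LINT p|torus. (cmod (g p - h p))\<^sup>2)"
proof -
  have i: "integrable torus (\<lambda>p. (cmod (f p - h p))\<^sup>2)" "integrable torus (\<lambda>p. (cmod (f p - g p))\<^sup>2)"
    "integrable torus (\<lambda>p. (cmod (g p - h p))\<^sup>2)"
    using square_integrable_diff[OF assms(1,3)] square_integrable_diff[OF assms(1,2)] square_integrable_diff[OF assms(2,3)]
    by (auto simp: square_integrable_def)
  have "(LINT p|torus. (cmod (f p - h p))\<^sup>2) \<le> (LINT p|torus. 2 * (cmod (f p - g p))\<^sup>2 + 2 * (cmod (g p - h p))\<^sup>2)"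
  proof (intro integral_mono)
    fix p
    have "cmod (f p - h p) \<le> cmod (f p - g p) + cmod (g p - h p)"
      using norm_triangle_ineq[of "f p - g p" "g p - h p"] by simp
    then have "(cmod (f p - h p))\<^sup>2 \<le> (cmod (f p - g p) + cmod (g p - h p))\<^sup>2" by (intro power_mono) auto
    then show "(cmod (f p - h p))\<^sup>2 \<le> 2 * (cmod (f p - g p))\<^sup>2 + 2 * (cmod (g p - h p))\<^sup>2"
      using sum_squares_bound[of "cmod (f p - g p)" "cmod (g p - h p)"] by (simp add: power2_sum)
  qed (use i in auto)
  then show ?thesis using i by simp
qed

lemma square_integrable_trig_poly: "trig_poly P \<Longrightarrow> square_integrable torus P"
  by (intro square_integrable_torus_continuous continuous_trig_poly)

lemma trig_approximable_limit:
  assumes f: "square_integrable torus f"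
    and lim: "\<And>e. e > 0 \<Longrightarrow> \<exists>g. trig_approximable g \<and> (LINT p|torus. (cmod (f p - g p))\<^sup>2) < e"
  shows "trig_approximable f"
  unfolding trig_approximable_def
proof (intro conjI f allI impI)
  fix e :: real assume e: "e > 0"
  obtain g where g: "trig_approximable g" "(LINT p|torus. (cmod (f p - g p))\<^sup>2) < e / 4"
    using lim[of "e / 4"] e by auto
  then obtain P where P: "trig_poly P" "(LINT p|torus. (cmod (g p - P p))\<^sup>2) < e / 4"
    unfolding trig_approximable_def using e by (metis zero_less_divide_iff zero_less_numeral)
  have "(LINT p|torus. (cmod (f p - P p))\<^sup>2) < e"
    using L2_dist_triangle[OF f _ square_integrable_trig_poly[OF P(1)], of g] g P
    unfolding trig_approximable_def by linarith
  then show "\<exists>P. trig_poly P \<and> (LINT p|torus. (cmod (f p - P p))\<^sup>2) < e" using P by blast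
qed

lemma trig_approximable_trig_poly: "trig_poly P \<Longrightarrow> trig_approximable P"
  unfolding trig_approximable_def using square_integrable_trig_poly by (auto intro!: exI[of _ P])

lemma trig_approximable_add:
  assumes "trig_approximable f" "trig_approximable g"
  shows "trig_approximable (\<lambda>p. f p + g p)"
  unfolding trig_approximable_def
proof (intro conjI allI impI)
  have sf: "square_integrable torus f" and sg: "square_integrable torus g" using assms by (auto simp: trig_approximable_def)
  show sfg: "square_integrable torus (\<lambda>p. f p + g p)" using sf sg by (rule square_integrable_add)
  fix e :: real assume "e > 0"
  then have e: "e / 4 > 0" by simp
  obtain P Q where P: "trig_poly P" "(LINT p|torus. (cmod (f p - P p))\<^sup>2) < e / 4"
    and Q: "trig_poly Q" "(LINT p|torus. (cmod (g p - Q p))\<^sup>2) < e / 4"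
    using assms e unfolding trig_approximable_def by meson
  have "(LINT p|torus. (cmod ((f p + g p) - (P p + Q p)))\<^sup>2) \<le>
      2 * (LINT p|torus. (cmod ((f p + g p) - (P p + g p)))\<^sup>2) + 2 * (LINT p|torus. (cmod ((P p + g p) - (P p + Q p)))\<^sup>2)"
    by (intro L2_dist_triangle sfg square_integrable_add square_integrable_trig_poly P Q sg)
  then have "(LINT p|torus. (cmod ((f p + g p) - (P p + Q p)))\<^sup>2) < e" using P(2) Q(2) by simp
  then show "\<exists>P. trig_poly P \<and> (LINT p|torus. (cmod ((f p + g p) - P p))\<^sup>2) < e"
    using trig_poly_add[OF P(1) Q(1)] by blast
qed

lemma trig_approximable_cmult:
  assumes "trig_approximable f"
  shows "trig_approximable (\<lambda>p. c * f p)"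
  unfolding trig_approximable_def
proof (intro conjI allI impI)
  have sf: "square_integrable torus f" using assms by (auto simp: trig_approximable_def)
  then show "square_integrable torus (\<lambda>p. c * f p)"
    by (auto simp: square_integrable_def norm_mult power_mult_distrib)
  fix e :: real assume e: "e > 0"
  then have "e / (1 + (cmod c)\<^sup>2) > 0" by (auto intro!: divide_pos_pos add_pos_nonneg)
  then obtain P where P: "trig_poly P" "(LINT p|torus. (cmod (f p - P p))\<^sup>2) < e / (1 + (cmod c)\<^sup>2)"
    using assms unfolding trig_approximable_def by meson
  have "(LINT p|torus. (cmod (c * f p - c * P p))\<^sup>2) = (cmod c)\<^sup>2 * (LINT p|torus. (cmod (f p - P p))\<^sup>2)"
    by (simp add: right_diff_distrib[symmetric] norm_mult power_mult_distrib)
  also have "\<dots> \<le> (1 + (cmod c)\<^sup>2) * (LINT p|torus. (cmod (f p - P p))\<^sup>2)" by (intro mult_right_mono) auto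
  also have "\<dots> < (1 + (cmod c)\<^sup>2) * (e / (1 + (cmod c)\<^sup>2))"
    by (rule mult_strict_left_mono[OF P(2)]) (auto intro!: add_pos_nonneg)
  also have "\<dots> = e"
  proof -
    have "1 + (cmod c)\<^sup>2 > 0" by (auto intro!: add_pos_nonneg)
    then show ?thesis by simp
  qed
  finally show "\<exists>P. trig_poly P \<and> (LINT p|torus. (cmod (c * f p - P p))\<^sup>2) < e"
    using trig_poly_mult[OF trig_poly_const P(1), of c] by blast
qed

text \<open>The step from each class of functions to the next: squared differences are dominated by
  4 |g|^2, so pointwise convergence becomes L2 convergence.\<close>

lemma trig_approximable_dominated_limit:
  assumes s: "\<And>i. trig_approximable (s i)" and f: "f \<in> borel_measurable torus"
    and conv: "\<And>p. p \<in> space torus \<Longrightarrow> (\<lambda>i. s i p) \<longlonglongrightarrow> f p"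
    and g: "square_integrable torus g" and dom: "\<And>i p. p \<in> space torus \<Longrightarrow> cmod (s i p) \<le> norm (g p)"
  shows "trig_approximable f"
proof (rule trig_approximable_limit)
  have fg: "cmod (f p) \<le> norm (g p)" if "p \<in> space torus" for p
    by (rule LIMSEQ_le_const2[OF tendsto_norm[OF conv[OF that]]]) (use dom[OF that] in auto)
  have ig: "integrable torus (\<lambda>p. (norm (g p))\<^sup>2)" using g by (simp add: square_integrable_def)
  show sf: "square_integrable torus f"
    unfolding square_integrable_def
    by (intro conjI f Bochner_Integration.integrable_bound[OF ig] AE_I2) (use f fg in \<open>auto intro!: power_mono\<close>)
  have ms: "s i \<in> borel_measurable torus" for i using s[of i] by (auto simp: trig_approximable_def square_integrable_def)
  have "(\<lambda>i. LINT p|torus. (cmod (f p - s i p))\<^sup>2) \<longlonglongrightarrow> (LINT p|torus. 0)"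
  proof (rule integral_dominated_convergence[where w = "\<lambda>p. 4 * (norm (g p))\<^sup>2"])
    show "AE p in torus. (\<lambda>i. (cmod (f p - s i p))\<^sup>2) \<longlonglongrightarrow> 0"
    proof (rule AE_I2)
      fix p assume p: "p \<in> space torus"
      have "(\<lambda>i. (cmod (f p - s i p))\<^sup>2) \<longlonglongrightarrow> (cmod (f p - f p))\<^sup>2"
        by (intro tendsto_intros conv p)
      then show "(\<lambda>i. (cmod (f p - s i p))\<^sup>2) \<longlonglongrightarrow> 0" by simp
    qed
    show "AE p in torus. norm ((cmod (f p - s i p))\<^sup>2) \<le> 4 * (norm (g p))\<^sup>2" for i
    proof (rule AE_I2)
      fix p assume p: "p \<in> space torus"
      have "cmod (f p - s i p) \<le> 2 * norm (g p)"
        using norm_triangle_ineq4[of "f p" "s i p"] fg[OF p] dom[OF p, of i] by linarith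
      then have "(cmod (f p - s i p))\<^sup>2 \<le> (2 * norm (g p))\<^sup>2" by (intro power_mono) auto
      then show "norm ((cmod (f p - s i p))\<^sup>2) \<le> 4 * (norm (g p))\<^sup>2" by (simp add: power_mult_distrib)
    qed
  qed (use ig f ms in auto)
  then have lim: "(\<lambda>i. LINT p|torus. (cmod (f p - s i p))\<^sup>2) \<longlonglongrightarrow> 0" by simp
  fix e :: real assume "e > 0"
  then obtain i where "(LINT p|torus. (cmod (f p - s i p))\<^sup>2) < e"
    using order_tendstoD(2)[OF lim] eventually_happens'[OF sequentially_bot] by blast
  then show "\<exists>g. trig_approximable g \<and> (LINT p|torus. (cmod (f p - g p))\<^sup>2) < e" using s by blast
qed


lemma trig_approximable_cong:
  assumes "trig_approximable g" "f \<in> borel_measurable torus" "\<And>p. p \<in> space torus \<Longrightarrow> f p = g p"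
  shows "trig_approximable f"
proof (rule trig_approximable_dominated_limit[of "\<lambda>_. g" f g])
  show "(\<lambda>i. g p) \<longlonglongrightarrow> f p" if "p \<in> space torus" for p using assms(3)[OF that] by simp
qed (use assms in \<open>auto simp: trig_approximable_def\<close>)

lemma space_torus: "space torus = {0..<1} \<times> {0..<1}"
  by (simp add: torus_def space_pair_measure)

text \<open>Stone-Weierstrass on the compact image of the closed unit square gives polynomials with
  uniform errors below 1/(i+1), and the constant B + 1 dominates all of them.\<close>

lemma trig_approximable_continuous:
  fixes H :: "complex \<times> complex \<Rightarrow> real"
  assumes H: "continuous_on UNIV H"
  shows "trig_approximable (\<lambda>p. of_real (H (torus_embedding p)))"
proof -
  let ?S = "torus_embedding ` ({0..1} \<times> {0..1})"
  have ce: "continuous_on UNIV torus_embedding"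
    unfolding torus_embedding_def[abs_def] by (intro continuous_intros)
  have S: "compact ?S"
    by (intro compact_continuous_image compact_Times) (auto intro: continuous_on_subset[OF ce])
  have HS: "continuous_on ?S H" using H continuous_on_subset by blast
  then have "bounded (H ` ?S)" by (intro compact_imp_bounded compact_continuous_image S)
  then obtain B where B0: "\<forall>u\<in>H ` ?S. norm u \<le> B" unfolding bounded_iff by blast
  then have B: "norm (H z) \<le> B" if "z \<in> ?S" for z using that by blast
  have "\<forall>i. \<exists>g. real_polynomial_function g \<and> (\<forall>z\<in>?S. \<bar>H z - g z\<bar> < 1 / real (Suc i))"
  proof
    fix i
    obtain g where "real_polynomial_function g" "\<And>z. z \<in> ?S \<Longrightarrow> \<bar>H z - g z\<bar> < 1 / real (Suc i)"
      by (rule Stone_Weierstrass_real_polynomial_function[OF S HS, of "1 / real (Suc i)"]) (simp, blast)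
    then show "\<exists>g. real_polynomial_function g \<and> (\<forall>z\<in>?S. \<bar>H z - g z\<bar> < 1 / real (Suc i))" by blast
  qed
  from choice[OF this] obtain g where g0: "\<forall>i. real_polynomial_function (g i) \<and> (\<forall>z\<in>?S. \<bar>H z - g i z\<bar> < 1 / real (Suc i))" ..
  then have g: "real_polynomial_function (g i)" "z \<in> ?S \<Longrightarrow> \<bar>H z - g i z\<bar> < 1 / real (Suc i)" for i z by blast+
  have pS: "torus_embedding p \<in> ?S" if "p \<in> space torus" for p
    using that unfolding space_torus by (intro imageI) auto
  show ?thesis
  proof (rule trig_approximable_dominated_limit[where s = "\<lambda>i p. of_real (g i (torus_embedding p))" and g = "\<lambda>p. B + 1"])
    show "trig_approximable (\<lambda>p. complex_of_real (g i (torus_embedding p)))" for i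
      by (intro trig_approximable_trig_poly trig_poly_real_polynomial g)
    show "(\<lambda>p. complex_of_real (H (torus_embedding p))) \<in> borel_measurable torus"
      by (intro continuous_measurable_torus continuous_intros continuous_on_compose2[OF H ce]) auto
    show "square_integrable torus (\<lambda>p::real \<times> real. B + 1)"
      by (intro square_integrable_torus_continuous continuous_intros)
    fix p assume p: "p \<in> space torus"
    have "(\<lambda>i. g i (torus_embedding p)) \<longlonglongrightarrow> H (torus_embedding p)"
    proof (rule LIMSEQ_I)
      fix r :: real assume "r > 0"
      then obtain n where n: "1 / real (Suc n) < r" using nat_approx_posE by blast
      have "norm (g i (torus_embedding p) - H (torus_embedding p)) < r" if "i \<ge> n" for i
      proof -
        have "1 / real (Suc i) \<le> 1 / real (Suc n)" using that by (intro divide_left_mono) auto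
        then show ?thesis using g(2)[OF pS[OF p], of i] n by (simp add: abs_minus_commute)
      qed
      then show "\<exists>n. \<forall>i\<ge>n. norm (g i (torus_embedding p) - H (torus_embedding p)) < r" by blast
    qed
    then show "(\<lambda>i. complex_of_real (g i (torus_embedding p))) \<longlonglongrightarrow> complex_of_real (H (torus_embedding p))"
      by (rule tendsto_of_real)
    fix i
    have "1 / real (Suc i) \<le> 1 / 1" by (intro divide_left_mono) auto
    then have "\<bar>g i (torus_embedding p)\<bar> \<le> B + 1"
      using g(2)[OF pS[OF p], of i] B[OF pS[OF p]] unfolding real_norm_def by linarith
    then show "cmod (complex_of_real (g i (torus_embedding p))) \<le> norm (B + 1)" by simp
  qed
qed

text \<open>Represents [0,1) cut at a by a closed arc. Identifying 1 with 0 does no harm: the arc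
  includes the parameter 1 only for a at least 1, when x is at most a anyway. For negative a both
  sides are false.\<close>

lemma cis_mem_arc_iff:
  assumes x: "x \<in> {0..<1}"
  shows "cis (2 * pi * x) \<in> (\<lambda>x. cis (2 * pi * x)) ` {0..min 1 a} \<longleftrightarrow> x \<le> a"
proof
  assume "x \<le> a"
  then show "cis (2 * pi * x) \<in> (\<lambda>x. cis (2 * pi * x)) ` {0..min 1 a}" using x by (intro imageI) auto
next
  assume "cis (2 * pi * x) \<in> (\<lambda>x. cis (2 * pi * x)) ` {0..min 1 a}"
  then obtain u where u: "0 \<le> u" "u \<le> 1" "u \<le> a" "cis (2 * pi * x) = cis (2 * pi * u)" by auto
  then have "sin (2 * pi * x) = sin (2 * pi * u) \<and> cos (2 * pi * x) = cos (2 * pi * u)"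
    by (simp add: complex_eq_iff)
  then obtain n :: int where "2 * pi * x = 2 * pi * u + 2 * pi * n"
    unfolding sin_cos_eq_iff by auto
  then have "2 * pi * x = 2 * pi * (u + n)" by (simp only: distrib_left)
  then have n: "x = u + of_int n" by simp
  show "x \<le> a"
  proof (cases "n \<ge> 1")
    case True
    then have "real_of_int n \<ge> 1" by simp
    then show ?thesis using x u n by auto
  next
    case False
    then have "real_of_int n \<le> 0" by simp
    then show ?thesis using u n by linarith
  qed
qed

text \<open>The indicator of a nonempty closed set is the pointwise limit of cut-offs of i times the
  distance to it, which are continuous functions of the embedded point.\<close>

lemma trig_approximable_box:
  "trig_approximable (\<lambda>p. of_real (indicator (({0..<1} \<inter> {..a}) \<times> ({0..<1} \<inter> {..a'})) p))"
proof -
  let ?Q = "({0..<1} \<inter> {..a}) \<times> ({0..<1} \<inter> {..a'}) :: (real \<times> real) set"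
  let ?C = "\<lambda>a. (\<lambda>x. cis (2 * pi * x)) ` {0..min 1 a}"
  let ?A = "?C a \<times> ?C a'"
  have cC: "compact (?C a)" for a by (intro compact_continuous_image continuous_intros) auto
  have A: "closed ?A" by (intro compact_imp_closed compact_Times cC)
  have Q: "torus_embedding p \<in> ?A \<longleftrightarrow> p \<in> ?Q" if "p \<in> space torus" for p
    using that cis_mem_arc_iff[of "fst p" a] cis_mem_arc_iff[of "snd p" a']
    unfolding space_torus torus_embedding_def mem_Times_iff fst_conv snd_conv by auto
  have mQ: "(\<lambda>p. complex_of_real (indicator ?Q p)) \<in> borel_measurable torus"
  proof (rule measurable_torus_borel)
    have "?Q \<in> sets (borel \<Otimes>\<^sub>M borel)" by (intro pair_measureI) auto
    then have "?Q \<in> sets borel" unfolding borel_prod .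
    then show "(\<lambda>p. complex_of_real (indicator ?Q p)) \<in> borel_measurable borel" by measurable
  qed
  show ?thesis
  \<comment> \<open>\<open>infdist\<close> to the empty set is 0 by convention, so the cut-offs
    would be 1 instead of 0 for an empty box.\<close>
  proof (cases "?A = {}")
    case True
    have "p \<notin> ?Q" if "p \<in> space torus" for p using Q[OF that] unfolding True by blast
    then show ?thesis
      by (intro trig_approximable_cong[OF trig_approximable_trig_poly[OF trig_poly_const[of 0]] mQ]) auto
  next
    case False
    show ?thesis
    proof (rule trig_approximable_dominated_limit[OF _ mQ,
          where s = "\<lambda>i p. of_real (max 0 (1 - real i * infdist (torus_embedding p) ?A))" and g = "\<lambda>p. 1::real"])
      show "trig_approximable (\<lambda>p. complex_of_real (max 0 (1 - real i * infdist (torus_embedding p) ?A)))" for i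
        by (rule trig_approximable_continuous[of "\<lambda>z. max 0 (1 - real i * infdist z ?A)"]) (intro continuous_intros)
      show "square_integrable torus (\<lambda>p::real \<times> real. 1::real)"
        by (intro square_integrable_torus_continuous continuous_intros)
      fix p assume p: "p \<in> space torus"
      show "cmod (complex_of_real (max 0 (1 - real i * infdist (torus_embedding p) ?A))) \<le> norm (1::real)" for i
        using infdist_nonneg[of "torus_embedding p" ?A] by (simp add: norm_of_real)
      have "(\<lambda>i. max 0 (1 - real i * infdist (torus_embedding p) ?A)) \<longlonglongrightarrow> indicator ?Q p"
      proof (cases "p \<in> ?Q")
        case True
        then have "infdist (torus_embedding p) ?A = 0" using Q[OF p] by simp
        then show ?thesis using True by simp
      next
        case nQ: False
        define d where "d = infdist (torus_embedding p) ?A"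
        have "d > 0" unfolding d_def using infdist_pos_not_in_closed[OF A False] nQ Q[OF p] by blast
        then obtain n where n: "1 < real n * d" using reals_Archimedean3 by blast
        have "max 0 (1 - real i * d) = 0" if "i \<ge> n" for i
        proof -
          have "real n * d \<le> real i * d" using that \<open>d > 0\<close> by (intro mult_right_mono) auto
          then show ?thesis using n by linarith
        qed
        then have "eventually (\<lambda>i. max 0 (1 - real i * d) = 0) sequentially"
          unfolding eventually_sequentially by blast
        then show ?thesis using nQ unfolding d_def by (simp add: tendsto_eventually)
      qed
      then show "(\<lambda>i. complex_of_real (max 0 (1 - real i * infdist (torus_embedding p) ?A))) \<longlonglongrightarrow> complex_of_real (indicator ?Q p)"
        by (rule tendsto_of_real)
    qed
  qed
qed

lemma trig_approximable_sum:
  assumes "finite I" "\<And>i. i \<in> I \<Longrightarrow> trig_approximable (f i)"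
  shows "trig_approximable (\<lambda>p. \<Sum>i\<in>I. f i p)"
  using assms by (induction I rule: finite_induct)
    (auto intro: trig_approximable_add trig_approximable_trig_poly[OF trig_poly_const[of 0]])

text \<open>A generator of the sigma-algebra that is stable under intersection, so that Dynkin's
  argument carries approximability from boxes to all measurable sets.\<close>

definition corner_boxes :: "(real \<times> real) set set" where
  "corner_boxes = {A \<times> B | A B. A \<in> range (\<lambda>a. {0..<1} \<inter> {..a}) \<and> B \<in> range (\<lambda>a. {0..<1} \<inter> {..a})}"

lemma sets_torus: "sets torus = sigma_sets (space torus) corner_boxes"
proof -
  let ?E = "range (\<lambda>a. {0..<1} \<inter> {..a::real})"
  have "sets circle = (\<inter>) {0..<1} ` sigma_sets UNIV (range (\<lambda>a. {..a::real}))"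
    by (simp add: sets_restrict_space borel_eq_atMost)
  also have "\<dots> = sigma_sets {0..<1} ((\<inter>) {0..<1} ` range (\<lambda>a. {..a::real}))"
  proof (rule sigma_sets_Int)
    have "{0..<1::real} \<in> sets borel" by simp
    then show "{0..<1::real} \<in> sigma_sets UNIV (range (\<lambda>a. {..a}))" by (simp add: borel_eq_atMost)
  qed simp
  also have "(\<inter>) {0..<1} ` range (\<lambda>a. {..a::real}) = ?E" by auto
  finally have sc: "sets circle = sigma_sets (space circle) ?E" by simp
  have cov: "{0..<1} \<inter> {..1} \<in> ?E" by (rule rangeI)
  have "sets (circle \<Otimes>\<^sub>M circle) = sets (sigma (space circle \<times> space circle) {A \<times> B | A B. A \<in> ?E \<and> B \<in> ?E})"
    by (rule sets_pair_eq[OF _ sc, of "{{0..<1} \<inter> {..1}}" ?E, OF _ _ _ _ _ sc, of "{{0..<1} \<inter> {..1}}"])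
       (use cov in auto)
  also have "\<dots> = sigma_sets (space circle \<times> space circle) {A \<times> B | A B. A \<in> ?E \<and> B \<in> ?E}"
    by (rule sets_measure_of) auto
  finally show ?thesis by (simp only: torus_def space_pair_measure corner_boxes_def)
qed

lemma trig_approximable_indicator:
  assumes "A \<in> sets torus"
  shows "trig_approximable (\<lambda>p. of_real (indicator A p))"
proof -
  have 1: "Int_stable corner_boxes"
  proof (rule Int_stableI)
    fix P Q assume "P \<in> corner_boxes" "Q \<in> corner_boxes"
    then obtain a b c d where PQ: "P = ({0..<1} \<inter> {..a}) \<times> ({0..<1} \<inter> {..b})" "Q = ({0..<1} \<inter> {..c}) \<times> ({0..<1} \<inter> {..d})"
      unfolding corner_boxes_def by blast
    have "P \<inter> Q = ({0..<1} \<inter> {..min a c}) \<times> ({0..<1} \<inter> {..min b d})" unfolding PQ by auto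
    then show "P \<inter> Q \<in> corner_boxes" unfolding corner_boxes_def by blast
  qed
  have 2: "corner_boxes \<subseteq> Pow (space torus)" unfolding corner_boxes_def space_torus by auto
  have m: "(\<lambda>p. complex_of_real (indicator A p)) \<in> borel_measurable torus" if "A \<in> sets torus" for A
    using that by measurable
  have "A \<in> sigma_sets (space torus) corner_boxes" using assms sets_torus by simp
  from 1 2 this show ?thesis
  proof (induction rule: sigma_sets_induct_disjoint)
    case (basic A)
    then show ?case unfolding corner_boxes_def using trig_approximable_box by auto
  next
    case empty
    then show ?case using trig_approximable_trig_poly[OF trig_poly_const[of 0]] by simp
  next
    case (compl A)
    have t: "trig_approximable (\<lambda>p. 1 + (- 1) * complex_of_real (indicator A p))"
      by (intro trig_approximable_add trig_approximable_cmult trig_approximable_trig_poly trig_poly_const compl)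
    have "space torus - A \<in> sets torus" using compl(1) sets_torus by auto
    from t m[OF this] show ?case
      by (rule trig_approximable_cong) (auto simp: indicator_def)
  next
    case (union A)
    have At: "A i \<in> sets torus" for i using union(2) sets_torus by auto
    show ?case
    proof (rule trig_approximable_dominated_limit[where s = "\<lambda>n p. \<Sum>i<n. complex_of_real (indicator (A i) p)" and g = "\<lambda>p. 1::real"])
      show "trig_approximable (\<lambda>p. \<Sum>i<n. complex_of_real (indicator (A i) p))" for n
        using union(3) by (intro trig_approximable_sum) auto
      show "(\<lambda>p. complex_of_real (indicator (\<Union>i. A i) p)) \<in> borel_measurable torus"
        using At by (intro m) auto
      show "square_integrable torus (\<lambda>p::real \<times> real. 1::real)"
        by (intro square_integrable_torus_continuous continuous_intros)
      fix p
      have s: "(\<Sum>i<n. complex_of_real (indicator (A i) p)) = complex_of_real (indicator (\<Union>i<n. A i) p)" for n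
      proof -
        have "disjoint_family_on A {..<n}" using union(1) by (auto simp: disjoint_family_on_def)
        then have "(indicator (\<Union>i<n. A i) p :: real) = (\<Sum>i<n. indicator (A i) p)"
          by (intro indicator_UN_disjoint) auto
        then show ?thesis by simp
      qed
      show "(\<lambda>n. \<Sum>i<n. complex_of_real (indicator (A i) p)) \<longlonglongrightarrow> complex_of_real (indicator (\<Union>i. A i) p)"
        unfolding s by (intro tendsto_of_real LIMSEQ_indicator_UN)
      show "cmod (\<Sum>i<n. complex_of_real (indicator (A i) p)) \<le> norm (1::real)" for n
        unfolding s by (simp add: indicator_def)
    qed
  qed
qed

text \<open>Simple functions converge to f pointwise with modulus at most 2 |f|, and 2 |f| is square
  integrable, so dominated convergence applies once more.\<close>

lemma L2_trig_approximable:
  assumes f: "in_L2 f"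
  shows "trig_approximable (\<lambda>p. of_real (f p))"
proof -
  have fm: "f \<in> borel_measurable torus" using f by (simp add: in_L2_def)
  obtain s where s: "\<And>i. simple_function torus (s i)" "\<And>p. p \<in> space torus \<Longrightarrow> (\<lambda>i. s i p) \<longlonglongrightarrow> f p"
    "\<And>i p. p \<in> space torus \<Longrightarrow> \<bar>s i p\<bar> \<le> 2 * \<bar>f p\<bar>"
    using borel_measurable_implies_sequence_metric[OF fm, of 0] unfolding dist_real_def diff_0_right by blast
  show ?thesis
  proof (rule trig_approximable_dominated_limit[where s = "\<lambda>i p. of_real (s i p)" and g = "\<lambda>p. 2 * f p"])
    fix i
    have fin: "finite (s i ` space torus)" using s(1)[of i] by (rule simple_functionD)
    have "trig_approximable (\<lambda>p. \<Sum>y\<in>s i ` space torus. of_real y * of_real (indicator (s i -` {y} \<inter> space torus) p))"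
      using s(1)[of i] by (intro trig_approximable_sum fin trig_approximable_cmult trig_approximable_indicator)
        (auto simp: simple_function_def)
    then show "trig_approximable (\<lambda>p. complex_of_real (s i p))"
    proof (rule trig_approximable_cong)
      show "(\<lambda>p. complex_of_real (s i p)) \<in> borel_measurable torus"
        using borel_measurable_simple_function[OF s(1)] by measurable
      fix p assume p: "p \<in> space torus"
      have "complex_of_real (s i p) = complex_of_real (\<Sum>y\<in>s i ` space torus. indicator (s i -` {y} \<inter> space torus) p *\<^sub>R y)"
        by (subst simple_function_indicator_representation_banach[OF s(1) p]) simp
      then show "complex_of_real (s i p) = (\<Sum>y\<in>s i ` space torus. of_real y * of_real (indicator (s i -` {y} \<inter> space torus) p))"
        by (simp add: mult.commute)
    qed
  next
    show "square_integrable torus (\<lambda>p. 2 * f p)" using f by (auto simp: in_L2_def square_integrable_def power_mult_distrib)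
  qed (use s fm in \<open>auto intro!: tendsto_of_real simp: abs_mult\<close>)
qed

text \<open>Discards the nonnegative last sum in \<open>trig_poly_approximation_error\<close>. With
  this finite form of Parseval, infinite sums over modes never occur.\<close>

lemma Parseval_approximation:
  assumes f: "in_L2 f" and e: "e > 0"
  obtains S where "finite S" "(LINT p|torus. (f p)\<^sup>2) \<le> (\<Sum>kl\<in>S. (cmod (fcoeff f kl))\<^sup>2) + e"
proof -
  obtain P where "trig_poly P" and Pe: "(LINT p|torus. (cmod (of_real (f p) - P p))\<^sup>2) < e"
    using L2_trig_approximable[OF f] e unfolding trig_approximable_def by blast
  then obtain S a where S: "finite S" and P: "P = (\<lambda>p. \<Sum>kl\<in>S. a kl * fourier_char kl p)"
    unfolding trig_poly_def by blast
  have "(\<Sum>kl\<in>S. (cmod (a kl - fcoeff f kl))\<^sup>2) \<ge> 0" by (intro sum_nonneg) auto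
  then show ?thesis
    using that[OF S] Pe trig_poly_approximation_error[OF f S, of a] unfolding P by linarith
qed

subsection \<open>Fourier coefficients of weak solutions\<close>

definition phase :: "int \<times> int \<Rightarrow> real \<times> real \<Rightarrow> real" where
  "phase kl p = 2 * pi * (of_int (fst kl) * fst p + of_int (snd kl) * snd p)"

text \<open>Test functions are real, so a character is tested through its cosine and sine. The
  two-parameter family is closed under both partial derivatives, which makes \<open>C_k\<close> a
  plain induction.\<close>

definition real_wave :: "int \<times> int \<Rightarrow> real \<Rightarrow> real \<Rightarrow> real \<times> real \<Rightarrow> real" where
  "real_wave kl A B p = A * cos (phase kl p) + B * sin (phase kl p)"

lemma real_wave_has_derivative:
  "((\<lambda>s. real_wave kl A B (s, y)) has_real_derivative
      real_wave kl (2 * pi * fst kl * B) (- (2 * pi * fst kl * A)) (x, y)) (at x)"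
  "((\<lambda>s. real_wave kl A B (x, s)) has_real_derivative
      real_wave kl (2 * pi * snd kl * B) (- (2 * pi * snd kl * A)) (x, y)) (at y)"
  unfolding real_wave_def phase_def by (auto intro!: derivative_eq_intros simp: algebra_simps)

lemma partial_x_real_wave:
  "partial_x (real_wave kl A B) = real_wave kl (2 * pi * fst kl * B) (- (2 * pi * fst kl * A))"
  unfolding partial_x_def using DERIV_imp_deriv[OF real_wave_has_derivative(1)] by (auto simp: fun_eq_iff)

lemma partial_y_real_wave:
  "partial_y (real_wave kl A B) = real_wave kl (2 * pi * snd kl * B) (- (2 * pi * snd kl * A))"
  unfolding partial_y_def using DERIV_imp_deriv[OF real_wave_has_derivative(2)] by (auto simp: fun_eq_iff)

lemma continuous_real_wave: "continuous_on UNIV (real_wave kl A B)"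
  unfolding real_wave_def[abs_def] phase_def by (intro continuous_intros)

lemma test_function_real_wave: "test_function (real_wave kl A B)"
proof -
  have "C_k n (real_wave kl A B)" for n
  proof (induction n arbitrary: A B)
    case 0
    then show ?case by (simp add: continuous_real_wave)
  next
    case (Suc n)
    then show ?case
      using real_wave_has_derivative unfolding C_k.simps partial_x_real_wave partial_y_real_wave real_differentiable_def
      by (blast intro: continuous_real_wave)
  qed
  moreover have "real_wave kl A B (x + 1, y) = real_wave kl A B (x, y)" "real_wave kl A B (x, y + 1) = real_wave kl A B (x, y)" for x y
  proof -
    have "phase kl (x + 1, y) = phase kl (x, y) + 2 * pi * of_int (fst kl)"
      "phase kl (x, y + 1) = phase kl (x, y) + 2 * pi * of_int (snd kl)" by (simp_all add: phase_def algebra_simps)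
    then show "real_wave kl A B (x + 1, y) = real_wave kl A B (x, y)" "real_wave kl A B (x, y + 1) = real_wave kl A B (x, y)"
      by (simp_all add: real_wave_def sin_add cos_add)
  qed
  ultimately show ?thesis by (simp add: test_function_def)
qed

lemma laplacian_real_wave:
  "laplacian (real_wave kl A B) p = - (4 * pi\<^sup>2 * ((real_of_int (fst kl))\<^sup>2 + (real_of_int (snd kl))\<^sup>2)) * real_wave kl A B p"
  unfolding laplacian_def partial_x_real_wave partial_y_real_wave
  by (simp add: real_wave_def algebra_simps power2_eq_square)

lemma fcoeff_real_wave:
  assumes f: "in_L2 f"
  shows "fcoeff f kl = Complex (LINT p|torus. f p * real_wave kl 1 0 p) (- (LINT p|torus. f p * real_wave kl 0 1 p))"
proof -
  have i: "integrable torus (\<lambda>p. of_real (f p) * cnj (fourier_char kl p))"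
    by (intro integrable_L2_continuous[OF f] continuous_intros continuous_fourier_char)
  have "Re (fcoeff f kl) = (LINT p|torus. f p * real_wave kl 1 0 p)"
    unfolding fcoeff_def integral_Re[OF i, symmetric]
    by (simp add: fourier_char_def real_wave_def phase_def)
  moreover have "Im (fcoeff f kl) = - (LINT p|torus. f p * real_wave kl 0 1 p)"
    unfolding fcoeff_def integral_Im[OF i, symmetric]
    by (simp add: fourier_char_def real_wave_def phase_def)
  ultimately show ?thesis by (simp add: complex_eq_iff)
qed

text \<open>The weak equation tested with cosine and sine. Transport brings in the coefficients of b
  f, which couple all l; \<open>multiplier_commutator_bound\<close> is what later decouples
  them.\<close>

lemma fcoeff_has_derivative:
  assumes sol: "weak_solution b \<nu> f0 f" and contb: "continuous_on UNIV b" and t: "t > 0"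
  shows "((\<lambda>s. fcoeff (f s) (k, l)) has_vector_derivative
     - \<i> * (2 * pi * k) * fcoeff (\<lambda>p. f t p * b (snd p)) (k, l)
     - \<nu> * (4 * pi\<^sup>2 * ((real_of_int k)\<^sup>2 + (real_of_int l)\<^sup>2)) * fcoeff (f t) (k, l)) (at t)"
proof -
  let ?w = "real_wave (k, l)"
  have L2: "in_L2 (f s)" if "s \<ge> 0" for s using sol that by (simp add: weak_solution_def)
  have cb: "continuous_on UNIV (\<lambda>p::real \<times> real. b (snd p))"
    using continuous_on_compose2[OF contb continuous_on_snd[OF continuous_on_id]] by simp
  have fb: "in_L2 (\<lambda>p. f t p * b (snd p))" using t by (intro in_L2_mult_continuous[OF L2 cb]) simp
  have ir: "integrable torus (\<lambda>p. g p * ?w A B p)" if "in_L2 g" for g A B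
    using that by (intro integrable_mult_L2 square_integrable_torus_continuous[OF continuous_real_wave]) (simp add: in_L2_iff)
  define I where "I = (\<lambda>A B. LINT p|torus. f t p * ?w A B p)"
  define J where "J = (\<lambda>A B. LINT p|torus. (f t p * b (snd p)) * ?w A B p)"
  have Jlin: "J (x * A) (x * B) = x * J A B" for x A B
  proof -
    have "?w (x * A) (x * B) p = x * ?w A B p" for p by (simp add: real_wave_def algebra_simps)
    then have "J (x * A) (x * B) = (LINT p|torus. x * ((f t p * b (snd p)) * ?w A B p))"
      unfolding J_def by (simp add: mult_ac)
    then show ?thesis by (simp add: J_def)
  qed
  have d: "((\<lambda>s. LINT p|torus. f s p * ?w A B p) has_real_derivative
      (J (2 * pi * k * B) (- (2 * pi * k * A)) + \<nu> * (- (4 * pi\<^sup>2 * ((real_of_int k)\<^sup>2 + (real_of_int l)\<^sup>2)) * I A B))) (at t)" for A B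
  proof -
    have "((\<lambda>s. LINT p|torus. f s p * ?w A B p) has_real_derivative
        (LINT p|torus. f t p * (b (snd p) * partial_x (?w A B) p + \<nu> * laplacian (?w A B) p))) (at t)"
      using sol test_function_real_wave t unfolding weak_solution_def by blast
    moreover have "(LINT p|torus. f t p * (b (snd p) * partial_x (?w A B) p + \<nu> * laplacian (?w A B) p)) =
        (LINT p|torus. (f t p * b (snd p)) * ?w (2 * pi * k * B) (- (2 * pi * k * A)) p
          + (\<nu> * (- (4 * pi\<^sup>2 * ((real_of_int k)\<^sup>2 + (real_of_int l)\<^sup>2)))) * (f t p * ?w A B p))"
      unfolding partial_x_real_wave laplacian_real_wave by (simp add: algebra_simps)
    moreover have "\<dots> = J (2 * pi * k * B) (- (2 * pi * k * A)) + \<nu> * (- (4 * pi\<^sup>2 * ((real_of_int k)\<^sup>2 + (real_of_int l)\<^sup>2)) * I A B)"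
      unfolding I_def J_def using ir[OF fb] ir[OF L2, of t] t
      by (subst Bochner_Integration.integral_add) auto
    ultimately show ?thesis by simp
  qed
  let ?D = "\<lambda>A B. J (2 * pi * k * B) (- (2 * pi * k * A)) + \<nu> * (- (4 * pi\<^sup>2 * ((real_of_int k)\<^sup>2 + (real_of_int l)\<^sup>2)) * I A B)"
  have "((\<lambda>s. Complex (LINT p|torus. f s p * ?w 1 0 p) (- (LINT p|torus. f s p * ?w 0 1 p)))
      has_vector_derivative Complex (?D 1 0) (- ?D 0 1)) (at t)"
    unfolding has_vector_derivative_complex_iff using d[of 1 0] d[of 0 1]
    by (auto simp: has_real_derivative_iff_has_vector_derivative intro!: derivative_eq_intros)
  moreover have "Complex (?D 1 0) (- ?D 0 1) = - \<i> * (2 * pi * k) * fcoeff (\<lambda>p. f t p * b (snd p)) (k, l)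
     - \<nu> * (4 * pi\<^sup>2 * ((real_of_int k)\<^sup>2 + (real_of_int l)\<^sup>2)) * fcoeff (f t) (k, l)"
  proof -
    have "J (2 * pi * k * 0) (- (2 * pi * k * 1)) = - (2 * pi * k) * J 0 1"
      "J (2 * pi * k * 1) (- (2 * pi * k * 0)) = 2 * pi * k * J 1 0"
      using Jlin[of "- (2 * pi * k)" 0 1] Jlin[of "2 * pi * k" 1 0] by simp_all
    moreover have "fcoeff (\<lambda>p. f t p * b (snd p)) (k, l) = Complex (J 1 0) (- J 0 1)"
      unfolding J_def by (rule fcoeff_real_wave[OF fb])
    moreover have "fcoeff (f t) (k, l) = Complex (I 1 0) (- I 0 1)"
      unfolding I_def using t by (intro fcoeff_real_wave L2) simp
    ultimately show ?thesis by (simp add: complex_eq_iff algebra_simps)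
  qed
  ultimately have "((\<lambda>s. Complex (LINT p|torus. f s p * ?w 1 0 p) (- (LINT p|torus. f s p * ?w 0 1 p)))
      has_vector_derivative - \<i> * (2 * pi * k) * fcoeff (\<lambda>p. f t p * b (snd p)) (k, l)
     - \<nu> * (4 * pi\<^sup>2 * ((real_of_int k)\<^sup>2 + (real_of_int l)\<^sup>2)) * fcoeff (f t) (k, l)) (at t)" by (simp only:)
  \<comment> \<open>The formula for \<open>fcoeff\<close> in terms of waves needs f s in L2, known
    for nonnegative s; the positive times are an open set containing t.\<close>
  then show ?thesis
    by (rule has_vector_derivative_transform_within_open[where S = "{0<..}"]) (use t fcoeff_real_wave[OF L2] in auto)
qed

section \<open>Regularity in time and Gronwall's inequality\<close>

lemma L2_norm_triangle:
  assumes f: "in_L2 f" and g: "in_L2 g"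
  shows "L2_norm (\<lambda>p. f p + g p) \<le> L2_norm f + L2_norm g"
proof (rule power2_le_imp_le)
  have sf: "square_integrable torus f" "square_integrable torus g" using f g by (auto simp: in_L2_iff)
  have i: "integrable torus (\<lambda>p. (f p)\<^sup>2)" "integrable torus (\<lambda>p. (g p)\<^sup>2)" "integrable torus (\<lambda>p. f p * g p)"
    using f g integrable_mult_L2[OF sf] by (auto simp: in_L2_def)
  have "\<bar>LINT p|torus. f p * g p\<bar>\<^sup>2 \<le> (L2_norm f * L2_norm g)\<^sup>2"
    using Cauchy_Schwarz_L2[OF sf] by (simp add: power_mult_distrib L2_norm_power2)
  then have "\<bar>LINT p|torus. f p * g p\<bar> \<le> L2_norm f * L2_norm g"
    by (rule power2_le_imp_le) (simp add: L2_norm_nonneg)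
  then have "(LINT p|torus. f p * g p) \<le> L2_norm f * L2_norm g" by linarith
  moreover have "(L2_norm (\<lambda>p. f p + g p))\<^sup>2 = (L2_norm f)\<^sup>2 + 2 * (LINT p|torus. f p * g p) + (L2_norm g)\<^sup>2"
  proof -
    have "(LINT p|torus. (f p + g p)\<^sup>2) = (LINT p|torus. (f p)\<^sup>2 + 2 * (f p * g p) + (g p)\<^sup>2)"
      by (simp add: power2_sum algebra_simps)
    then show ?thesis using i by (simp add: L2_norm_power2)
  qed
  ultimately show "(L2_norm (\<lambda>p. f p + g p))\<^sup>2 \<le> (L2_norm f + L2_norm g)\<^sup>2" by (simp add: power2_sum)
qed (simp add: L2_norm_nonneg)

text \<open>A crude bound depending on T, from continuity of the norm on a compact time interval. It
  enters only the commutator error, which vanishes in the limit for fixed T.\<close>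

lemma weak_solution_norm_bounded:
  assumes sol: "weak_solution b \<nu> f0 f"
  obtains M where "M \<ge> 0" "\<And>t. t \<in> {0..T} \<Longrightarrow> (LINT p|torus. (f t p)\<^sup>2) \<le> M"
proof -
  have L2: "in_L2 (f s)" if "s \<ge> 0" for s using sol that by (simp add: weak_solution_def)
  have tri: "\<bar>L2_norm (f s) - L2_norm (f t)\<bar> \<le> L2_norm (\<lambda>p. f s p - f t p)" if "s \<ge> 0" "t \<ge> 0" for s t
  proof -
    have "L2_norm (\<lambda>p. f t p + (f s p - f t p)) \<le> L2_norm (f t) + L2_norm (\<lambda>p. f s p - f t p)"
      "L2_norm (\<lambda>p. f s p + (f t p - f s p)) \<le> L2_norm (f s) + L2_norm (\<lambda>p. f t p - f s p)"
      using that by (intro L2_norm_triangle in_L2_diff L2; simp)+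
    moreover have "L2_norm (\<lambda>p. f t p - f s p) = L2_norm (\<lambda>p. f s p - f t p)"
      by (simp add: L2_norm_def power2_commute)
    ultimately show ?thesis by simp
  qed
  have "continuous_on {0..T} (\<lambda>t. L2_norm (f t))"
    unfolding continuous_on_def
  proof
    fix t assume t: "t \<in> {0..T}"
    have "((\<lambda>s. L2_norm (\<lambda>p. f s p - f t p)) \<longlongrightarrow> 0) (at t within {0..T})"
      by (rule tendsto_within_subset[of _ _ _ "{0..}"]) (use sol t in \<open>auto simp: weak_solution_def\<close>)
    then have "((\<lambda>s. L2_norm (f s) - L2_norm (f t)) \<longlongrightarrow> 0) (at t within {0..T})"
      by (rule Lim_null_comparison[rotated]) (use t tri in \<open>auto simp: eventually_at_filter\<close>)
    then show "((\<lambda>s. L2_norm (f s)) \<longlongrightarrow> L2_norm (f t)) (at t within {0..T})"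
      by (rule LIM_zero_cancel)
  qed
  then have "bounded ((\<lambda>t. L2_norm (f t)) ` {0..T})"
    by (intro compact_imp_bounded compact_continuous_image) auto
  then obtain K where K: "\<forall>u\<in>(\<lambda>t. L2_norm (f t)) ` {0..T}. norm u \<le> K" unfolding bounded_iff by blast
  have "(LINT p|torus. (f t p)\<^sup>2) \<le> K\<^sup>2" if "t \<in> {0..T}" for t
  proof -
    have "L2_norm (f t) \<le> K" using K that by force
    then have "(L2_norm (f t))\<^sup>2 \<le> K\<^sup>2" by (intro power_mono L2_norm_nonneg)
    then show ?thesis by (simp add: L2_norm_power2)
  qed
  then show ?thesis using that[of "K\<^sup>2"] by simp
qed

text \<open>The point t = 0 is included, where the weak equation gives no derivative, so that
  \<open>Gronwall\<close> can start from the initial datum.\<close>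

lemma fcoeff_continuous:
  assumes sol: "weak_solution b \<nu> f0 f"
  shows "continuous_on {0..T} (\<lambda>t. fcoeff (f t) kl)"
  unfolding continuous_on_def
proof
  have L2: "in_L2 (f s)" if "s \<ge> 0" for s using sol that by (simp add: weak_solution_def)
  fix t assume t: "t \<in> {0..T}"
  have lim: "((\<lambda>s. L2_norm (\<lambda>p. f s p - f t p)) \<longlongrightarrow> 0) (at t within {0..T})"
    by (rule tendsto_within_subset[of _ _ _ "{0..}"]) (use sol t in \<open>auto simp: weak_solution_def\<close>)
  have le: "cmod (fcoeff (f s) kl - fcoeff (f t) kl) \<le> L2_norm (\<lambda>p. f s p - f t p)" if "s \<in> {0..T}" for s
    using that t norm_fcoeff_le[OF in_L2_diff[OF L2 L2], of s t kl] fcoeff_diff[OF L2 L2, of s t kl] by simp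
  have "((\<lambda>s. fcoeff (f s) kl - fcoeff (f t) kl) \<longlongrightarrow> 0) (at t within {0..T})"
    by (rule Lim_null_comparison[OF _ lim]) (use le in \<open>auto simp: eventually_at_filter\<close>)
  then show "((\<lambda>s. fcoeff (f s) kl) \<longlongrightarrow> fcoeff (f t) kl) (at t within {0..T})"
    by (rule LIM_zero_cancel)
qed

text \<open>With the integrating factor exp(\<gamma> t), and the accumulated error majorised by E
  exp(\<gamma> T) t, the difference \<open>\<Psi>\<close> is nonincreasing. A derivative is asked
  for only inside the interval, as the weak equation holds for positive times.\<close>

lemma Gronwall:
  fixes \<Phi> :: "real \<Rightarrow> real"
  assumes T: "0 \<le> T" and cont: "continuous_on {0..T} \<Phi>" and \<gamma>: "0 \<le> \<gamma>" and E: "0 \<le> E"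
    and der: "\<And>t. 0 < t \<Longrightarrow> t < T \<Longrightarrow> \<exists>d. (\<Phi> has_real_derivative d) (at t) \<and> d \<le> - \<gamma> * \<Phi> t + E"
  shows "\<Phi> T \<le> exp (- \<gamma> * T) * \<Phi> 0 + E * T"
proof -
  define \<Psi> where "\<Psi> = (\<lambda>t. exp (\<gamma> * t) * \<Phi> t - E * exp (\<gamma> * T) * t)"
  have "\<Psi> T \<le> \<Psi> 0"
  proof (rule DERIV_nonpos_imp_decreasing_open[OF T])
    show "continuous_on {0..T} \<Psi>" unfolding \<Psi>_def by (intro continuous_intros cont)
    fix t assume t: "0 < t" "t < T"
    obtain d where d: "(\<Phi> has_real_derivative d) (at t)" "d \<le> - \<gamma> * \<Phi> t + E" using der[OF t] by blast
    have "(\<Psi> has_real_derivative (exp (\<gamma> * t) * (\<gamma> * \<Phi> t + d) - E * exp (\<gamma> * T))) (at t)"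
      unfolding \<Psi>_def by (auto intro!: derivative_eq_intros d(1) simp: algebra_simps)
    moreover have "exp (\<gamma> * t) * (\<gamma> * \<Phi> t + d) \<le> exp (\<gamma> * T) * E"
    proof -
      have "exp (\<gamma> * t) * (\<gamma> * \<Phi> t + d) \<le> exp (\<gamma> * t) * E" using d(2) by (intro mult_left_mono) auto
      also have "\<dots> \<le> exp (\<gamma> * T) * E" using t \<gamma> E by (intro mult_right_mono) (auto intro: mult_left_mono)
      finally show ?thesis .
    qed
    ultimately show "\<exists>y. (\<Psi> has_real_derivative y) (at t) \<and> y \<le> 0"
      by (intro exI[of _ "exp (\<gamma> * t) * (\<gamma> * \<Phi> t + d) - E * exp (\<gamma> * T)"]) (simp add: mult.commute)
  qed
  then have "exp (\<gamma> * T) * \<Phi> T \<le> \<Phi> 0 + E * exp (\<gamma> * T) * T" by (simp add: \<Psi>_def)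
  have e: "exp (- \<gamma> * T) * exp (\<gamma> * T) = 1" by (simp flip: exp_add)
  from \<open>exp (\<gamma> * T) * \<Phi> T \<le> \<Phi> 0 + E * exp (\<gamma> * T) * T\<close>
  have "exp (- \<gamma> * T) * (exp (\<gamma> * T) * \<Phi> T) \<le> exp (- \<gamma> * T) * (\<Phi> 0 + E * exp (\<gamma> * T) * T)"
    by (intro mult_left_mono) auto
  also have "exp (- \<gamma> * T) * (\<Phi> 0 + E * exp (\<gamma> * T) * T) =
      exp (- \<gamma> * T) * \<Phi> 0 + (exp (- \<gamma> * T) * exp (\<gamma> * T)) * (E * T)" by (simp add: algebra_simps)
  also have "exp (- \<gamma> * T) * (exp (\<gamma> * T) * \<Phi> T) = (exp (- \<gamma> * T) * exp (\<gamma> * T)) * \<Phi> T"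
    by (simp only: mult.assoc)
  finally show ?thesis unfolding e by simp
qed

subsection \<open>Decay of a single mode\<close>

definition wave :: "int \<Rightarrow> real \<Rightarrow> complex" where
  "wave l y = cis (2 * pi * of_int l * y)"

lemma continuous_wave: "continuous_on A (wave l)"
  unfolding wave_def[abs_def] by (intro continuous_intros)

lemma continuous_wave_shift: "continuous_on A (\<lambda>y. wave l (y + h))"
  unfolding wave_def[abs_def] by (intro continuous_intros)

lemma wave_periodic: "wave l (y + 1) = wave l y"
proof -
  have "2 * pi * of_int l * (y + 1) = 2 * pi * of_int l * y + 2 * pi * of_int l" by (simp add: algebra_simps)
  then show ?thesis by (simp add: wave_def cis_mult[symmetric])
qed

lemma wave_has_vector_derivative: "(wave l has_vector_derivative (2 * pi * l * \<i>) * wave l y) (at y)"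
  unfolding has_vector_derivative_def wave_def[abs_def]
  by (auto intro!: derivative_eq_intros simp: scaleR_conv_of_real)

lemma integral_wave: "integral {0..1} (\<lambda>y. wave l y * cnj (wave m y)) = (if l = m then 1 else 0)"
proof -
  have e: "(\<lambda>y. wave l y * cnj (wave m y)) = wave (l - m)"
    by (auto simp: wave_def cis_cnj cis_mult algebra_simps)
  show ?thesis
  proof (cases "l = m")
    case True
    then show ?thesis unfolding e by (simp add: wave_def[abs_def])
  next
    case False
    define z where "z = 2 * pi * of_int (l - m) * \<i>"
    have z: "z \<noteq> 0" using False by (simp add: z_def)
    have "integral {0..1} (wave (l - m)) = 0"
    proof (rule integral_periodic_derivative)
      show "wave (l - m) (y + 1) / z = wave (l - m) y / z" for y by (simp only: wave_periodic)
      show "((\<lambda>y. wave (l - m) y / z) has_vector_derivative wave (l - m) y) (at y)" for y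
        using has_vector_derivative_divide[OF wave_has_vector_derivative[of "l - m" y], of z] z
        by (simp add: z_def)
    qed
    then show ?thesis unfolding e using False by simp
  qed
qed

text \<open>Reduces the functionals to finite quadratic forms in the coefficients, so their time
  derivatives involve no differentiation under the integral. Separate families u and v allow for the
  shifted waves of the cross term.\<close>

lemma integral_trig_form:
  fixes W :: "real \<Rightarrow> complex"
  assumes I: "finite I" and W: "continuous_on UNIV W" and u: "\<And>l. continuous_on UNIV (u l)" and v: "\<And>l. continuous_on UNIV (v l)"
  shows "integral {0..1} (\<lambda>y. W y * ((\<Sum>l\<in>I. x l * u l y) * cnj (\<Sum>m\<in>I. z m * v m y))) =
    (\<Sum>l\<in>I. \<Sum>m\<in>I. (x l * cnj (z m)) * integral {0..1} (\<lambda>y. W y * (u l y * cnj (v m y))))"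
proof -
  have i: "(\<lambda>y. (x l * cnj (z m)) * (W y * (u l y * cnj (v m y)))) integrable_on {0..1}" for l m
    by (intro integrable_unit_interval continuous_intros W u v)
  have "(\<lambda>y. W y * ((\<Sum>l\<in>I. x l * u l y) * cnj (\<Sum>m\<in>I. z m * v m y))) =
      (\<lambda>y. \<Sum>l\<in>I. \<Sum>m\<in>I. (x l * cnj (z m)) * (W y * (u l y * cnj (v m y))))"
  proof
    fix y
    have "W y * ((\<Sum>l\<in>I. x l * u l y) * cnj (\<Sum>m\<in>I. z m * v m y)) =
        (\<Sum>l\<in>I. \<Sum>m\<in>I. W y * ((x l * u l y) * (cnj (z m) * cnj (v m y))))"
      by (simp only: cnj_sum complex_cnj_mult sum_product) (simp only: sum_distrib_left)
    also have "\<dots> = (\<Sum>l\<in>I. \<Sum>m\<in>I. (x l * cnj (z m)) * (W y * (u l y * cnj (v m y))))"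
      by (simp only: mult_ac)
    finally show "W y * ((\<Sum>l\<in>I. x l * u l y) * cnj (\<Sum>m\<in>I. z m * v m y)) =
        (\<Sum>l\<in>I. \<Sum>m\<in>I. (x l * cnj (z m)) * (W y * (u l y * cnj (v m y))))" .
  qed
  then show ?thesis
    using I i by (simp only: integral_sum integrable_sum integral_mult_right)
qed

lemma trig_form_has_derivative:
  fixes W :: "real \<Rightarrow> complex"
  assumes I: "finite I" and W: "continuous_on UNIV W" and u: "\<And>l. continuous_on UNIV (u l)" and v: "\<And>l. continuous_on UNIV (v l)"
    and a: "\<And>l. ((\<lambda>s. a s l) has_vector_derivative a' l) (at t)"
  shows "((\<lambda>s. integral {0..1} (\<lambda>y. W y * ((\<Sum>l\<in>I. a s l * u l y) * cnj (\<Sum>m\<in>I. a s m * v m y)))) has_vector_derivative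
    integral {0..1} (\<lambda>y. W y * ((\<Sum>l\<in>I. a' l * u l y) * cnj (\<Sum>m\<in>I. a t m * v m y)))
    + integral {0..1} (\<lambda>y. W y * ((\<Sum>l\<in>I. a t l * u l y) * cnj (\<Sum>m\<in>I. a' m * v m y)))) (at t)"
proof -
  let ?K = "\<lambda>l m. integral {0..1} (\<lambda>y. W y * (u l y * cnj (v m y)))"
  have "((\<lambda>s. \<Sum>l\<in>I. \<Sum>m\<in>I. (a s l * cnj (a s m)) * ?K l m) has_vector_derivative
      (\<Sum>l\<in>I. \<Sum>m\<in>I. (a t l * cnj (a' m) + a' l * cnj (a t m)) * ?K l m)) (at t)"
    by (intro has_vector_derivative_sum has_vector_derivative_mult_left has_vector_derivative_mult
        has_vector_derivative_cnj a)
  moreover have "(\<Sum>l\<in>I. \<Sum>m\<in>I. (a t l * cnj (a' m) + a' l * cnj (a t m)) * ?K l m) =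
      (\<Sum>l\<in>I. \<Sum>m\<in>I. (a' l * cnj (a t m)) * ?K l m) + (\<Sum>l\<in>I. \<Sum>m\<in>I. (a t l * cnj (a' m)) * ?K l m)"
    by (simp add: sum.distrib distrib_right)
  ultimately show ?thesis unfolding integral_trig_form[OF I W u v] by simp
qed

lemma trig_form_continuous:
  fixes W :: "real \<Rightarrow> complex"
  assumes I: "finite I" and W: "continuous_on UNIV W" and u: "\<And>l. continuous_on UNIV (u l)" and v: "\<And>l. continuous_on UNIV (v l)"
    and a: "\<And>l. continuous_on A (\<lambda>s. a s l)"
  shows "continuous_on A (\<lambda>s. integral {0..1} (\<lambda>y. W y * ((\<Sum>l\<in>I. a s l * u l y) * cnj (\<Sum>m\<in>I. a s m * v m y))))"
  unfolding integral_trig_form[OF I W u v] by (intro continuous_intros a)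

lemma integral_Re_Im_unit_interval:
  fixes f :: "real \<Rightarrow> complex"
  assumes "continuous_on UNIV f"
  shows "integral {0..1} (\<lambda>y. Re (f y)) = Re (integral {0..1} f)" "integral {0..1} (\<lambda>y. Im (f y)) = Im (integral {0..1} f)"
  using integral_linear[OF integrable_unit_interval[OF assms] bounded_linear_Re]
    integral_linear[OF integrable_unit_interval[OF assms] bounded_linear_Im] by (simp_all add: o_def)

text \<open>The triangular window of the Fejer kernel. A sharp cut-off has two unit jumps and its
  commutator bound would not tend to zero; here the squared differences sum to order 1/m.\<close>

definition fejer_weight :: "int \<Rightarrow> int \<Rightarrow> real" where
  "fejer_weight m l = max 0 (1 - \<bar>of_int l\<bar> / of_int m)"

lemma fejer_weight_bounds: "m \<ge> 1 \<Longrightarrow> 0 \<le> fejer_weight m l \<and> fejer_weight m l \<le> 1"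
  by (auto simp: fejer_weight_def)

lemma fejer_weight_ends: "m \<ge> 1 \<Longrightarrow> fejer_weight m (- m - 1) = 0 \<and> fejer_weight m (m + 1) = 0"
  by (auto simp: fejer_weight_def field_simps)

lemma fejer_weight_variation:
  assumes m: "m \<ge> 1"
  shows "(\<Sum>l\<in>{-m..m + 1}. (fejer_weight m (l - 1) - fejer_weight m l)\<^sup>2) \<le> 4 / of_int m"
proof -
  have m0: "real_of_int m > 0" "real_of_int m \<ge> 1" using m by simp_all
  have "(fejer_weight m (l - 1) - fejer_weight m l)\<^sup>2 \<le> (1 / of_int m)\<^sup>2" for l
  proof -
    have "\<bar>fejer_weight m (l - 1) - fejer_weight m l\<bar> \<le> \<bar>(1 - \<bar>of_int (l - 1)\<bar> / of_int m) - (1 - \<bar>of_int l\<bar> / of_int m)\<bar>"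
      unfolding fejer_weight_def by (auto simp: max_def abs_if)
    also have "\<dots> = \<bar>\<bar>of_int l\<bar> - \<bar>of_int (l - 1)\<bar>\<bar> / real_of_int m" using m0 by (simp add: diff_divide_distrib[symmetric] abs_divide)
    also have "\<dots> \<le> 1 / of_int m" using m0 by (intro divide_right_mono) auto
    finally have "\<bar>fejer_weight m (l - 1) - fejer_weight m l\<bar>\<^sup>2 \<le> (1 / of_int m)\<^sup>2" by (intro power_mono) auto
    then show ?thesis by simp
  qed
  then have "(\<Sum>l\<in>{-m..m + 1}. (fejer_weight m (l - 1) - fejer_weight m l)\<^sup>2) \<le> (\<Sum>l\<in>{-m..m + 1}. (1 / real_of_int m)\<^sup>2)"
    by (intro sum_mono)
  also have "\<dots> = (2 * of_int m + 2) * (1 / real_of_int m)\<^sup>2" using m by simp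
  also have "\<dots> \<le> (4 * of_int m) * (1 / real_of_int m)\<^sup>2" using m0 by (intro mult_right_mono) auto
  also have "\<dots> = 4 / of_int m" using m0 by (simp add: power2_eq_square)
  finally show ?thesis .
qed

lemma fejer_weight_tendsto: "(\<lambda>n. fejer_weight (int (Suc n)) l) \<longlonglongrightarrow> 1"
proof -
  have "(\<lambda>n. max 0 (1 - \<bar>of_int l\<bar> * inverse (real (Suc n)))) \<longlonglongrightarrow> max 0 (1 - \<bar>of_int l\<bar> * 0)"
    by (intro tendsto_intros LIMSEQ_inverse_real_of_nat)
  then show ?thesis by (simp add: fejer_weight_def divide_inverse)
qed


lemma norm_trig_sum_unit_interval:
  assumes "finite I"
  shows "integral {0..1} (\<lambda>y. (cmod (\<Sum>l\<in>I. a l * wave l y))\<^sup>2) = (\<Sum>l\<in>I. (cmod (a l))\<^sup>2)"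
proof -
  let ?G = "\<lambda>y. \<Sum>l\<in>I. a l * wave l y"
  have c: "continuous_on UNIV (\<lambda>y. 1 * (?G y * cnj (?G y)))" by (intro continuous_intros continuous_wave)
  have "(\<lambda>y. (cmod (?G y))\<^sup>2) = (\<lambda>y. Re (1 * (?G y * cnj (?G y))))"
    unfolding mult_1 complex_norm_square[symmetric] by simp
  then have "integral {0..1} (\<lambda>y. (cmod (?G y))\<^sup>2) = Re (integral {0..1} (\<lambda>y. 1 * (?G y * cnj (?G y))))"
    using integral_Re_Im_unit_interval(1)[OF c] by (simp only:)
  also have "integral {0..1} (\<lambda>y. 1 * (?G y * cnj (?G y))) =
      (\<Sum>l\<in>I. \<Sum>m\<in>I. (a l * cnj (a m)) * integral {0..1} (\<lambda>y. 1 * (wave l y * cnj (wave m y))))"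
    by (rule integral_trig_form[OF assms]) (intro continuous_intros continuous_wave)+
  also have "\<dots> = (\<Sum>l\<in>I. a l * cnj (a l))"
    unfolding mult_1 integral_wave using assms
    by (intro sum.cong refl) (simp add: if_distrib[of "(*) _"] cong: if_cong)
  also have "Re \<dots> = (\<Sum>l\<in>I. (cmod (a l))\<^sup>2)"
    unfolding Re_sum complex_norm_square[symmetric] by simp
  finally show ?thesis .
qed

text \<open>\<open>Gronwall\<close> applied to the corrected functional of the Fejer mean of mode k.
  The factor 3 is the ratio of its bounds 3/2 and 1/2 in terms of the mass; the last summand is the
  commutator accumulated over time, of order m^(-1/2).\<close>

lemma mode_decay:
  assumes sm: "smooth b" and per: "\<And>x. b (x + 1) = b x"
    and nz: "\<And>y. \<exists>k\<in>{1..N + 1}. (deriv ^^ k) b y \<noteq> 0"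
  obtains c where "c > 0"
    "\<And>\<nu> f0 f T M B k m. 0 < \<nu> \<Longrightarrow> \<nu> < 1 \<Longrightarrow> weak_solution b \<nu> f0 f \<Longrightarrow> 0 \<le> T \<Longrightarrow>
      (\<And>t. t \<in> {0..T} \<Longrightarrow> (LINT p|torus. (f t p)\<^sup>2) \<le> M) \<Longrightarrow>
      0 \<le> B \<Longrightarrow> (\<And>y y'. \<bar>b y - b y'\<bar> \<le> B * cmod (cis (2 * pi * (y - y')) - 1)) \<Longrightarrow>
      k \<noteq> 0 \<Longrightarrow> 1 \<le> m \<Longrightarrow>
      (\<Sum>l\<in>{-m..m}. (fejer_weight m l * cmod (fcoeff (f T) (k, l)))\<^sup>2) \<le>
      3 * exp (- c * \<nu> powr (real (N + 1) / real (N + 3)) * T) * (\<Sum>l\<in>{-m..m}. (cmod (fcoeff (f 0) (k, l)))\<^sup>2)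
        + 4 * (\<bar>2 * pi * of_int k\<bar> * sqrt (M * (B\<^sup>2 * (4 / of_int m)))) * (1 + M) * T"
proof -
  obtain \<theta> \<gamma> where \<theta>: "\<theta> > 0" and \<gamma>: "\<gamma> > 0"
    and hypo: "\<And>\<nu>. 0 < \<nu> \<Longrightarrow> \<nu> < 1 \<Longrightarrow> \<exists>h w. hypocoercive b \<nu> \<theta> (\<gamma> * \<nu> powr (real (N + 1) / real (N + 3))) h w"
    by (rule shear_hypocoercivity[OF sm per nz]) blast
  have contb: "continuous_on UNIV b"
    using smooth_has_derivative[OF sm, of 0] DERIV_isCont
    by (intro continuous_at_imp_continuous_on) fastforce
  show ?thesis
  \<comment> \<open>The mass is at least 2/3 of the functional, so the rate \<gamma> for the mass
    becomes 2 \<gamma> / 3 for the functional.\<close>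
  proof (rule that[of "2 * \<gamma> / 3"])
    show "2 * \<gamma> / 3 > 0" using \<gamma> by simp
    fix \<nu> T M B :: real and f0 f and k m :: int
    assume \<nu>: "0 < \<nu>" "\<nu> < 1" and sol: "weak_solution b \<nu> f0 f" and T: "0 \<le> T"
      and M: "\<And>t. t \<in> {0..T} \<Longrightarrow> (LINT p|torus. (f t p)\<^sup>2) \<le> M"
      and B: "0 \<le> B" "\<And>y y'. \<bar>b y - b y'\<bar> \<le> B * cmod (cis (2 * pi * (y - y')) - 1)"
      and k: "k \<noteq> 0" and m: "1 \<le> m"
    have L2: "in_L2 (f s)" if "s \<ge> 0" for s using sol that by (simp add: weak_solution_def)
    define rt where "rt = \<nu> powr (real (N + 1) / real (N + 3))"
    define q where "q = 2 * pi * of_int k"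
    define \<rho> where "\<rho> = \<bar>q\<bar> * sqrt (M * (B\<^sup>2 * (4 / of_int m)))"
    define I where "I = {-m..m}"
    define \<sigma> where "\<sigma> = fejer_weight m"
    define a where "a = (\<lambda>s l. \<sigma> l * fcoeff (f s) (k, l))"
    define \<beta> where "\<beta> = (\<lambda>s l. fcoeff (\<lambda>p. f s p * b (snd p)) (k, l))"
    define a' where "a' = (\<lambda>s l. \<sigma> l * (- \<i> * q * \<beta> s l
        - \<nu> * (4 * pi\<^sup>2 * ((real_of_int k)\<^sup>2 + (real_of_int l)\<^sup>2)) * fcoeff (f s) (k, l)))"
    define G where "G = (\<lambda>s y. \<Sum>l\<in>I. a s l * wave l y)"
    define G1 where "G1 = (\<lambda>s y. \<Sum>l\<in>I. a s l * ((2 * pi * l * \<i>) * wave l y))"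
    define G2 where "G2 = (\<lambda>s y. \<Sum>l\<in>I. a s l * ((2 * pi * l * \<i>) * ((2 * pi * l * \<i>) * wave l y)))"
    define H where "H = (\<lambda>s y. \<Sum>l\<in>I. a' s l * wave l y)"
    \<comment> \<open>i q times the commutator: b times the smoothed mode, minus the smoothed mode
      of b f.\<close>
    define R where "R = (\<lambda>s y. \<i> * q * (\<Sum>l\<in>I. \<sigma> l * (b y * fcoeff (f s) (k, l) - \<beta> s l) * cis (2 * pi * l * y)))"
    have fin: "finite I" by (simp add: I_def)
    have M0: "0 \<le> M"
    proof -
      have "0 \<le> (LINT p|torus. (f 0 p)\<^sup>2)" by simp
      also have "\<dots> \<le> M" using M[of 0] T by simp
      finally show ?thesis .
    qed
    have rt: "rt \<ge> 0" by (simp add: rt_def)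
    have \<rho>: "\<rho> \<ge> 0" using M0 m by (simp add: \<rho>_def)
    have q: "1 \<le> \<bar>q\<bar>"
    proof -
      have "1 \<le> \<bar>k\<bar>" using k by simp
      then have "1 \<le> \<bar>real_of_int k\<bar>" by linarith
      then have "1 * 1 \<le> (2 * pi) * \<bar>real_of_int k\<bar>" using pi_gt3 by (intro mult_mono) auto
      then show ?thesis by (simp add: q_def abs_mult)
    qed
    obtain h w where hw: "hypocoercive b \<nu> \<theta> (\<gamma> * rt) h w"
      using hypo[OF \<nu>] unfolding rt_def by blast
    have w: "continuous_on UNIV w" using hw unfolding hypocoercive_def by (rule conjunct1)
    note hyp = hw[unfolded hypocoercive_def, THEN conjunct2, rule_format, OF q]
    have per1: "periodic_C1 (G s) (G1 s)" for s
    proof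
      show "G s (y + 1) = G s y" "G1 s (y + 1) = G1 s y" for y by (simp_all only: G_def G1_def wave_periodic)
      show "(G s has_vector_derivative G1 s y) (at y)" for y
        unfolding G_def G1_def by (intro has_vector_derivative_sum has_vector_derivative_mult_right wave_has_vector_derivative)
      show "continuous_on UNIV (G1 s)" unfolding G1_def by (intro continuous_intros continuous_wave)
    qed
    have der1: "(G1 s has_vector_derivative G2 s y) (at y)" for s y
      unfolding G1_def G2_def by (intro has_vector_derivative_sum has_vector_derivative_mult_right wave_has_vector_derivative)
    have cG: "continuous_on UNIV (G s)" and cG2: "continuous_on UNIV (G2 s)" and cH: "continuous_on UNIV (H s)" for s
      unfolding G_def G2_def H_def by (intro continuous_intros continuous_wave)+
    have cR: "continuous_on UNIV (R s)" for s unfolding R_def by (intro continuous_intros contb)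
    have Rb: "cmod (R s y) \<le> \<rho>" if s: "s \<in> {0..T}" for s y
    proof -
      have "(cmod (\<Sum>l\<in>I. \<sigma> l * (b y * fcoeff (f s) (k, l) - \<beta> s l) * cis (2 * pi * l * y)))\<^sup>2
          \<le> (LINT p|torus. (f s p)\<^sup>2) * (B\<^sup>2 * (\<Sum>l\<in>{-m..m + 1}. (\<sigma> (l - 1) - \<sigma> l)\<^sup>2))"
        unfolding I_def \<beta>_def \<sigma>_def
        by (rule multiplier_commutator_bound[OF L2 contb B]) (use s m fejer_weight_ends[OF m] in auto)
      also have "\<dots> \<le> M * (B\<^sup>2 * (4 / of_int m))"
        using M[OF s] fejer_weight_variation[OF m] M0 unfolding \<sigma>_def
        by (intro mult_mono mult_left_mono) (auto intro!: sum_nonneg mult_nonneg_nonneg)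
      finally have "cmod (\<Sum>l\<in>I. \<sigma> l * (b y * fcoeff (f s) (k, l) - \<beta> s l) * cis (2 * pi * l * y))
          \<le> sqrt (M * (B\<^sup>2 * (4 / of_int m)))" by (rule real_le_rsqrt)
      then show ?thesis unfolding R_def \<rho>_def norm_mult by (simp add: mult_left_mono)
    qed
    have Heq: "H s y = - \<i> * (q * b y) * G s y + \<nu> * (G2 s y - q\<^sup>2 * G s y) + R s y" for s y
    proof -
      have "a' s l * wave l y = - \<i> * (q * b y) * (a s l * wave l y)
          + \<nu> * (a s l * ((2 * pi * l * \<i>) * ((2 * pi * l * \<i>) * wave l y)) - q\<^sup>2 * (a s l * wave l y))
          + \<i> * q * (\<sigma> l * (b y * fcoeff (f s) (k, l) - \<beta> s l) * cis (2 * pi * l * y))" for l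
        unfolding a'_def a_def q_def wave_def by (simp add: algebra_simps power2_eq_square)
      then have "H s y = (\<Sum>l\<in>I. - \<i> * (q * b y) * (a s l * wave l y)
          + \<nu> * (a s l * ((2 * pi * l * \<i>) * ((2 * pi * l * \<i>) * wave l y)) - q\<^sup>2 * (a s l * wave l y))
          + \<i> * q * (\<sigma> l * (b y * fcoeff (f s) (k, l) - \<beta> s l) * cis (2 * pi * l * y)))"
        unfolding H_def by (simp only:)
      then show ?thesis
        unfolding G_def G2_def R_def by (simp only: sum.distrib sum_subtractf sum_distrib_left[symmetric])
    qed
    define N0 where "N0 = (\<lambda>s. integral {0..1} (\<lambda>y. (cmod (G s y))\<^sup>2))"
    \<comment> \<open>The factor 1 and the products with \<open>cnj\<close> give both terms of the
      functional the shape of \<open>integral_trig_form\<close>.\<close>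
    define F1 where "F1 = (\<lambda>s. integral {0..1} (\<lambda>y. 1 * (G s y * cnj (G s y))))"
    define F2 where "F2 = (\<lambda>s. integral {0..1} (\<lambda>y. complex_of_real (w y) * (G s (y + h) * cnj (G s y))))"
    define \<Phi> where "\<Phi> = (\<lambda>s. Re (F1 s) + \<theta> * (Im (F2 s) / q))"
    have N0eq: "N0 s = (\<Sum>l\<in>I. (cmod (a s l))\<^sup>2)" for s
      unfolding N0_def G_def by (rule norm_trig_sum_unit_interval[OF fin])
    have \<sigma>01: "0 \<le> \<sigma> l" "\<sigma> l \<le> 1" for l using fejer_weight_bounds[OF m] by (auto simp: \<sigma>_def)
    have a_le: "(cmod (a s l))\<^sup>2 \<le> (cmod (fcoeff (f s) (k, l)))\<^sup>2" for s l
      unfolding a_def norm_mult using \<sigma>01[of l] by (intro power_mono mult_left_le_one_le) auto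
    have N0M: "N0 s \<le> M" if s: "s \<in> {0..T}" for s
    proof -
      have "N0 s \<le> (\<Sum>l\<in>I. (cmod (fcoeff (f s) (k, l)))\<^sup>2)" unfolding N0eq by (intro sum_mono a_le)
      also have "\<dots> = (\<Sum>kl\<in>Pair k ` I. (cmod (fcoeff (f s) kl))\<^sup>2)"
        by (subst sum.reindex) (auto simp: inj_on_def)
      also have "\<dots> \<le> (LINT p|torus. (f s p)\<^sup>2)" using s fin by (intro Bessel L2) auto
      also have "\<dots> \<le> M" by (rule M[OF s])
      finally show ?thesis .
    qed
    have N00: "0 \<le> N0 s" for s unfolding N0eq by (intro sum_nonneg) auto
    have F1N: "Re (F1 s) = N0 s" for s
    proof -
      have c: "continuous_on UNIV (\<lambda>y. 1 * (G s y * cnj (G s y)))" by (intro continuous_intros cG)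
      have "(\<lambda>y. Re (1 * (G s y * cnj (G s y)))) = (\<lambda>y. (cmod (G s y))\<^sup>2)"
        unfolding mult_1 complex_norm_square[symmetric] by simp
      then show ?thesis using integral_Re_Im_unit_interval(1)[OF c] unfolding F1_def N0_def by simp
    qed
    have F2I: "Im (F2 s) = integral {0..1} (\<lambda>y. w y * Im (G s (y + h) * cnj (G s y)))" for s
    proof -
      have c: "continuous_on UNIV (\<lambda>y. complex_of_real (w y) * (G s (y + h) * cnj (G s y)))"
        by (intro continuous_intros cG w continuous_on_shift)
      show ?thesis unfolding F2_def integral_Re_Im_unit_interval(2)[OF c, symmetric] by simp
    qed
    note cw = continuous_wave continuous_wave_shift
    have wc: "continuous_on UNIV (\<lambda>y. complex_of_real (w y))" by (intro continuous_intros w)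
    have est: "\<bar>\<theta> * (Im (F2 s) / q)\<bar> \<le> N0 s / 2"
      "integral {0..1} (\<lambda>y. 2 * Re (cnj (G s y) * H s y))
          + \<theta> * (integral {0..1} (\<lambda>y. w y * Im (H s (y + h) * cnj (G s y) + G s (y + h) * cnj (H s y))) / q)
          \<le> - (\<gamma> * rt) * N0 s + 2 * \<rho> * (1 + N0 s)" if s: "s \<in> {0..T}" for s
      using hyp[OF per1[of s] der1 cG2 cR Rb[OF s] Heq] unfolding F2I N0_def by blast+
    have \<Phi>_bounds: "N0 s / 2 \<le> \<Phi> s" "\<Phi> s \<le> 3 / 2 * N0 s" if s: "s \<in> {0..T}" for s
      using est(1)[OF s] F1N[of s] unfolding \<Phi>_def by linarith+
    have ca: "continuous_on {0..T} (\<lambda>s. a s l)" for l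
      unfolding a_def by (intro continuous_intros fcoeff_continuous[OF sol])
    have c\<Phi>: "continuous_on {0..T} \<Phi>"
    proof -
      have "continuous_on {0..T} F1" unfolding F1_def G_def
        by (intro trig_form_continuous fin ca cw continuous_intros)
      moreover have "continuous_on {0..T} F2" unfolding F2_def G_def
        by (intro trig_form_continuous[where u = "\<lambda>l y. wave l (y + h)"] fin ca cw wc)
      ultimately show ?thesis unfolding \<Phi>_def using q by (intro continuous_intros) auto
    qed
    have "\<Phi> T \<le> exp (- (2 * \<gamma> / 3 * rt) * T) * \<Phi> 0 + 2 * \<rho> * (1 + M) * T"
    proof (rule Gronwall[OF T c\<Phi>])
      show "0 \<le> 2 * \<gamma> / 3 * rt" using \<gamma> rt by simp
      show "0 \<le> 2 * \<rho> * (1 + M)" using \<rho> M0 by simp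
      fix t assume t: "0 < t" "t < T"
      then have tT: "t \<in> {0..T}" by simp
      have da: "((\<lambda>s. a s l) has_vector_derivative a' t l) (at t)" for l
        unfolding a_def a'_def \<beta>_def q_def
        by (intro has_vector_derivative_mult_right) (use fcoeff_has_derivative[OF sol contb t(1), of k l] in simp)
      have d1: "(F1 has_vector_derivative
          integral {0..1} (\<lambda>y. 1 * (H t y * cnj (G t y))) + integral {0..1} (\<lambda>y. 1 * (G t y * cnj (H t y)))) (at t)"
        unfolding F1_def G_def H_def by (rule trig_form_has_derivative) (intro fin da cw continuous_intros)+
      have d2: "(F2 has_vector_derivative
          integral {0..1} (\<lambda>y. complex_of_real (w y) * (H t (y + h) * cnj (G t y)))
          + integral {0..1} (\<lambda>y. complex_of_real (w y) * (G t (y + h) * cnj (H t y)))) (at t)"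
        unfolding F2_def G_def H_def
        by (rule trig_form_has_derivative[where u = "\<lambda>l y. wave l (y + h)"]) (intro fin da cw wc)+
      let ?d1 = "integral {0..1} (\<lambda>y. 1 * (H t y * cnj (G t y))) + integral {0..1} (\<lambda>y. 1 * (G t y * cnj (H t y)))"
      let ?d2 = "integral {0..1} (\<lambda>y. complex_of_real (w y) * (H t (y + h) * cnj (G t y)))
          + integral {0..1} (\<lambda>y. complex_of_real (w y) * (G t (y + h) * cnj (H t y)))"
      have e1: "Re ?d1 = integral {0..1} (\<lambda>y. 2 * Re (cnj (G t y) * H t y))"
      proof -
        have c: "continuous_on UNIV (\<lambda>y. 1 * (H t y * cnj (G t y)))" "continuous_on UNIV (\<lambda>y. 1 * (G t y * cnj (H t y)))"
          by (intro continuous_intros cG cH)+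
        have "?d1 = integral {0..1} (\<lambda>y. 1 * (H t y * cnj (G t y)) + 1 * (G t y * cnj (H t y)))"
          by (intro integral_add[symmetric] integrable_unit_interval c)
        then have "Re ?d1 = integral {0..1} (\<lambda>y. Re (1 * (H t y * cnj (G t y)) + 1 * (G t y * cnj (H t y))))"
          using integral_Re_Im_unit_interval(1)[OF continuous_on_add[OF c]] by simp
        also have "(\<lambda>y. Re (1 * (H t y * cnj (G t y)) + 1 * (G t y * cnj (H t y)))) = (\<lambda>y. 2 * Re (cnj (G t y) * H t y))"
          by (simp add: algebra_simps)
        finally show ?thesis .
      qed
      have e2: "Im ?d2 = integral {0..1} (\<lambda>y. w y * Im (H t (y + h) * cnj (G t y) + G t (y + h) * cnj (H t y)))"
      proof -
        have c: "continuous_on UNIV (\<lambda>y. complex_of_real (w y) * (H t (y + h) * cnj (G t y)))"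
          "continuous_on UNIV (\<lambda>y. complex_of_real (w y) * (G t (y + h) * cnj (H t y)))"
          by (intro continuous_intros cG cH w continuous_on_shift)+
        have "?d2 = integral {0..1} (\<lambda>y. complex_of_real (w y) * (H t (y + h) * cnj (G t y)) + complex_of_real (w y) * (G t (y + h) * cnj (H t y)))"
          by (intro integral_add[symmetric] integrable_unit_interval c)
        then have "Im ?d2 = integral {0..1} (\<lambda>y. Im (complex_of_real (w y) * (H t (y + h) * cnj (G t y)) + complex_of_real (w y) * (G t (y + h) * cnj (H t y))))"
          using integral_Re_Im_unit_interval(2)[OF continuous_on_add[OF c]] by simp
        also have "(\<lambda>y. Im (complex_of_real (w y) * (H t (y + h) * cnj (G t y)) + complex_of_real (w y) * (G t (y + h) * cnj (H t y))))
            = (\<lambda>y. w y * Im (H t (y + h) * cnj (G t y) + G t (y + h) * cnj (H t y)))"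
          by (simp add: algebra_simps)
        finally show ?thesis .
      qed
      have "(\<Phi> has_real_derivative (Re ?d1 + \<theta> * (Im ?d2 / q))) (at t)"
      proof -
        have r1: "((\<lambda>s. Re (F1 s)) has_real_derivative Re ?d1) (at t)"
          unfolding has_real_derivative_iff_has_vector_derivative
          by (rule bounded_linear.has_vector_derivative[OF bounded_linear_Re d1])
        have r2: "((\<lambda>s. Im (F2 s)) has_real_derivative Im ?d2) (at t)"
          unfolding has_real_derivative_iff_has_vector_derivative
          by (rule bounded_linear.has_vector_derivative[OF bounded_linear_Im d2])
        show ?thesis unfolding \<Phi>_def by (intro DERIV_add r1 DERIV_cmult DERIV_cdivide r2)
      qed
      moreover have "Re ?d1 + \<theta> * (Im ?d2 / q) \<le> - (2 * \<gamma> / 3 * rt) * \<Phi> t + 2 * \<rho> * (1 + M)"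
      proof -
        have "Re ?d1 + \<theta> * (Im ?d2 / q) \<le> - (\<gamma> * rt) * N0 t + 2 * \<rho> * (1 + N0 t)"
          unfolding e1 e2 by (rule est(2)[OF tT])
        also have "\<dots> \<le> - (2 * \<gamma> / 3 * rt) * \<Phi> t + 2 * \<rho> * (1 + M)"
        proof (rule add_mono)
          have "2 * \<gamma> / 3 * rt * \<Phi> t \<le> 2 * \<gamma> / 3 * rt * (3 / 2 * N0 t)"
            using \<gamma> rt \<Phi>_bounds(2)[OF tT] by (intro mult_left_mono) auto
          then show "- (\<gamma> * rt) * N0 t \<le> - (2 * \<gamma> / 3 * rt) * \<Phi> t" by simp
          show "2 * \<rho> * (1 + N0 t) \<le> 2 * \<rho> * (1 + M)" using \<rho> N0M[OF tT] by (intro mult_left_mono) auto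
        qed
        finally show ?thesis .
      qed
      ultimately show "\<exists>d. (\<Phi> has_real_derivative d) (at t) \<and> d \<le> - (2 * \<gamma> / 3 * rt) * \<Phi> t + 2 * \<rho> * (1 + M)" by blast
    qed
    moreover have "exp (- (2 * \<gamma> / 3 * rt) * T) * \<Phi> 0 \<le> exp (- (2 * \<gamma> / 3 * rt) * T) * (3 / 2 * N0 0)"
      using \<Phi>_bounds(2)[of 0] T by (intro mult_left_mono) auto
    ultimately have "N0 T \<le> 3 * exp (- (2 * \<gamma> / 3 * rt) * T) * N0 0 + 4 * \<rho> * (1 + M) * T"
    proof -
      assume A: "\<Phi> T \<le> exp (- (2 * \<gamma> / 3 * rt) * T) * \<Phi> 0 + 2 * \<rho> * (1 + M) * T"
        "exp (- (2 * \<gamma> / 3 * rt) * T) * \<Phi> 0 \<le> exp (- (2 * \<gamma> / 3 * rt) * T) * (3 / 2 * N0 0)"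
      have "N0 T / 2 \<le> \<Phi> T" using \<Phi>_bounds(1)[of T] T by simp
      with A show ?thesis by linarith
    qed
    also have "\<dots> \<le> 3 * exp (- (2 * \<gamma> / 3 * rt) * T) * (\<Sum>l\<in>I. (cmod (fcoeff (f 0) (k, l)))\<^sup>2) + 4 * \<rho> * (1 + M) * T"
      unfolding N0eq by (intro add_right_mono mult_left_mono sum_mono a_le) auto
    also have "N0 T = (\<Sum>l\<in>I. (fejer_weight m l * cmod (fcoeff (f T) (k, l)))\<^sup>2)"
      unfolding N0eq a_def norm_mult using \<sigma>01 by (simp add: \<sigma>_def)
    finally show "(\<Sum>l\<in>{-m..m}. (fejer_weight m l * cmod (fcoeff (f T) (k, l)))\<^sup>2) \<le>
      3 * exp (- (2 * \<gamma> / 3) * \<nu> powr (real (N + 1) / real (N + 3)) * T) * (\<Sum>l\<in>{-m..m}. (cmod (fcoeff (f 0) (k, l)))\<^sup>2)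
        + 4 * (\<bar>2 * pi * of_int k\<bar> * sqrt (M * (B\<^sup>2 * (4 / of_int m)))) * (1 + M) * T"
      unfolding I_def rt_def \<rho>_def q_def by (simp add: mult.assoc)
  qed
qed

subsection \<open>Dissipation enhancement\<close>

lemma fcoeff_cong_AE:
  assumes "in_L2 f" "in_L2 g" "AE p in torus. f p = g p"
  shows "fcoeff f kl = fcoeff g kl"
  unfolding fcoeff_def
proof (rule integral_cong_AE)
  have [measurable]: "f \<in> borel_measurable torus" "g \<in> borel_measurable torus" using assms by (auto simp: in_L2_def)
  have [measurable]: "(\<lambda>p. cnj (fourier_char kl p)) \<in> borel_measurable torus"
    by (intro continuous_measurable_torus continuous_intros continuous_fourier_char)
  show "(\<lambda>p. complex_of_real (f p) * cnj (fourier_char kl p)) \<in> borel_measurable torus"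
    "(\<lambda>p. complex_of_real (g p) * cnj (fourier_char kl p)) \<in> borel_measurable torus" by measurable
  show "AE p in torus. complex_of_real (f p) * cnj (fourier_char kl p) = complex_of_real (g p) * cnj (fourier_char kl p)"
    using assms(3) by eventually_elim simp
qed

text \<open>The character of frequency (0, l) is constant in x, so Fubini with x integrated first
  meets the mean in x.\<close>

lemma fcoeff_zero_mean:
  assumes f: "in_L2 f" and mean: "AE y in circle. (LINT x|circle. f (x, y)) = 0"
  shows "fcoeff f (0, l) = 0"
proof -
  let ?g = "\<lambda>x y. complex_of_real (f (x, y)) * cnj (fourier_char (0, l) (x, y))"
  have eq: "(\<lambda>p. of_real (f p) * cnj (fourier_char (0, l) p)) = case_prod ?g" by auto
  have "integrable torus (\<lambda>p. of_real (f p) * cnj (fourier_char (0, l) p))"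
    by (intro integrable_L2_continuous[OF f] continuous_intros continuous_fourier_char)
  then have "integrable (circle \<Otimes>\<^sub>M circle) (case_prod ?g)" unfolding eq torus_def .
  then have "fcoeff f (0, l) = (LINT y|circle. LINT x|circle. ?g x y)"
    unfolding fcoeff_def eq torus_def by (rule torus.integral_snd[symmetric])
  also have "\<dots> = (LINT y|circle. complex_of_real (LINT x|circle. f (x, y)) * cnj (cis (2 * pi * l * y)))"
    by (simp add: fourier_char_def mult.assoc)
  also have "\<dots> = 0"
    by (rule integral_eq_zero_AE) (use mean in eventually_elim, simp)
  finally show ?thesis .
qed

text \<open>The cross term divides by q, so k = 0 is treated apart. Transport is absent there, the
  coefficients obey a heat equation and their moduli cannot grow; \<open>Gronwall\<close> is used
  with rate and error zero.\<close>

lemma zero_mode_vanishes: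
  assumes sol: "weak_solution b \<nu> f0 f" and f0: "in_L2 f0" and contb: "continuous_on UNIV b"
    and mean: "AE y in circle. (LINT x|circle. f0 (x, y)) = 0" and T: "0 \<le> T" and \<nu>: "0 < \<nu>"
  shows "fcoeff (f T) (0, l) = 0"
proof -
  let ?c = "\<lambda>t. fcoeff (f t) (0, l)"
  have "(cmod (?c T))\<^sup>2 \<le> exp (- 0 * T) * (cmod (?c 0))\<^sup>2 + 0 * T"
  proof (rule Gronwall[OF T, of "\<lambda>t. (cmod (?c t))\<^sup>2"])
    show "continuous_on {0..T} (\<lambda>t. (cmod (?c t))\<^sup>2)"
      by (intro continuous_intros fcoeff_continuous[OF sol])
    fix t assume t: "0 < t" "t < T"
    let ?K = "\<nu> * (4 * pi\<^sup>2 * (real_of_int l)\<^sup>2)"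
    have d: "(?c has_vector_derivative - ?K * ?c t) (at t)"
      using fcoeff_has_derivative[OF sol contb t(1), of 0 l] by simp
    have "((\<lambda>s. Re (?c s * cnj (?c s))) has_vector_derivative Re (?c t * cnj (- ?K * ?c t) + (- ?K * ?c t) * cnj (?c t))) (at t)"
      by (intro bounded_linear.has_vector_derivative[OF bounded_linear_Re] has_vector_derivative_mult
          has_vector_derivative_cnj d)
    moreover have "(\<lambda>s. Re (?c s * cnj (?c s))) = (\<lambda>s. (cmod (?c s))\<^sup>2)"
      unfolding complex_norm_square[symmetric] by simp
    moreover have "Re (?c t * cnj (- ?K * ?c t) + (- ?K * ?c t) * cnj (?c t)) = - 2 * ?K * (cmod (?c t))\<^sup>2"
      unfolding cmod_power2 by (simp add: power2_eq_square algebra_simps)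
    ultimately have "((\<lambda>s. (cmod (?c s))\<^sup>2) has_real_derivative - 2 * ?K * (cmod (?c t))\<^sup>2) (at t)"
      unfolding has_real_derivative_iff_has_vector_derivative by (simp only:)
    moreover have "- 2 * ?K * (cmod (?c t))\<^sup>2 \<le> - 0 * (cmod (?c t))\<^sup>2 + 0"
      using \<nu> by (simp add: mult_nonneg_nonneg)
    ultimately show "\<exists>d. ((\<lambda>s. (cmod (?c s))\<^sup>2) has_real_derivative d) (at t) \<and> d \<le> - 0 * (cmod (?c t))\<^sup>2 + 0" by blast
  qed auto
  moreover have "?c 0 = 0"
    using fcoeff_cong_AE[of "f 0" f0 "(0, l)"] fcoeff_zero_mean[OF f0 mean, of l] sol f0
    by (auto simp: weak_solution_def)
  ultimately show ?thesis by simp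
qed

text \<open>The order of limits matters: for a finite set of modes at fixed T, the Fejer index tends
  to infinity and removes both the weights and the commutator errors; only then does Parseval
  exhaust the norm. Bessel's inequality makes the bound independent of the finite set.\<close>

lemma weak_solution_decay:
  assumes sm: "smooth b" and per: "\<And>x. b (x + 1) = b x"
    and nz: "\<And>y. \<exists>k\<in>{1..N + 1}. (deriv ^^ k) b y \<noteq> 0"
  obtains c where "c > 0"
    "\<And>\<nu> f0 f T. 0 < \<nu> \<Longrightarrow> \<nu> < 1 \<Longrightarrow> in_L2 f0 \<Longrightarrow> (AE y in circle. (LINT x|circle. f0 (x, y)) = 0) \<Longrightarrow>
      weak_solution b \<nu> f0 f \<Longrightarrow> 0 \<le> T \<Longrightarrow>
      (LINT p|torus. (f T p)\<^sup>2) \<le> 3 * exp (- c * \<nu> powr (real (N + 1) / real (N + 3)) * T) * (LINT p|torus. (f0 p)\<^sup>2)"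
proof -
  obtain c where c: "c > 0" and decay:
    "\<And>\<nu> f0 f T M B k m. 0 < \<nu> \<Longrightarrow> \<nu> < 1 \<Longrightarrow> weak_solution b \<nu> f0 f \<Longrightarrow> 0 \<le> T \<Longrightarrow>
      (\<And>t. t \<in> {0..T} \<Longrightarrow> (LINT p|torus. (f t p)\<^sup>2) \<le> M) \<Longrightarrow>
      0 \<le> B \<Longrightarrow> (\<And>y y'. \<bar>b y - b y'\<bar> \<le> B * cmod (cis (2 * pi * (y - y')) - 1)) \<Longrightarrow>
      k \<noteq> 0 \<Longrightarrow> 1 \<le> m \<Longrightarrow>
      (\<Sum>l\<in>{-m..m}. (fejer_weight m l * cmod (fcoeff (f T) (k, l)))\<^sup>2) \<le>
      3 * exp (- c * \<nu> powr (real (N + 1) / real (N + 3)) * T) * (\<Sum>l\<in>{-m..m}. (cmod (fcoeff (f 0) (k, l)))\<^sup>2)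
        + 4 * (\<bar>2 * pi * of_int k\<bar> * sqrt (M * (B\<^sup>2 * (4 / of_int m)))) * (1 + M) * T"
    by (rule mode_decay[OF sm per nz]) blast
  obtain B where B: "B > 0" "\<And>y y'. \<bar>b y - b y'\<bar> \<le> B * cmod (cis (2 * pi * (y - y')) - 1)"
    by (rule periodic_Lipschitz_chord[OF sm per]) blast
  have contb: "continuous_on UNIV b"
    using smooth_has_derivative[OF sm, of 0] DERIV_isCont
    by (intro continuous_at_imp_continuous_on) fastforce
  show ?thesis
  proof (rule that[OF c])
    fix \<nu> T :: real and f0 f
    assume \<nu>: "0 < \<nu>" "\<nu> < 1" and f0: "in_L2 f0" and mean: "AE y in circle. (LINT x|circle. f0 (x, y)) = 0"
      and sol: "weak_solution b \<nu> f0 f" and T: "0 \<le> T"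
    define X where "X = 3 * exp (- c * \<nu> powr (real (N + 1) / real (N + 3)) * T)"
    have X: "X \<ge> 0" by (simp add: X_def)
    have L2: "in_L2 (f s)" if "s \<ge> 0" for s using sol that by (simp add: weak_solution_def)
    obtain M where M: "\<And>t. t \<in> {0..T} \<Longrightarrow> (LINT p|torus. (f t p)\<^sup>2) \<le> M"
      using weak_solution_norm_bounded[OF sol, of T] by blast
    have c0: "fcoeff (f 0) kl = fcoeff f0 kl" for kl
      using sol f0 by (intro fcoeff_cong_AE) (auto simp: weak_solution_def)
    let ?c = "\<lambda>kl. cmod (fcoeff (f T) kl)"
    have partial: "(\<Sum>kl\<in>S. (?c kl)\<^sup>2) \<le> X * (LINT p|torus. (f0 p)\<^sup>2)" if S: "finite S" for S
    proof (rule LIMSEQ_le)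
      let ?K = "fst ` S - {0}"
      let ?err = "\<lambda>n. \<Sum>k\<in>?K. 4 * (\<bar>2 * pi * of_int k\<bar> * sqrt (M * (B\<^sup>2 * (4 / real_of_int (int (Suc n)))))) * (1 + M) * T"
      show "(\<lambda>n. \<Sum>kl\<in>S. (fejer_weight (int (Suc n)) (snd kl) * ?c kl)\<^sup>2) \<longlonglongrightarrow> (\<Sum>kl\<in>S. (?c kl)\<^sup>2)"
      proof (rule tendsto_sum)
        fix kl
        have "(\<lambda>n. (fejer_weight (int (Suc n)) (snd kl) * ?c kl)\<^sup>2) \<longlonglongrightarrow> (1 * ?c kl)\<^sup>2"
          by (intro tendsto_intros fejer_weight_tendsto)
        then show "(\<lambda>n. (fejer_weight (int (Suc n)) (snd kl) * ?c kl)\<^sup>2) \<longlonglongrightarrow> (?c kl)\<^sup>2" by simp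
      qed
      have "?err \<longlonglongrightarrow> (\<Sum>k\<in>?K. 4 * (\<bar>2 * pi * of_int k\<bar> * sqrt (M * (B\<^sup>2 * (4 * 0)))) * (1 + M) * T)"
        unfolding divide_inverse of_int_of_nat_eq
        by (intro tendsto_sum tendsto_intros LIMSEQ_inverse_real_of_nat)
      then have "?err \<longlonglongrightarrow> 0" by simp
      then show "(\<lambda>n. X * (LINT p|torus. (f0 p)\<^sup>2) + ?err n) \<longlonglongrightarrow> X * (LINT p|torus. (f0 p)\<^sup>2)"
        using tendsto_add[OF tendsto_const] by fastforce
      have "(\<Sum>kl\<in>S. (fejer_weight (int (Suc n)) (snd kl) * ?c kl)\<^sup>2) \<le> X * (LINT p|torus. (f0 p)\<^sup>2) + ?err n" for n
      proof -
        define m where "m = int (Suc n)"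
        have m: "1 \<le> m" by (simp add: m_def)
        let ?g = "\<lambda>kl. (fejer_weight m (snd kl) * ?c kl)\<^sup>2"
        have fK: "finite ?K" using S by simp
        \<comment> \<open>The discarded pairs contribute nothing: k = 0 by
          \<open>zero_mode_vanishes\<close>, and |l| > m because the Fejer weight is zero
          there.\<close>
        have "(\<Sum>kl\<in>S. ?g kl) = (\<Sum>kl\<in>S \<inter> (?K \<times> {-m..m}). ?g kl)"
        proof (intro sum.mono_neutral_right S ballI)
          fix kl assume kl: "kl \<in> S - S \<inter> (?K \<times> {-m..m})"
          obtain k l where kleq: "kl = (k, l)" by (cases kl)
          have "k = 0 \<or> \<bar>l\<bar> > m" using kl unfolding kleq by (force simp: image_iff)
          then show "?g kl = 0"
          proof
            assume "k = 0"
            then show ?thesis using zero_mode_vanishes[OF sol f0 contb mean T \<nu>(1)] by (simp add: kleq)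
          next
            assume "\<bar>l\<bar> > m"
            then have "real_of_int \<bar>l\<bar> > real_of_int m" by (simp only: of_int_less_iff)
            then have "fejer_weight m l = 0" using m by (simp add: fejer_weight_def field_simps)
            then show ?thesis by (simp add: kleq)
          qed
        qed auto
        also have "\<dots> \<le> (\<Sum>kl\<in>?K \<times> {-m..m}. ?g kl)" using fK by (intro sum_mono2) auto
        also have "\<dots> = (\<Sum>k\<in>?K. \<Sum>l\<in>{-m..m}. (fejer_weight m l * ?c (k, l))\<^sup>2)"
          by (simp add: sum.cartesian_product split_beta)
        also have "\<dots> \<le> (\<Sum>k\<in>?K. X * (\<Sum>l\<in>{-m..m}. (cmod (fcoeff (f 0) (k, l)))\<^sup>2)
            + 4 * (\<bar>2 * pi * of_int k\<bar> * sqrt (M * (B\<^sup>2 * (4 / of_int m)))) * (1 + M) * T)"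
          unfolding X_def
        proof (rule sum_mono)
          fix k assume "k \<in> ?K"
          then have "k \<noteq> 0" by simp
          from decay[OF \<nu> sol T M less_imp_le[OF B(1)] B(2) this m]
          show "(\<Sum>l\<in>{-m..m}. (fejer_weight m l * ?c (k, l))\<^sup>2) \<le>
            3 * exp (- c * \<nu> powr (real (N + 1) / real (N + 3)) * T) * (\<Sum>l\<in>{-m..m}. (cmod (fcoeff (f 0) (k, l)))\<^sup>2)
            + 4 * (\<bar>2 * pi * of_int k\<bar> * sqrt (M * (B\<^sup>2 * (4 / of_int m)))) * (1 + M) * T" by simp
        qed
        also have "\<dots> = X * (\<Sum>k\<in>?K. \<Sum>l\<in>{-m..m}. (cmod (fcoeff f0 (k, l)))\<^sup>2) + ?err n"
          unfolding sum.distrib sum_distrib_left[symmetric] c0 m_def by simp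
        also have "(\<Sum>k\<in>?K. \<Sum>l\<in>{-m..m}. (cmod (fcoeff f0 (k, l)))\<^sup>2) = (\<Sum>kl\<in>?K \<times> {-m..m}. (cmod (fcoeff f0 kl))\<^sup>2)"
          by (simp add: sum.cartesian_product split_beta)
        also have "X * (\<Sum>kl\<in>?K \<times> {-m..m}. (cmod (fcoeff f0 kl))\<^sup>2) + ?err n \<le> X * (LINT p|torus. (f0 p)\<^sup>2) + ?err n"
          using fK X by (intro add_right_mono mult_left_mono Bessel f0) auto
        finally show ?thesis unfolding m_def .
      qed
      then show "\<exists>N. \<forall>n\<ge>N. (\<Sum>kl\<in>S. (fejer_weight (int (Suc n)) (snd kl) * ?c kl)\<^sup>2) \<le> X * (LINT p|torus. (f0 p)\<^sup>2) + ?err n"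
        by blast
    qed
    have "(LINT p|torus. (f T p)\<^sup>2) \<le> X * (LINT p|torus. (f0 p)\<^sup>2) + e" if e: "e > 0" for e
    proof -
      obtain S where "finite S" "(LINT p|torus. (f T p)\<^sup>2) \<le> (\<Sum>kl\<in>S. (?c kl)\<^sup>2) + e"
        using Parseval_approximation[OF L2[OF T] e] by blast
      then show ?thesis using partial[of S] by linarith
    qed
    then show "(LINT p|torus. (f T p)\<^sup>2) \<le> 3 * exp (- c * \<nu> powr (real (N + 1) / real (N + 3)) * T) * (LINT p|torus. (f0 p)\<^sup>2)"
      unfolding X_def by (rule field_le_epsilon)
  qed
qed

theorem corollary1:
  fixes b :: "real \<Rightarrow> real" and N :: nat
  assumes "periodic_fun_simple' b"
    and "smooth b"
    and "finite (circle_critical_points b)"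
    and "nondegeneracy_bound b N"
    and "\<And>n. nondegeneracy_bound b n \<Longrightarrow> N \<le> n"
  shows "shear_dissipation_enhancing b (\<lambda>\<nu>. \<nu> powr (real (N + 1) / real (N + 3)))"
proof -
  have per: "b (x + 1) = b x" for x
  proof -
    interpret periodic_fun_simple' b by (rule assms(1))
    show ?thesis by (rule plus_1)
  qed
  \<comment> \<open>Periodicity carries the assumption from critical points in [0,1) to all critical
    points; elsewhere k = 1 serves.\<close>
  have nz: "\<exists>k\<in>{1..N + 1}. (deriv ^^ k) b y \<noteq> 0" for y
  proof (cases "deriv b y = 0")
    case True
    have pd: "(deriv ^^ k) b (frac y) = (deriv ^^ k) b y" for k
      by (rule periodic_frac[of "(deriv ^^ k) b", OF periodic_iterated_deriv[of b, OF per]])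
    have "frac y \<in> circle_critical_points b"
      using True pd[of 1] by (simp add: circle_critical_points_def frac_lt_1)
    then show ?thesis using assms(4) pd unfolding nondegeneracy_bound_def by metis
  next
    case False
    then show ?thesis by (intro bexI[of _ 1]) auto
  qed
  obtain c where c: "c > 0" and decay: "\<And>\<nu> f0 f T. 0 < \<nu> \<Longrightarrow> \<nu> < 1 \<Longrightarrow> in_L2 f0 \<Longrightarrow>
      (AE y in circle. (LINT x|circle. f0 (x, y)) = 0) \<Longrightarrow> weak_solution b \<nu> f0 f \<Longrightarrow> 0 \<le> T \<Longrightarrow>
      (LINT p|torus. (f T p)\<^sup>2) \<le> 3 * exp (- c * \<nu> powr (real (N + 1) / real (N + 3)) * T) * (LINT p|torus. (f0 p)\<^sup>2)"
    by (rule weak_solution_decay[OF assms(2) per nz]) blast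
  let ?r = "\<lambda>\<nu>::real. \<nu> powr (real (N + 1) / real (N + 3))"
  have lim: "((\<lambda>\<nu>. \<nu> / ?r \<nu>) \<longlongrightarrow> 0) (at_right 0)"
  proof -
    \<comment> \<open>The quotient of \<nu> by the rate has the positive exponent 1 - (N+1)/(N+3) =
      2/(N+3).\<close>
    have "((\<lambda>\<nu>::real. \<nu> powr (2 / real (N + 3))) \<longlongrightarrow> 0 powr (2 / real (N + 3))) (at_right 0)"
      by (intro tendsto_powr2 tendsto_ident_at tendsto_const) (auto simp: eventually_at_filter)
    then have "((\<lambda>\<nu>::real. \<nu> powr (2 / real (N + 3))) \<longlongrightarrow> 0) (at_right 0)" by simp
    moreover have "eventually (\<lambda>\<nu>::real. \<nu> powr (2 / real (N + 3)) = \<nu> / ?r \<nu>) (at_right 0)"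
    proof (rule eventually_at_right_less[of 0, THEN eventually_mono])
      fix \<nu> :: real assume \<nu>: "0 < \<nu>"
      have "2 / real (N + 3) = 1 - real (N + 1) / real (N + 3)" by (simp add: field_simps)
      then show "\<nu> powr (2 / real (N + 3)) = \<nu> / ?r \<nu>" using \<nu> by (simp only: powr_diff powr_one)
    qed
    ultimately show ?thesis by (rule Lim_transform_eventually)
  qed
  \<comment> \<open>\<open>decay\<close> concerns squared norms, hence sqrt 3 and c / 2.\<close>
  have main: "L2_norm (f t) \<le> sqrt 3 * exp (- (c / 2) * ?r \<nu> * t) * L2_norm f0"
    if "\<nu> \<in> {0<..<1}" "in_L2 f0" "AE y in circle. (LINT x|circle. f0 (x, y)) = 0" "weak_solution b \<nu> f0 f" "t \<ge> 0"
    for \<nu> f0 f t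
  proof (rule power2_le_imp_le)
    have "(L2_norm (f t))\<^sup>2 \<le> 3 * exp (- c * ?r \<nu> * t) * (L2_norm f0)\<^sup>2"
      unfolding L2_norm_power2 using that by (intro decay) auto
    also have "exp (- c * ?r \<nu> * t) = (exp (- (c / 2) * ?r \<nu> * t))\<^sup>2"
      by (simp add: power2_eq_square flip: exp_add)
    finally show "(L2_norm (f t))\<^sup>2 \<le> (sqrt 3 * exp (- (c / 2) * ?r \<nu> * t) * L2_norm f0)\<^sup>2"
      by (simp add: power_mult_distrib)
  qed (simp add: L2_norm_nonneg)
  show ?thesis
    unfolding shear_dissipation_enhancing_def
  proof (intro conjI lim)
    show "\<forall>\<nu>\<in>{0<..<1}. 0 < ?r \<nu>" by simp
    show "\<exists>C>0. \<exists>c>0. \<forall>\<nu>\<in>{0<..<1}. \<forall>f0 f.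
        in_L2 f0 \<longrightarrow> (AE y in circle. (LINT x|circle. f0 (x, y)) = 0) \<longrightarrow>
        weak_solution b \<nu> f0 f \<longrightarrow>
        (\<forall>t\<ge>0. L2_norm (f t) \<le> C * exp (- c * ?r \<nu> * t) * L2_norm f0)"
      using c main by (intro exI[of _ "sqrt 3"] conjI exI[of _ "c / 2"]) auto
  qed
qed

end
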